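(* Assume the semiparametric model satisfies the standing assumptions A1--A7 of the context. If $\tilde\theta_n$ is a random sequence satisfying $\tilde\theta_n-\hat\theta_n=o_P(1)$, then $$\log pl_n(\tilde\theta_n)=\log pl_n(\hat\theta_n)-\frac n2(\tilde\theta_n-\hat\theta_n)^2\tilde I_0+O_P\big(n|\tilde\theta_n-\hat\theta_n|^3+n^{-1/2}\big),$$ $$\sqrt n(\hat\theta_n-\theta_0)=\frac1{\sqrt n}\sum_{i=1}^n\tilde\ell_0(X_i)\tilde I_0^{-1}+O_P(n^{-1/2}).$$
   Context: Setting. The data $X_1,\dots,X_n$ are i.i.d. with values in a sample space $\mathcal X$, from a semiparametric model $\{p_{\theta,\eta}:\theta\in\Theta,\eta\in\mathcal H\}$ with $\Theta\subset\mathbb R$ and $\mathcal H$ an arbitrary (typically infinite-dimensional) set equipped with a norm $\|\cdot\|$; $(\theta_0,\eta_0)$ is the true parameter and $P=P_{\theta_0,\eta_0}$ the true law. $\mathrm{lik}(\theta,\eta)(x)$ is the likelihood of one observation, and $\mathrm{lik}_n(\theta,\eta)=\prod_{i=1}^n\mathrm{lik}(\theta,\eta)(X_i)$. The profile likelihood is $pl_n(\theta)=\sup_\eta \mathrm{lik}_n(\theta,\eta)$; $\hat\eta_\theta=\arg\max_\eta \mathrm{lik}_n(\theta,\eta)$; $(\hat\theta_n,\hat\eta_n)$, $\hat\eta_n=\hat\eta_{\hat\theta_n}$, is the maximum likelihood estimator for the full likelihood. Operator notation: $Pf=\int f\,dP$, $\mathbb P_nf=n^{-1}\sum_{i=1}^n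 f(X_i)$, $\mathbb G_nf=n^{-1/2}\sum_{i=1}^n(f(X_i)-Pf)$. Efficient score: $\tilde\ell_{\theta,\eta}=\dot\ell_{\theta,\eta}-\Pi_{\theta,\eta}\dot\ell_{\theta,\eta}$, where $\dot\ell_{\theta,\eta}$ is the score for $\theta$ (partial derivative of the log-likelihood in $\theta$, $\eta$ fixed) and $\Pi_{\theta,\eta}$ is the $L_2(P_{\theta,\eta})$-projection onto the closed linear span of the score functions for $\eta$. $\tilde I_{\theta,\eta}$ is the variance of $\tilde\ell_{\theta,\eta}$. Write $\tilde\ell_0=\tilde\ell_{\theta_0,\eta_0}$, $\tilde I_0=\tilde I_{\theta_0,\eta_0}=P\tilde\ell_0^2$. Least favorable submodel: a map $t\mapsto\eta_t(\theta,\eta)$ from a neighborhood of $\theta$ into $\mathcal H$ is given, and $\ell(t,\theta,\eta)(x)=\log\mathrm{lik}(t,\eta_t(\theta,\eta))(x)$. $\dot\ell,\ddot\ell,\ell^{(3)}$ denote the first, second and third derivatives of $\ell(t,\theta,\eta)$ in $t$; $\ell_{t,\theta}(t,\theta,\eta)$ is the derivative of $\dot\ell(t,\theta,\eta)$ in $\theta$. $\dot\ell_0=\dot\ell(\theta_0,\theta_0,\eta_0)$, $\ddot\ell_0=\ddot\ell(\theta_0,\theta_0,\eta_0)$. The submodel is least favorable at $(\theta_0,\eta_0)$, i.e. $\dot\ell_0=\tilde\ell_0$. Standing assumptions: A1. $\Theta\subset\mathbb R$ is compact and $\theta_0$ is an interior point of $\Theta$. A2. $\eta_\theta(\theta,\eta)=\eta$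 for all $(\theta,\eta)\in\Theta\times\mathcal H$. A3. $\|\hat\eta_{\tilde\theta_n}-\eta_0\|=O_P(n^{-1/2}+|\tilde\theta_n-\theta_0|)$ whenever $\tilde\theta_n=\theta_0+o_P(1)$. A4. The maps $(t,\theta,\eta)\mapsto\frac{\partial^{l+m}}{\partial t^l\partial\theta^m}\ell(t,\theta,\eta)$ have integrable envelope functions in $L_1(P)$ in some neighborhood of $(\theta_0,\theta_0,\eta_0)$ for $(l,m)=(0,0),(1,0),(2,0),(3,0),(1,1),(1,2),(2,1)$. This smoothness is taken to imply $-P\dot\ell_0^2=P\ddot\ell_0$ and $\frac{\partial}{\partial\theta}P\dot\ell(\theta_0,\theta,\eta_0)|_{\theta=\theta_0}=0$. A5. There is a neighborhood $V$ of $(\theta_0,\theta_0,\eta_0)$ in $\Theta\times\Theta\times\mathcal H$ such that $\{\ddot\ell(t,\theta,\eta):(t,\theta,\eta)\in V\}$ and $\{\ell_{t,\theta}(t,\theta,\eta):(t,\theta,\eta)\in V\}$ are $P$-Donsker and $\{\ell^{(3)}(t,\theta,\eta):(t,\theta,\eta)\in V\}$ is $P$-Glivenko--Cantelli. A6. For all $\eta$ in some neighborhood of $\eta_0$: $\mathbb G_n(\dot\ell(\theta_0,\theta_0,\eta)-\dot\ell_0)=O_P(\|\eta-\eta_0\|)$; $P\ddot\ell(\theta_0,\theta_0,\eta)-P\ddot\ell(\theta_0,\theta_0,\eta_0)=O(\|\eta-\eta_0\|)$; $P\ell_{t,\theta}(\theta_0,\theta_0,\eta)-P\ell_{t,\theta}(\theta_0,\theta_0,\eta_0)=O(\|\eta-\eta_0\|)$;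 $P\dot\ell(\theta_0,\theta_0,\eta)=O(\|\eta-\eta_0\|^2)$. A7. $\tilde I_0>0$.
   Formalization: Consistency of the maximum likelihood estimator, θ̂_n = θ_0 + o_P(1), is added as a hypothesis; A1–A7 are local and do not imply it, and without it the claim fails (e.g. non-identifiable models), while the second display itself forces it. *)

theory Defs
  imports "HOL-Probability.Probability" "HOL-Probability.Discrete_Topology"
begin

subsection \<open>Stochastic order symbols\<close>

text \<open>
  Suprema over function classes and functionals of maximisers need not be measurable, so the
  stochastic order symbols use outer probability. On measurable sets outer probability is
  probability.
\<close>

definition O_P :: "'w measure \<Rightarrow> (nat \<Rightarrow> 'w \<Rightarrow> real) \<Rightarrow> (nat \<Rightarrow> 'w \<Rightarrow> real) \<Rightarrow> bool" where
  "O_P M Z R \<longleftrightarrow> (\<forall>\<epsilon>>0. \<exists>C. \<forall>\<^sub>F n in sequentially.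
     outer_measure_of M {\<omega> \<in> space M. \<not> \<bar>Z n \<omega>\<bar> \<le> C * R n \<omega>} \<le> ennreal \<epsilon>)"

text \<open>
  \<open>Z\<^sub>n(h) = O\<^sub>P(R(h))\<close> for all \<open>h \<in> U\<close>, with the bound holding for all \<open>h\<close> on one and the same
  event, so that a random \<open>h\<close> may be substituted.
\<close>

definition O_P_on ::
  "'w measure \<Rightarrow> 'i set \<Rightarrow> (nat \<Rightarrow> 'i \<Rightarrow> 'w \<Rightarrow> real) \<Rightarrow> ('i \<Rightarrow> real) \<Rightarrow> bool" where
  "O_P_on M U Z R \<longleftrightarrow> (\<forall>\<epsilon>>0. \<exists>C. \<forall>\<^sub>F n in sequentially.
     outer_measure_of M {\<omega> \<in> space M. \<exists>h\<in>U. \<not> \<bar>Z n h \<omega>\<bar> \<le> C * R h} \<le> ennreal \<epsilon>)"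

definition o_P_1 :: "'w measure \<Rightarrow> (nat \<Rightarrow> 'w \<Rightarrow> real) \<Rightarrow> bool" where
  "o_P_1 M Z \<longleftrightarrow> (\<forall>\<epsilon>>0.
     (\<lambda>n. outer_measure_of M {\<omega> \<in> space M. \<bar>Z n \<omega>\<bar> > \<epsilon>}) \<longlonglongrightarrow> 0)"

definition random_seq_in :: "'w measure \<Rightarrow> real set \<Rightarrow> (nat \<Rightarrow> 'w \<Rightarrow> real) \<Rightarrow> bool" where
  "random_seq_in M \<Theta> Z \<longleftrightarrow> (\<forall>n. Z n \<in> borel_measurable M \<and> (\<forall>\<omega>\<in>space M. Z n \<omega> \<in> \<Theta>))"

subsection \<open>Empirical measure and empirical process\<close>

text \<open>Here \<open>x :: nat \<Rightarrow> 'x\<close> is a realisation of the data; a sample of size \<open>n\<close> is \<open>x 0, \<dots>, x (n - 1)\<close>.\<close>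

definition emp_mean :: "(nat \<Rightarrow> 'x) \<Rightarrow> nat \<Rightarrow> ('x \<Rightarrow> real) \<Rightarrow> real" where
  "emp_mean x n f = (\<Sum>i<n. f (x i)) / real n"

definition emp_proc :: "'x measure \<Rightarrow> (nat \<Rightarrow> 'x) \<Rightarrow> nat \<Rightarrow> ('x \<Rightarrow> real) \<Rightarrow> real" where
  "emp_proc P x n f = (\<Sum>i<n. f (x i) - (\<integral>y. f y \<partial>P)) / sqrt (real n)"

text \<open>
  Function classes are studied, as usual, on the canonical space \<open>(\<X>\<^sup>\<infinity>, \<A>\<^sup>\<infinity>, P\<^sup>\<infinity>)\<close> on which the
  observations are the coordinate projections.
\<close>

abbreviation sample_space :: "'x measure \<Rightarrow> (nat \<Rightarrow> 'x) measure" where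
  "sample_space P \<equiv> (\<Pi>\<^sub>M i\<in>UNIV. P)"

definition Glivenko_Cantelli :: "'x measure \<Rightarrow> ('x \<Rightarrow> real) set \<Rightarrow> bool" where
  "Glivenko_Cantelli P F \<longleftrightarrow>
     (\<forall>f\<in>F. integrable P f) \<and>
     (\<exists>\<Delta>. (\<forall>n. \<Delta> n \<in> borel_measurable (sample_space P)) \<and>
          (\<forall>n. \<forall>x\<in>space (sample_space P). \<forall>f\<in>F.
             \<bar>emp_mean x n f - (\<integral>y. f y \<partial>P)\<bar> \<le> \<Delta> n x) \<and>
          (AE x in sample_space P. (\<lambda>n. \<Delta> n x) \<longlonglongrightarrow> 0))"

text \<open>
  The Banach space of bounded real functions on a set \<open>F\<close> of functions with the supremum norm is
  realised inside the bounded continuous functions on a discrete space, as those vanishing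
  off \<open>F\<close>.
\<close>

definition linf :: "('x \<Rightarrow> real) set \<Rightarrow> (('x \<Rightarrow> real) discrete \<Rightarrow>\<^sub>C real) set" where
  "linf F = {z. \<forall>f. f \<notin> F \<longrightarrow> apply_bcontfun z (discrete f) = 0}"

definition to_linf :: "('x \<Rightarrow> real) set \<Rightarrow> (('x \<Rightarrow> real) \<Rightarrow> real) \<Rightarrow> (('x \<Rightarrow> real) discrete \<Rightarrow>\<^sub>C real)" where
  "to_linf F z = Bcontfun (\<lambda>d. if of_discrete d \<in> F then z (of_discrete d) else 0)"

definition outer_expectation :: "'w measure \<Rightarrow> ('w \<Rightarrow> real) \<Rightarrow> real" where
  "outer_expectation M T =
     Inf {integral\<^sup>L M U | U. integrable M U \<and> (\<forall>\<omega>\<in>space M. T \<omega> \<le> U \<omega>)}"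

text \<open>
  Weak convergence of the empirical process in the sense of Hoffmann-Joergensen to a tight Borel
  law on the space of bounded functions on \<open>F\<close>.
\<close>

definition Donsker :: "'x measure \<Rightarrow> ('x \<Rightarrow> real) set \<Rightarrow> bool" where
  "Donsker P F \<longleftrightarrow>
     (\<forall>f\<in>F. integrable P f) \<and>
     (\<forall>x\<in>space P. \<exists>B. \<forall>f\<in>F. \<bar>f x - (\<integral>y. f y \<partial>P)\<bar> \<le> B) \<and>
     (\<exists>L. prob_space L \<and> sets L = sets (restrict_space borel (linf F)) \<and>
          (\<forall>\<epsilon>>0. \<exists>K\<subseteq>linf F. compact K \<and> measure L K \<ge> 1 - \<epsilon>) \<and>
          (\<forall>h :: (('x \<Rightarrow> real) discrete \<Rightarrow>\<^sub>C real) \<Rightarrow> real.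
             continuous_on (linf F) h \<and> bounded (h ` linf F) \<longrightarrow>
             (\<lambda>n. outer_expectation (sample_space P) (\<lambda>x. h (to_linf F (emp_proc P x n))))
               \<longlonglongrightarrow> (\<integral>z. h z \<partial>L)))"

subsection \<open>Semiparametric model and profile likelihood\<close>

text \<open>\<open>lik \<theta> \<eta>\<close> is the density of one observation with respect to the dominating measure \<open>\<mu>\<close>.\<close>

definition law :: "'x measure \<Rightarrow> (real \<Rightarrow> 'h \<Rightarrow> 'x \<Rightarrow> real) \<Rightarrow> real \<Rightarrow> 'h \<Rightarrow> 'x measure" where
  "law \<mu> lik \<theta> \<eta> = density \<mu> (\<lambda>x. ennreal (lik \<theta> \<eta> x))"

definition semiparametric_model ::
  "'x measure \<Rightarrow> real set \<Rightarrow> 'h set \<Rightarrow> (real \<Rightarrow> 'h \<Rightarrow> 'x \<Rightarrow> real) \<Rightarrow> bool" where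
  "semiparametric_model \<mu> \<Theta> H lik \<longleftrightarrow> sigma_finite_measure \<mu> \<and>
     (\<forall>\<theta>\<in>\<Theta>. \<forall>\<eta>\<in>H. lik \<theta> \<eta> \<in> borel_measurable \<mu> \<and> (\<forall>x\<in>space \<mu>. 0 \<le> lik \<theta> \<eta> x) \<and>
        prob_space (law \<mu> lik \<theta> \<eta>))"

definition lik_n ::
  "(real \<Rightarrow> 'h \<Rightarrow> 'x \<Rightarrow> real) \<Rightarrow> (nat \<Rightarrow> 'x) \<Rightarrow> nat \<Rightarrow> real \<Rightarrow> 'h \<Rightarrow> real" where
  "lik_n lik x n \<theta> \<eta> = (\<Prod>i<n. lik \<theta> \<eta> (x i))"

definition profile_lik ::
  "'h set \<Rightarrow> (real \<Rightarrow> 'h \<Rightarrow> 'x \<Rightarrow> real) \<Rightarrow> (nat \<Rightarrow> 'x) \<Rightarrow> nat \<Rightarrow> real \<Rightarrow> real" where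
  "profile_lik H lik x n \<theta> = (SUP \<eta>\<in>H. lik_n lik x n \<theta> \<eta>)"

subsection \<open>Efficient score and efficient information\<close>

definition L2 :: "'x measure \<Rightarrow> ('x \<Rightarrow> real) set" where
  "L2 Q = {f \<in> borel_measurable Q. integrable Q (\<lambda>x. (f x)\<^sup>2)}"

definition closed_span :: "'x measure \<Rightarrow> ('x \<Rightarrow> real) set \<Rightarrow> ('x \<Rightarrow> real) set" where
  "closed_span Q S = {h \<in> L2 Q. \<forall>\<epsilon>>0. \<exists>T a. finite T \<and> T \<subseteq> S \<and>
     (\<integral>x. (h x - (\<Sum>g\<in>T. a g * g x))\<^sup>2 \<partial>Q) < \<epsilon>}"

definition L2_proj :: "'x measure \<Rightarrow> ('x \<Rightarrow> real) set \<Rightarrow> ('x \<Rightarrow> real) \<Rightarrow> ('x \<Rightarrow> real)" where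
  "L2_proj Q W f = (SOME g. g \<in> W \<and> (\<forall>w\<in>W. (\<integral>x. (f x - g x) * w x \<partial>Q) = 0))"

definition theta_score :: "(real \<Rightarrow> 'h \<Rightarrow> 'x \<Rightarrow> real) \<Rightarrow> real \<Rightarrow> 'h \<Rightarrow> 'x \<Rightarrow> real" where
  "theta_score lik \<theta> \<eta> x = deriv (\<lambda>u. ln (lik u \<eta> x)) \<theta>"

text \<open>
  Score functions for the nuisance parameter: scores of one-dimensional submodels
  \<open>s \<mapsto> lik \<theta> (p s)\<close> with \<open>p 0 = \<eta>\<close>, differentiable in quadratic mean at \<open>s = 0\<close>.
\<close>

definition eta_scores ::
  "'x measure \<Rightarrow> 'h set \<Rightarrow> (real \<Rightarrow> 'h \<Rightarrow> 'x \<Rightarrow> real) \<Rightarrow> real \<Rightarrow> 'h \<Rightarrow> ('x \<Rightarrow> real) set" where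
  "eta_scores \<mu> H lik \<theta> \<eta> = {g \<in> L2 (law \<mu> lik \<theta> \<eta>). \<exists>p :: real \<Rightarrow> 'h. p 0 = \<eta> \<and>
     (\<forall>\<^sub>F s in at_right 0. p s \<in> H) \<and>
     ((\<lambda>s. \<integral>\<^sup>+x. ennreal (((sqrt (lik \<theta> (p s) x) - sqrt (lik \<theta> \<eta> x)) / s
               - g x * sqrt (lik \<theta> \<eta> x) / 2)\<^sup>2) \<partial>\<mu>) \<longlongrightarrow> 0) (at_right 0)}"

definition efficient_score ::
  "'x measure \<Rightarrow> 'h set \<Rightarrow> (real \<Rightarrow> 'h \<Rightarrow> 'x \<Rightarrow> real) \<Rightarrow> real \<Rightarrow> 'h \<Rightarrow> 'x \<Rightarrow> real" where
  "efficient_score \<mu> H lik \<theta> \<eta> x = theta_score lik \<theta> \<eta> x -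
     L2_proj (law \<mu> lik \<theta> \<eta>)
       (closed_span (law \<mu> lik \<theta> \<eta>) (eta_scores \<mu> H lik \<theta> \<eta>)) (theta_score lik \<theta> \<eta>) x"

definition efficient_info ::
  "'x measure \<Rightarrow> 'h set \<Rightarrow> (real \<Rightarrow> 'h \<Rightarrow> 'x \<Rightarrow> real) \<Rightarrow> real \<Rightarrow> 'h \<Rightarrow> real" where
  "efficient_info \<mu> H lik \<theta> \<eta> =
     prob_space.variance (law \<mu> lik \<theta> \<eta>) (efficient_score \<mu> H lik \<theta> \<eta>)"

subsection \<open>Least favorable submodel\<close>

definition submodel_loglik ::
  "(real \<Rightarrow> 'h \<Rightarrow> 'x \<Rightarrow> real) \<Rightarrow> (real \<Rightarrow> real \<Rightarrow> 'h \<Rightarrow> 'h) \<Rightarrow> real \<Rightarrow> real \<Rightarrow> 'h \<Rightarrow> 'x \<Rightarrow> real" where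
  "submodel_loglik lik etat t \<theta> \<eta> x = ln (lik t (etat t \<theta> \<eta>) x)"

text \<open>
  \<open>pd l m n\<close> differentiates \<open>m\<close> times in \<open>t\<close> and then \<open>n\<close> times in \<open>\<theta>\<close>; so \<open>pd l 1 1\<close> is the
  \<open>\<theta>\<close>-derivative of the \<open>t\<close>-derivative.
\<close>

definition pd ::
  "(real \<Rightarrow> real \<Rightarrow> 'h \<Rightarrow> 'x \<Rightarrow> real) \<Rightarrow> nat \<Rightarrow> nat \<Rightarrow> real \<Rightarrow> real \<Rightarrow> 'h \<Rightarrow> 'x \<Rightarrow> real" where
  "pd l m n t \<theta> \<eta> x = (deriv ^^ n) (\<lambda>u. (deriv ^^ m) (\<lambda>s. l s u \<eta> x) t) \<theta>"

text \<open>The last differentiation in forming \<open>pd l m n t \<theta> \<eta> x\<close> is of a differentiable function.\<close>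

definition pd_exists ::
  "(real \<Rightarrow> real \<Rightarrow> 'h \<Rightarrow> 'x \<Rightarrow> real) \<Rightarrow> nat \<Rightarrow> nat \<Rightarrow> real \<Rightarrow> real \<Rightarrow> 'h \<Rightarrow> 'x \<Rightarrow> bool" where
  "pd_exists l m n t \<theta> \<eta> x \<longleftrightarrow>
     (0 < m \<and> n = 0 \<longrightarrow> (\<lambda>s. pd l (m - 1) 0 s \<theta> \<eta> x) differentiable (at t)) \<and>
     (0 < n \<longrightarrow> (\<lambda>u. pd l m (n - 1) t u \<eta> x) differentiable (at \<theta>))"

definition nbhd_in :: "'a::topological_space set \<Rightarrow> 'a \<Rightarrow> 'a set \<Rightarrow> bool" where
  "nbhd_in S a V \<longleftrightarrow> openin (top_of_set S) V \<and> a \<in> V"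

text \<open>
  Note that \<open>ln 0 = 0\<close>; positivity of the likelihood is therefore part of the requirement that
  \<open>\<ell>(t,\<theta>,\<eta>)\<close> be finite.
\<close>

definition smooth_with_envelopes ::
  "'x measure \<Rightarrow> 'h set \<Rightarrow> (real \<Rightarrow> 'h \<Rightarrow> 'x \<Rightarrow> real) \<Rightarrow> (real \<Rightarrow> real \<Rightarrow> 'h \<Rightarrow> 'h) \<Rightarrow>
     (nat \<times> nat) set \<Rightarrow> (real \<times> real \<times> 'h) set \<Rightarrow> bool" where
  "smooth_with_envelopes P H lik etat J V \<longleftrightarrow>
     (\<forall>(t,\<theta>,\<eta>)\<in>V. etat t \<theta> \<eta> \<in> H) \<and>
     (AE x in P. \<forall>(t,\<theta>,\<eta>)\<in>V. 0 < lik t (etat t \<theta> \<eta>) x) \<and>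
     (\<forall>(m,n)\<in>J.
        (AE x in P. \<forall>(t,\<theta>,\<eta>)\<in>V. pd_exists (submodel_loglik lik etat) m n t \<theta> \<eta> x) \<and>
        (\<forall>(t,\<theta>,\<eta>)\<in>V. pd (submodel_loglik lik etat) m n t \<theta> \<eta> \<in> borel_measurable P) \<and>
        (\<exists>E. integrable P E \<and>
           (AE x in P. \<forall>(t,\<theta>,\<eta>)\<in>V. \<bar>pd (submodel_loglik lik etat) m n t \<theta> \<eta> x\<bar> \<le> E x)))"

end

theory Submission
  imports Defs
begin

text \<open>
  The profile likelihood is a supremum over an infinite-dimensional set, so it cannot be expanded
  directly. Inserting the least favorable submodel gives a sandwich between ordinary
  one-dimensional functions: for every \<open>\<theta>\<close> and every admissible \<open>\<eta>\<close>,
  \<open>log pl\<^sub>n(t) \<ge> n P\<^sub>n \<ell>(t,\<theta>,\<eta>)\<close>, with equality at \<open>t = \<theta>\<close> if \<open>\<eta>\<close> maximises the likelihood at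
  \<open>\<theta>\<close>. Hence \<open>log pl\<^sub>n(\<theta>) - log pl\<^sub>n(\<theta>\<^sub>0)\<close> lies between the increments from \<open>\<theta>\<^sub>0\<close> to \<open>\<theta>\<close> of the two
  smooth functions \<open>t \<mapsto> n P\<^sub>n \<ell>(t,\<theta>\<^sub>0,\<eta>)\<close> (with \<open>\<eta>\<close> the maximiser at \<open>\<theta>\<^sub>0\<close>) and
  \<open>t \<mapsto> n P\<^sub>n \<ell>(t,\<theta>,\<eta>)\<close> (with \<open>\<eta>\<close> the maximiser at \<open>\<theta>\<close>).

  Both functions are expanded at \<open>t = \<theta>\<^sub>0\<close>. Write \<open>S\<close> for the empirical mean of the efficient score
  and \<open>\<delta> = n\<^sup>-\<^sup>1\<^sup>/\<^sup>2 + \<bar>\<theta> - \<theta>\<^sub>0\<bar>\<close>, the rate of the nuisance estimator. The first derivative is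
  \<open>S + O(\<delta>\<^sup>2)\<close>: the effect of estimating \<open>\<eta>\<close> is of second order because the score has mean
  \<open>O(\<parallel>\<eta> - \<eta>\<^sub>0\<parallel>\<^sup>2)\<close>, and the effect of moving the second argument of \<open>\<ell>\<close> is of second order because
  the mixed derivative \<open>\<ell>\<^sub>t\<^sub>,\<^sub>\<theta>\<close> has mean zero at the truth. The second derivative is
  \<open>- I\<^sub>0 + O(\<delta>)\<close> by the information identity, and the third is bounded by an average of envelopes.
  The fluctuations are controlled by the Donsker property, which makes the empirical process bounded
  in probability uniformly over the class (\<open>Donsker_tightly\<close>). This expansion is
  \<open>submodel_expansion\<close> on a fixed sample and \<open>expansion_tightly\<close> in probability; the sandwich is
  \<open>profile_expansion\<close>.

  The sandwich alone would locate \<open>\<theta>\<close>-hat only up to an error \<open>n\<^sup>-\<^sup>1\<^sup>/\<^sup>4\<close> on the root-\<open>n\<close> scale. The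
  sharper second claim comes from the first-order condition: \<open>t \<mapsto> P\<^sub>n \<ell>(t,\<theta>,\<eta>)\<close> at the maximum
  likelihood estimator \<open>(\<theta>,\<eta>)\<close> is maximal at \<open>t = \<theta>\<close>, so its derivative vanishes there
  (\<open>score_equation\<close>), which reads \<open>0 = S - (\<theta> - \<theta>\<^sub>0) I\<^sub>0 + O(\<delta>\<^sup>2)\<close>. Consistency lets the quadratic
  error be absorbed (\<open>root_n_rate\<close>). Finally, subtracting the expansions for the two
  parameter sequences and inserting the value of \<open>S\<close> completes the square around the estimator
  (\<open>recenter_expansion\<close>).
\<close>

section \<open>Bounds in outer probability\<close>

text \<open>
  With high probability. Events need not be measurable, so their complements are measured by outer probability.
\<close>

definition whp :: "'w measure \<Rightarrow> (nat \<Rightarrow> 'w \<Rightarrow> bool) \<Rightarrow> bool" where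
  "whp M Q \<longleftrightarrow> (\<forall>\<epsilon>>0. \<forall>\<^sub>F n in sequentially.
     outer_measure_of M {\<omega> \<in> space M. \<not> Q n \<omega>} \<le> ennreal \<epsilon>)"

text \<open>
  The common form of all stochastic bounds below: \<open>Q C n\<close> is a random event that should hold for
  all large \<open>n\<close> with probability close to one, once the constant \<open>C\<close> is chosen large enough for the
  desired probability. With \<open>Q C n \<omega>\<close> an inequality with constant \<open>C\<close> this is \<open>O\<^sub>P\<close>; allowing an
  arbitrary \<open>Q\<close> makes it possible to collect several bounds under a single constant and then to argue
  on a fixed sample.
\<close>

definition tightly :: "'w measure \<Rightarrow> (real \<Rightarrow> nat \<Rightarrow> 'w \<Rightarrow> bool) \<Rightarrow> bool" where
  "tightly M Q \<longleftrightarrow> (\<forall>\<epsilon>>0. \<exists>C. \<forall>\<^sub>F n in sequentially.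
     outer_measure_of M {\<omega> \<in> space M. \<not> Q C n \<omega>} \<le> ennreal \<epsilon>)"

lemma outer_measure_of_leI:
  assumes "B \<in> sets M" "A \<subseteq> B" "emeasure M B \<le> e"
  shows "outer_measure_of M A \<le> e"
  using outer_measure_of_mono[OF assms(2), of M] assms(1,3) by simp

lemma outer_measure_of_conj:
  assumes "outer_measure_of M {\<omega> \<in> space M. \<not> Q \<omega>} \<le> ennreal a"
    and "outer_measure_of M {\<omega> \<in> space M. \<not> R \<omega>} \<le> ennreal b" and "0 \<le> a" "0 \<le> b"
  shows "outer_measure_of M {\<omega> \<in> space M. \<not> (Q \<omega> \<and> R \<omega>)} \<le> ennreal (a + b)"
proof -
  obtain A where A: "A \<in> sets M" "{\<omega> \<in> space M. \<not> Q \<omega>} \<subseteq> A"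
      "outer_measure_of M {\<omega> \<in> space M. \<not> Q \<omega>} = emeasure M A"
    using outer_measure_of_attain[of "{\<omega> \<in> space M. \<not> Q \<omega>}" M] by auto
  obtain B where B: "B \<in> sets M" "{\<omega> \<in> space M. \<not> R \<omega>} \<subseteq> B"
      "outer_measure_of M {\<omega> \<in> space M. \<not> R \<omega>} = emeasure M B"
    using outer_measure_of_attain[of "{\<omega> \<in> space M. \<not> R \<omega>}" M] by auto
  show ?thesis
  proof (rule outer_measure_of_leI)
    show "A \<union> B \<in> sets M" using A B by auto
    show "{\<omega> \<in> space M. \<not> (Q \<omega> \<and> R \<omega>)} \<subseteq> A \<union> B" using A B by auto
    have "emeasure M (A \<union> B) \<le> emeasure M A + emeasure M B"
      using A B by (intro emeasure_subadditive)
    also have "\<dots> \<le> ennreal a + ennreal b"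
      using assms A B by (intro add_mono) auto
    finally show "emeasure M (A \<union> B) \<le> ennreal (a + b)"
      using assms(3,4) by simp
  qed
qed

text \<open>
  The constant is fixed first, so the second event may depend on it in any way, for instance
  require a consistent quantity to be small compared with \<open>1 / C\<close>. This is how errors are absorbed.
\<close>

lemma tightly_conj_whp:
  assumes Q: "tightly M Q" and R: "\<And>C. whp M (R C)"
  shows "tightly M (\<lambda>C n \<omega>. Q C n \<omega> \<and> R C n \<omega>)"
  unfolding tightly_def
proof (intro allI impI)
  fix \<epsilon> :: real assume \<epsilon>: "\<epsilon> > 0"
  obtain C where C: "\<forall>\<^sub>F n in sequentially. outer_measure_of M {\<omega> \<in> space M. \<not> Q C n \<omega>} \<le> ennreal (\<epsilon>/2)"
    using Q \<epsilon> unfolding tightly_def by (meson half_gt_zero)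
  have "\<forall>\<^sub>F n in sequentially. outer_measure_of M {\<omega> \<in> space M. \<not> R C n \<omega>} \<le> ennreal (\<epsilon>/2)"
    using R[of C] \<epsilon> unfolding whp_def by simp
  with C have "\<forall>\<^sub>F n in sequentially.
      outer_measure_of M {\<omega> \<in> space M. \<not> (Q C n \<omega> \<and> R C n \<omega>)} \<le> ennreal \<epsilon>"
  proof eventually_elim
    case (elim n)
    from outer_measure_of_conj[OF elim] \<epsilon> show ?case by simp
  qed
  then show "\<exists>C. \<forall>\<^sub>F n in sequentially.
      outer_measure_of M {\<omega> \<in> space M. \<not> (Q C n \<omega> \<and> R C n \<omega>)} \<le> ennreal \<epsilon>" ..
qed

text \<open>
  Monotonicity in the constant lets both bounds be used with the larger of the two constants.
\<close>

lemma tightly_conj: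
  assumes Q: "tightly M Q" and R: "tightly M R"
    and mQ: "\<And>C C' n \<omega>. C \<le> C' \<Longrightarrow> Q C n \<omega> \<Longrightarrow> Q C' n \<omega>"
    and mR: "\<And>C C' n \<omega>. C \<le> C' \<Longrightarrow> R C n \<omega> \<Longrightarrow> R C' n \<omega>"
  shows "tightly M (\<lambda>C n \<omega>. Q C n \<omega> \<and> R C n \<omega>)"
  unfolding tightly_def
proof (intro allI impI)
  fix \<epsilon> :: real assume \<epsilon>: "\<epsilon> > 0"
  obtain C1 where C1: "\<forall>\<^sub>F n in sequentially. outer_measure_of M {\<omega> \<in> space M. \<not> Q C1 n \<omega>} \<le> ennreal (\<epsilon>/2)"
    using Q \<epsilon> unfolding tightly_def by (meson half_gt_zero)
  obtain C2 where C2: "\<forall>\<^sub>F n in sequentially. outer_measure_of M {\<omega> \<in> space M. \<not> R C2 n \<omega>} \<le> ennreal (\<epsilon>/2)"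
    using R \<epsilon> unfolding tightly_def by (meson half_gt_zero)
  define C where "C = max C1 C2"
  from C1 C2 have "\<forall>\<^sub>F n in sequentially.
      outer_measure_of M {\<omega> \<in> space M. \<not> (Q C n \<omega> \<and> R C n \<omega>)} \<le> ennreal \<epsilon>"
  proof eventually_elim
    case (elim n)
    have "{\<omega> \<in> space M. \<not> (Q C n \<omega> \<and> R C n \<omega>)} \<subseteq> {\<omega> \<in> space M. \<not> (Q C1 n \<omega> \<and> R C2 n \<omega>)}"
      using mQ[of C1 C n] mR[of C2 C n] by (auto simp: C_def)
    then have "outer_measure_of M {\<omega> \<in> space M. \<not> (Q C n \<omega> \<and> R C n \<omega>)}
        \<le> outer_measure_of M {\<omega> \<in> space M. \<not> (Q C1 n \<omega> \<and> R C2 n \<omega>)}"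
      by (rule outer_measure_of_mono)
    also have "\<dots> \<le> ennreal \<epsilon>"
      using outer_measure_of_conj[OF elim] \<epsilon> by simp
    finally show ?case .
  qed
  then show "\<exists>C. \<forall>\<^sub>F n in sequentially.
      outer_measure_of M {\<omega> \<in> space M. \<not> (Q C n \<omega> \<and> R C n \<omega>)} \<le> ennreal \<epsilon>" ..
qed

text \<open>
  The passage from stochastic to deterministic reasoning: \<open>Q\<close> collects bounds known to hold, and
  the premise is an implication on a fixed sample.
\<close>

lemma tightly_mono:
  assumes Q: "tightly M Q"
    and QR: "\<And>C. \<exists>C'. \<forall>\<^sub>F n in sequentially. \<forall>\<omega>\<in>space M. Q C n \<omega> \<longrightarrow> R C' n \<omega>"
  shows "tightly M R"
  unfolding tightly_def
proof (intro allI impI)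
  fix \<epsilon> :: real assume "\<epsilon> > 0"
  then obtain C where C: "\<forall>\<^sub>F n in sequentially. outer_measure_of M {\<omega> \<in> space M. \<not> Q C n \<omega>} \<le> ennreal \<epsilon>"
    using Q unfolding tightly_def by blast
  obtain C' where "\<forall>\<^sub>F n in sequentially. \<forall>\<omega>\<in>space M. Q C n \<omega> \<longrightarrow> R C' n \<omega>"
    using QR by blast
  with C have "\<forall>\<^sub>F n in sequentially. outer_measure_of M {\<omega> \<in> space M. \<not> R C' n \<omega>} \<le> ennreal \<epsilon>"
  proof eventually_elim
    case (elim n)
    have "outer_measure_of M {\<omega> \<in> space M. \<not> R C' n \<omega>} \<le> outer_measure_of M {\<omega> \<in> space M. \<not> Q C n \<omega>}"
      using elim(2) by (intro outer_measure_of_mono) auto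
    then show ?case using elim(1) by simp
  qed
  then show "\<exists>C. \<forall>\<^sub>F n in sequentially. outer_measure_of M {\<omega> \<in> space M. \<not> R C n \<omega>} \<le> ennreal \<epsilon>" ..
qed

lemma tightly_const: "tightly M (\<lambda>C n \<omega>. c \<le> C)"
proof -
  have "outer_measure_of M {\<omega> \<in> space M. \<not> c \<le> c} \<le> ennreal \<epsilon>" for \<epsilon> by simp
  then show ?thesis unfolding tightly_def by (intro allI impI exI[of _ c]) auto
qed

lemma whp_mono:
  assumes "whp M Q" "\<forall>\<^sub>F n in sequentially. \<forall>\<omega>\<in>space M. Q n \<omega> \<longrightarrow> R n \<omega>"
  shows "whp M R"
  unfolding whp_def
proof (intro allI impI)
  fix \<epsilon> :: real assume "\<epsilon> > 0"
  then have "\<forall>\<^sub>F n in sequentially. outer_measure_of M {\<omega> \<in> space M. \<not> Q n \<omega>} \<le> ennreal \<epsilon>"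
    using assms(1) unfolding whp_def by blast
  with assms(2) show "\<forall>\<^sub>F n in sequentially. outer_measure_of M {\<omega> \<in> space M. \<not> R n \<omega>} \<le> ennreal \<epsilon>"
  proof eventually_elim
    case (elim n)
    have "outer_measure_of M {\<omega> \<in> space M. \<not> R n \<omega>} \<le> outer_measure_of M {\<omega> \<in> space M. \<not> Q n \<omega>}"
      using elim(1) by (intro outer_measure_of_mono) auto
    then show ?case using elim(2) by simp
  qed
qed

lemma whp_conj:
  assumes "whp M Q" "whp M R"
  shows "whp M (\<lambda>n \<omega>. Q n \<omega> \<and> R n \<omega>)"
  unfolding whp_def
proof (intro allI impI)
  fix \<epsilon> :: real assume \<epsilon>: "\<epsilon> > 0"
  have "\<forall>\<^sub>F n in sequentially. outer_measure_of M {\<omega> \<in> space M. \<not> Q n \<omega>} \<le> ennreal (\<epsilon>/2)"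
    "\<forall>\<^sub>F n in sequentially. outer_measure_of M {\<omega> \<in> space M. \<not> R n \<omega>} \<le> ennreal (\<epsilon>/2)"
    using assms \<epsilon> unfolding whp_def by simp_all
  then show "\<forall>\<^sub>F n in sequentially.
      outer_measure_of M {\<omega> \<in> space M. \<not> (Q n \<omega> \<and> R n \<omega>)} \<le> ennreal \<epsilon>"
  proof eventually_elim
    case (elim n)
    from outer_measure_of_conj[OF elim] \<epsilon> show ?case by simp
  qed
qed

lemma whp_AE:
  assumes "AE \<omega> in M. Q \<omega>"
  shows "whp M (\<lambda>n. Q)"
proof -
  obtain N where N: "{\<omega> \<in> space M. \<not> Q \<omega>} \<subseteq> N" "emeasure M N = 0" "N \<in> sets M"
    using assms by (rule AE_E)
  have "outer_measure_of M {\<omega> \<in> space M. \<not> Q \<omega>} \<le> ennreal \<epsilon>" for \<epsilon>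
    using N by (intro outer_measure_of_leI[of N]) auto
  then show ?thesis unfolding whp_def by simp
qed

lemma o_P_1_whp:
  assumes "o_P_1 M Z" "r > 0"
  shows "whp M (\<lambda>n \<omega>. \<bar>Z n \<omega>\<bar> \<le> r)"
  unfolding whp_def
proof (intro allI impI)
  fix \<epsilon> :: real assume \<epsilon>: "\<epsilon> > 0"
  have "(\<lambda>n. outer_measure_of M {\<omega> \<in> space M. \<bar>Z n \<omega>\<bar> > r}) \<longlonglongrightarrow> 0"
    using assms unfolding o_P_1_def by blast
  then have "\<forall>\<^sub>F n in sequentially. outer_measure_of M {\<omega> \<in> space M. \<bar>Z n \<omega>\<bar> > r} < ennreal \<epsilon>"
    using \<epsilon> by (rule_tac order_tendstoD) auto
  then show "\<forall>\<^sub>F n in sequentially. outer_measure_of M {\<omega> \<in> space M. \<not> \<bar>Z n \<omega>\<bar> \<le> r} \<le> ennreal \<epsilon>"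
    by eventually_elim (simp add: not_le)
qed

lemma whp_o_P_1:
  assumes "\<And>r. r > 0 \<Longrightarrow> whp M (\<lambda>n \<omega>. \<bar>Z n \<omega>\<bar> \<le> r)"
  shows "o_P_1 M Z"
  unfolding o_P_1_def
proof (intro allI impI)
  fix r :: real assume "r > 0"
  note w = assms[OF this, unfolded whp_def not_le]
  show "(\<lambda>n. outer_measure_of M {\<omega> \<in> space M. \<bar>Z n \<omega>\<bar> > r}) \<longlonglongrightarrow> 0"
  proof (rule order_tendstoI)
    fix a :: ennreal assume "0 < a"
    then obtain e where e: "0 < e" "ennreal e < a"
      by (metis dense ennreal_cases ennreal_less_zero_iff not_less_iff_gr_or_eq top_greatest le_less
          not_less order.strict_trans1)
    show "\<forall>\<^sub>F n in sequentially. outer_measure_of M {\<omega> \<in> space M. \<bar>Z n \<omega>\<bar> > r} < a"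
      using w[rule_format, OF e(1)] e(2) by (auto elim!: eventually_mono)
  qed simp
qed

lemma o_P_1_add:
  assumes Y: "o_P_1 M Y" and Z: "o_P_1 M Z"
  shows "o_P_1 M (\<lambda>n \<omega>. Y n \<omega> + Z n \<omega>)"
proof (rule whp_o_P_1)
  fix r :: real assume "r > 0"
  then have "whp M (\<lambda>n \<omega>. \<bar>Y n \<omega>\<bar> \<le> r/2 \<and> \<bar>Z n \<omega>\<bar> \<le> r/2)"
    by (intro whp_conj o_P_1_whp assms) auto
  then show "whp M (\<lambda>n \<omega>. \<bar>Y n \<omega> + Z n \<omega>\<bar> \<le> r)"
    by (rule whp_mono) (intro always_eventually; auto)
qed

lemma O_P_tightly: "O_P M Z R \<longleftrightarrow> tightly M (\<lambda>C n \<omega>. \<bar>Z n \<omega>\<bar> \<le> C * R n \<omega>)"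
  unfolding O_P_def tightly_def ..

lemma O_P_on_tightly: "O_P_on M U Z R \<longleftrightarrow> tightly M (\<lambda>C n \<omega>. \<forall>h\<in>U. \<bar>Z n h \<omega>\<bar> \<le> C * R h)"
  unfolding O_P_on_def tightly_def by simp

text \<open>
  Markov's inequality.
\<close>

lemma tightly_integrableI:
  assumes int: "\<And>n. n \<ge> 1 \<Longrightarrow> integrable M (Z n)"
    and nn: "\<And>n \<omega>. 0 \<le> Z n \<omega>"
    and bd: "\<And>n. n \<ge> 1 \<Longrightarrow> integral\<^sup>L M (Z n) \<le> K"
  shows "tightly M (\<lambda>C n \<omega>. Z n \<omega> \<le> C)"
  unfolding tightly_def
proof (intro allI impI)
  fix \<epsilon> :: real assume \<epsilon>: "\<epsilon> > 0"
  have K: "0 \<le> K"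
  proof -
    have "0 \<le> integral\<^sup>L M (Z 1)" by (intro Bochner_Integration.integral_nonneg nn)
    then show ?thesis using bd[of 1] by simp
  qed
  define C where "C = (K + 1) / \<epsilon>"
  have C: "C > 0" using K \<epsilon> by (simp add: C_def)
  have "outer_measure_of M {\<omega> \<in> space M. \<not> Z n \<omega> \<le> C} \<le> ennreal \<epsilon>" if n: "n \<ge> 1" for n
  proof (rule outer_measure_of_leI)
    note [measurable] = borel_measurable_integrable[OF int[OF n]]
    show "{\<omega> \<in> space M. C \<le> Z n \<omega>} \<in> sets M" by measurable
    show "{\<omega> \<in> space M. \<not> Z n \<omega> \<le> C} \<subseteq> {\<omega> \<in> space M. C \<le> Z n \<omega>}" by auto
    have "emeasure M {\<omega> \<in> space M. C \<le> Z n \<omega>} \<le> ennreal (1 / C * integral\<^sup>L M (Z n))"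
      by (rule integral_Markov_inequality[OF int[OF n] _ C]) (simp add: nn)
    also have "\<dots> \<le> ennreal \<epsilon>"
    proof (rule ennreal_leI)
      have "1 / C * integral\<^sup>L M (Z n) \<le> 1 / C * K"
        using bd[OF n] C by (intro mult_left_mono) auto
      also have "\<dots> \<le> \<epsilon>"
        using K \<epsilon> by (simp add: C_def field_simps)
      finally show "1 / C * integral\<^sup>L M (Z n) \<le> \<epsilon>" .
    qed
    finally show "emeasure M {\<omega> \<in> space M. C \<le> Z n \<omega>} \<le> ennreal \<epsilon>" .
  qed
  then show "\<exists>C. \<forall>\<^sub>F n in sequentially. outer_measure_of M {\<omega> \<in> space M. \<not> Z n \<omega> \<le> C} \<le> ennreal \<epsilon>"
    by (intro exI[of _ C] eventually_sequentiallyI[of 1]) auto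
qed

section \<open>Independent samples and Donsker classes\<close>

locale iid_sample = prob_space M for M :: "'w measure" +
  fixes P :: "'x measure" and X :: "nat \<Rightarrow> 'w \<Rightarrow> 'x"
  assumes indep: "indep_vars (\<lambda>_. P) X UNIV"
    and distr: "\<And>i. distr M P (X i) = P"
begin

lemma X_measurable[measurable]: "X i \<in> measurable M P"
  using indep unfolding indep_vars_def2 by simp

lemma prob_space_P: "prob_space P"
  using prob_space_distr[OF X_measurable[of 0]] distr by simp

lemma integrable_X:
  fixes f :: "'x \<Rightarrow> real"
  shows "integrable P f \<Longrightarrow> integrable M (\<lambda>\<omega>. f (X i \<omega>))"
  using integrable_distr[OF X_measurable, of i f] distr[of i] by simp

lemma integral_X:
  fixes f :: "'x \<Rightarrow> real"
  assumes [measurable]: "f \<in> borel_measurable P"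
  shows "(\<integral>\<omega>. f (X i \<omega>) \<partial>M) = (\<integral>x. f x \<partial>P)"
  using integral_distr[OF X_measurable[of i] assms] distr[of i] by simp

lemma AE_X:
  assumes "AE x in P. Q x"
  shows "AE \<omega> in M. \<forall>i. Q (X i \<omega>)"
proof -
  have "AE \<omega> in M. Q (X i \<omega>)" for i
    by (rule AE_distrD[OF X_measurable[of i]]) (simp only: distr assms)
  then show ?thesis by (simp add: AE_all_countable)
qed

lemma data_measurable[measurable]: "(\<lambda>\<omega> i. X i \<omega>) \<in> measurable M (sample_space P)"
  using measurable_restrict[of UNIV X M "\<lambda>_. P"] by (simp add: restrict_UNIV)

lemma distr_data: "distr M (sample_space P) (\<lambda>\<omega> i. X i \<omega>) = sample_space P"
  using indep_vars_iff_distr_eq_PiM[where I=UNIV and M'="\<lambda>_. P" and X=X] indep distr by (simp add: restrict_UNIV)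

text \<open>
  Transports statements about function classes, which live on the canonical sample space, to the
  given probability space.
\<close>

lemma tightly_data:
  assumes "tightly (sample_space P) Q"
  shows "tightly M (\<lambda>C n \<omega>. Q C n (\<lambda>i. X i \<omega>))"
  unfolding tightly_def
proof (intro allI impI)
  fix \<epsilon> :: real assume "\<epsilon> > 0"
  then obtain C where C: "\<forall>\<^sub>F n in sequentially.
      outer_measure_of (sample_space P) {x \<in> space (sample_space P). \<not> Q C n x} \<le> ennreal \<epsilon>"
    using assms unfolding tightly_def by blast
  have "\<forall>\<^sub>F n in sequentially. outer_measure_of M {\<omega> \<in> space M. \<not> Q C n (\<lambda>i. X i \<omega>)} \<le> ennreal \<epsilon>"
    using C
  proof eventually_elim
    case (elim n)
    let ?A = "{x \<in> space (sample_space P). \<not> Q C n x}"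
    obtain B where B: "B \<in> sets (sample_space P)" "?A \<subseteq> B"
        "outer_measure_of (sample_space P) ?A = emeasure (sample_space P) B"
      using outer_measure_of_attain[of ?A "sample_space P"] by auto
    show ?case
    proof (rule outer_measure_of_leI)
      show "(\<lambda>\<omega> i. X i \<omega>) -` B \<inter> space M \<in> sets M"
        using B(1) by measurable
      show "{\<omega> \<in> space M. \<not> Q C n (\<lambda>i. X i \<omega>)} \<subseteq> (\<lambda>\<omega> i. X i \<omega>) -` B \<inter> space M"
        using B(2) measurable_space[OF data_measurable] by auto
      have "emeasure M ((\<lambda>\<omega> i. X i \<omega>) -` B \<inter> space M) = emeasure (sample_space P) B"
        using emeasure_distr[OF data_measurable B(1)] distr_data by simp
      then show "emeasure M ((\<lambda>\<omega> i. X i \<omega>) -` B \<inter> space M) \<le> ennreal \<epsilon>"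
        using elim B(3) by simp
    qed
  qed
  then show "\<exists>C. \<forall>\<^sub>F n in sequentially.
      outer_measure_of M {\<omega> \<in> space M. \<not> Q C n (\<lambda>i. X i \<omega>)} \<le> ennreal \<epsilon>" ..
qed

lemma emp_mean_tightly:
  assumes E: "integrable P E" and nn: "\<And>x. 0 \<le> E x"
  shows "tightly M (\<lambda>C n \<omega>. emp_mean (\<lambda>i. X i \<omega>) n E \<le> C)"
proof (rule tightly_integrableI)
  fix n :: nat assume n: "n \<ge> 1"
  show "integrable M (\<lambda>\<omega>. emp_mean (\<lambda>i. X i \<omega>) n E)"
    unfolding emp_mean_def by (auto intro!: integrable_X E)
  have "(\<integral>\<omega>. emp_mean (\<lambda>i. X i \<omega>) n E \<partial>M) = (\<Sum>i<n. \<integral>x. E x \<partial>P) / real n"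
    unfolding emp_mean_def
    using integrable_X[OF E] integral_X[OF borel_measurable_integrable[OF E]]
    by simp
  also have "\<dots> = (\<integral>x. E x \<partial>P)" using n by simp
  finally show "(\<integral>\<omega>. emp_mean (\<lambda>i. X i \<omega>) n E \<partial>M) \<le> (\<integral>x. E x \<partial>P)" by simp
qed (simp add: emp_mean_def sum_nonneg nn)

lemma second_moment_sum:
  assumes f[measurable]: "f \<in> borel_measurable P" and f2: "integrable P (\<lambda>x. (f x)\<^sup>2)"
    and f0: "(\<integral>x. f x \<partial>P) = 0"
  shows "integrable M (\<lambda>\<omega>. (\<Sum>i<n. f (X i \<omega>))\<^sup>2) \<and>
    (\<integral>\<omega>. (\<Sum>i<n. f (X i \<omega>))\<^sup>2 \<partial>M) = real n * (\<integral>x. (f x)\<^sup>2 \<partial>P)"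
proof (induction n)
  case (Suc n)
  interpret P: prob_space P by (rule prob_space_P)
  have f1: "integrable P f"
    by (rule P.square_integrable_imp_integrable[OF f f2])
  let ?S = "\<lambda>\<omega>. \<Sum>i<n. f (X i \<omega>)"
  have iv: "indep_vars (\<lambda>_. borel) (\<lambda>i \<omega>. f (X i \<omega>)) (insert n {..<n})"
    by (rule indep_vars_subset[OF indep_vars_compose2[OF indep, of "\<lambda>_. f" "\<lambda>_. borel"]]) auto
  have "indep_var borel (\<lambda>\<omega>. f (X n \<omega>)) borel (\<lambda>\<omega>. \<Sum>i\<in>{..<n}. f (X i \<omega>))"
    by (rule indep_vars_sum[OF _ _ iv]) auto
  moreover have "integrable M (\<lambda>\<omega>. f (X n \<omega>))" "integrable M ?S"
    by (auto intro!: integrable_X f1 integrable_sum)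
  ultimately have cross: "integrable M (\<lambda>\<omega>. f (X n \<omega>) * ?S \<omega>)"
      "(\<integral>\<omega>. f (X n \<omega>) * ?S \<omega> \<partial>M) = 0"
    using indep_var_integrable[of "\<lambda>\<omega>. f (X n \<omega>)" ?S]
      indep_var_lebesgue_integral[of "\<lambda>\<omega>. f (X n \<omega>)" ?S] integral_X[OF f, of n] f0 by auto
  have sq: "integrable M (\<lambda>\<omega>. (f (X n \<omega>))\<^sup>2)"
      "(\<integral>\<omega>. (f (X n \<omega>))\<^sup>2 \<partial>M) = (\<integral>x. (f x)\<^sup>2 \<partial>P)"
    using integrable_X[OF f2, of n] integral_X[of "\<lambda>x. (f x)\<^sup>2" n] by auto
  have eq: "(\<lambda>\<omega>. (\<Sum>i<Suc n. f (X i \<omega>))\<^sup>2) = (\<lambda>\<omega>. (?S \<omega>)\<^sup>2 + 2 * (f (X n \<omega>) * ?S \<omega>) + (f (X n \<omega>))\<^sup>2)"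
    by (auto simp: power2_sum algebra_simps)
  show ?case
    unfolding eq using Suc.IH cross sq by (auto simp: algebra_simps)
qed simp

text \<open>
  Chebyshev's inequality, based on the variance of a sum of independent variables.
\<close>

lemma centered_emp_mean_tightly:
  assumes f[measurable]: "f \<in> borel_measurable P" and f2: "integrable P (\<lambda>x. (f x)\<^sup>2)"
    and f0: "(\<integral>x. f x \<partial>P) = 0"
  shows "tightly M (\<lambda>C n \<omega>. \<bar>emp_mean (\<lambda>i. X i \<omega>) n f\<bar> \<le> C / sqrt (real n))"
proof -
  have "tightly M (\<lambda>C n \<omega>. (\<Sum>i<n. f (X i \<omega>))\<^sup>2 / real n \<le> C)"
  proof (rule tightly_integrableI)
    fix n :: nat assume n: "n \<ge> 1"
    note m = second_moment_sum[OF assms, of n]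
    show "integrable M (\<lambda>\<omega>. (\<Sum>i<n. f (X i \<omega>))\<^sup>2 / real n)"
      using m by auto
    show "(\<integral>\<omega>. (\<Sum>i<n. f (X i \<omega>))\<^sup>2 / real n \<partial>M) \<le> (\<integral>x. (f x)\<^sup>2 \<partial>P)"
      using m n by auto
  qed simp
  then show ?thesis
  proof (rule tightly_mono)
    fix C :: real
    have "\<bar>emp_mean (\<lambda>i. X i \<omega>) n f\<bar> \<le> sqrt C / sqrt (real n)"
      if n: "n \<ge> 1" and le: "(\<Sum>i<n. f (X i \<omega>))\<^sup>2 / real n \<le> C" for n \<omega>
    proof -
      let ?S = "\<Sum>i<n. f (X i \<omega>)"
      have "\<bar>?S\<bar> / sqrt (real n) = sqrt (?S\<^sup>2 / real n)"
        by (simp add: real_sqrt_divide)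
      also have "\<dots> \<le> sqrt C" using le by simp
      finally have "\<bar>?S\<bar> / sqrt (real n) / sqrt (real n) \<le> sqrt C / sqrt (real n)"
        by (intro divide_right_mono) auto
      then show ?thesis by (simp add: emp_mean_def)
    qed
    then show "\<exists>C'. \<forall>\<^sub>F n in sequentially. \<forall>\<omega>\<in>space M.
        (\<Sum>i<n. f (X i \<omega>))\<^sup>2 / real n \<le> C \<longrightarrow> \<bar>emp_mean (\<lambda>i. X i \<omega>) n f\<bar> \<le> C' / sqrt (real n)"
      by (intro exI[of _ "sqrt C"] eventually_sequentiallyI[of 1]) auto
  qed
qed

end

lemma to_linf_apply:
  assumes "bounded (z ` F)"
  shows "apply_bcontfun (to_linf F z) (discrete f) = (if f \<in> F then z f else 0)"
proof -
  obtain B where B: "\<And>f. f \<in> F \<Longrightarrow> norm (z f) \<le> B"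
    using assms by (auto simp: bounded_iff)
  have "(\<lambda>d. if of_discrete d \<in> F then z (of_discrete d) else 0) \<in> bcontfun"
  proof (rule bcontfun_normI)
    show "continuous_on UNIV (\<lambda>d. if of_discrete d \<in> F then z (of_discrete d) else 0)"
      by (auto simp: continuous_on_open_vimage open_discrete)
    show "norm (if of_discrete d \<in> F then z (of_discrete d) else 0) \<le> max B 0" for d
      using B[of "of_discrete d"] by auto
  qed
  then show ?thesis
    unfolding to_linf_def by (simp add: Bcontfun_inverse discrete_inverse)
qed

text \<open>
  Weak convergence is tested on the single bounded continuous functional
  \<open>h(z) = min 1 (max 0 (\<parallel>z\<parallel> - B))\<close>, where \<open>B\<close> bounds a compact set that carries most of the limit
  law. The limit gives \<open>h\<close> small mean, hence so do the empirical processes for large \<open>n\<close>, and Markov's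
  inequality applied to a measurable majorant turns this into a bound on the outer probability that
  the supremum norm exceeds \<open>B + 1\<close>.
\<close>

lemma Donsker_tightly:
  assumes P: "prob_space P" and D: "Donsker P F"
  shows "tightly (sample_space P) (\<lambda>C n x. \<forall>f\<in>F. \<bar>emp_proc P x n f\<bar> \<le> C)"
  unfolding tightly_def
proof (intro allI impI)
  fix \<epsilon> :: real assume \<epsilon>: "\<epsilon> > 0"
  interpret P: prob_space P by fact
  interpret PP: product_prob_space "\<lambda>_. P" "UNIV :: nat set" ..
  interpret S: prob_space "sample_space P" by (rule prob_space_PiM) (rule P)
  obtain L where L: "prob_space L" "sets L = sets (restrict_space borel (linf F))"
    and tight: "\<And>\<epsilon>. \<epsilon> > 0 \<Longrightarrow> \<exists>K\<subseteq>linf F. compact K \<and> measure L K \<ge> 1 - \<epsilon>"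
    and weak: "\<And>h :: (('a \<Rightarrow> real) discrete \<Rightarrow>\<^sub>C real) \<Rightarrow> real.
      continuous_on (linf F) h \<Longrightarrow> bounded (h ` linf F) \<Longrightarrow>
      (\<lambda>n. outer_expectation (sample_space P) (\<lambda>x. h (to_linf F (emp_proc P x n))))
        \<longlonglongrightarrow> (\<integral>z. h z \<partial>L)"
    using D unfolding Donsker_def by blast
  interpret L: prob_space L by fact
  \<comment> \<open>A compact set of limit mass at least \<open>1 - \<epsilon>/4\<close>, so that \<open>h\<close> has limit mean below \<open>\<epsilon>/2\<close>.\<close>
  obtain K where K: "K \<subseteq> linf F" "compact K" "measure L K \<ge> 1 - \<epsilon>/4"
    using tight[of "\<epsilon>/4"] \<epsilon> by auto
  obtain B where B: "\<And>z. z \<in> K \<Longrightarrow> norm z \<le> B"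
    using compact_imp_bounded[OF K(2)] by (auto simp: bounded_iff)
  define h where "h z = min 1 (max 0 (norm z - B))" for z :: "('a \<Rightarrow> real) discrete \<Rightarrow>\<^sub>C real"
  have hcont: "continuous_on A h" for A
    unfolding h_def by (intro continuous_intros)
  have h01: "0 \<le> h z" "h z \<le> 1" for z by (auto simp: h_def)
  have "bounded (h ` linf F)"
    using h01 by (auto simp: bounded_iff intro!: exI[of _ 1])
  note lim = weak[OF hcont this]
  have KL: "K \<in> sets L"
    unfolding L(2) sets_restrict_space using K(1) compact_imp_closed[OF K(2)]
    by (auto intro!: image_eqI[of _ _ K])
  have hmeas: "h \<in> borel_measurable L"
  proof -
    have "h \<in> borel_measurable (restrict_space borel (linf F))"
      using borel_measurable_continuous_onI[OF hcont] by (rule measurable_restrict_space1)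
    then show ?thesis using measurable_cong_sets[OF L(2) refl] by blast
  qed
  have hint: "integrable L h"
    by (rule L.integrable_const_bound[of _ 1]) (use h01 hmeas in auto)
  have "(\<integral>z. h z \<partial>L) \<le> (\<integral>z. indicator (space L - K) z \<partial>L)"
  proof (rule integral_mono)
    show "integrable L (indicator (space L - K) :: _ \<Rightarrow> real)"
      using KL by (intro L.integrable_const_bound[of _ 1]) (auto simp: indicator_def)
    show "h z \<le> indicator (space L - K) z" if "z \<in> space L" for z
      using that B[of z] h01[of z] by (auto simp: h_def indicator_def)
  qed (rule hint)
  also have "\<dots> = measure L (space L - K)" using KL by simp
  also have "\<dots> = 1 - measure L K" using KL by (rule L.prob_compl)
  also have "\<dots> \<le> \<epsilon>/4" using K(3) by simp
  finally have "(\<integral>z. h z \<partial>L) < \<epsilon>/2" using \<epsilon> by simp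
  from order_tendstoD(2)[OF lim this]
  have "\<forall>\<^sub>F n in sequentially.
     outer_measure_of (sample_space P) {x \<in> space (sample_space P). \<not> (\<forall>f\<in>F. \<bar>emp_proc P x n f\<bar> \<le> B + 1)} \<le> ennreal \<epsilon>"
  proof eventually_elim
    case (elim n)
    let ?T = "\<lambda>x. h (to_linf F (emp_proc P x n))"
    let ?S = "{integral\<^sup>L (sample_space P) U | U. integrable (sample_space P) U \<and>
       (\<forall>\<omega>\<in>space (sample_space P). ?T \<omega> \<le> U \<omega>)}"
    have "integral\<^sup>L (sample_space P) (\<lambda>_. 1) \<in> ?S"
      using h01(2) by (intro CollectI exI[of _ "\<lambda>_. 1"]) auto
    then obtain U where U: "integrable (sample_space P) U"
       "\<And>x. x \<in> space (sample_space P) \<Longrightarrow> ?T x \<le> U x" "integral\<^sup>L (sample_space P) U < \<epsilon>/2"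
      using cInf_lessD[of ?S "\<epsilon>/2"] elim unfolding outer_expectation_def by blast
    have U0: "0 \<le> U x" if "x \<in> space (sample_space P)" for x
      using U(2)[OF that] h01(1) order_trans by blast
    show ?case
    proof (rule outer_measure_of_leI)
      note [measurable] = borel_measurable_integrable[OF U(1)]
      show "{x \<in> space (sample_space P). 1 \<le> U x} \<in> sets (sample_space P)" by measurable
      show "{x \<in> space (sample_space P). \<not> (\<forall>f\<in>F. \<bar>emp_proc P x n f\<bar> \<le> B + 1)}
          \<subseteq> {x \<in> space (sample_space P). 1 \<le> U x}"
      proof safe
        fix x f assume x: "x \<in> space (sample_space P)" and f: "f \<in> F" "\<not> \<bar>emp_proc P x n f\<bar> \<le> B + 1"
        have "\<forall>i. \<exists>b. \<forall>f\<in>F. \<bar>f (x i) - (\<integral>y. f y \<partial>P)\<bar> \<le> b"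
          using D x unfolding Donsker_def by (auto simp: space_PiM)
        then obtain b where b: "\<And>i f. f \<in> F \<Longrightarrow> \<bar>f (x i) - (\<integral>y. f y \<partial>P)\<bar> \<le> b i" by metis
        have "norm (emp_proc P x n g) \<le> (\<Sum>i<n. b i) / sqrt (real n)" if "g \<in> F" for g
          unfolding emp_proc_def real_norm_def abs_divide
          using that b by (auto intro!: divide_right_mono order.trans[OF sum_abs] sum_mono)
        then have "bounded (emp_proc P x n ` F)"
          by (auto simp: bounded_iff intro!: exI[of _ "(\<Sum>i<n. b i) / sqrt (real n)"])
        then have "\<bar>emp_proc P x n f\<bar> = norm (apply_bcontfun (to_linf F (emp_proc P x n)) (discrete f))"
          using f by (simp add: to_linf_apply)
        also have "\<dots> \<le> norm (to_linf F (emp_proc P x n))" by (rule norm_bounded)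
        finally have "?T x = 1" using f(2) by (simp add: h_def)
        then show "1 \<le> U x" using U(2)[OF x] by simp
      qed
      have "emeasure (sample_space P) {x \<in> space (sample_space P). 1 \<le> U x}
          \<le> ennreal (1 / 1 * integral\<^sup>L (sample_space P) U)"
        using U0 by (intro integral_Markov_inequality[OF U(1)]) auto
      also have "\<dots> \<le> ennreal \<epsilon>" using U(3) \<epsilon> by (intro ennreal_leI) auto
      finally show "emeasure (sample_space P) {x \<in> space (sample_space P). 1 \<le> U x} \<le> ennreal \<epsilon>" .
    qed
  qed
  then show "\<exists>C. \<forall>\<^sub>F n in sequentially. outer_measure_of (sample_space P)
      {x \<in> space (sample_space P). \<not> (\<forall>f\<in>F. \<bar>emp_proc P x n f\<bar> \<le> C)} \<le> ennreal \<epsilon>" ..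
qed

section \<open>Taylor expansion of empirical means\<close>

lemma emp_mean_diff: "emp_mean x n (\<lambda>y. f y - g y) = emp_mean x n f - emp_mean x n g"
  by (simp add: emp_mean_def sum_subtractf diff_divide_distrib)

lemma emp_mean_cmult: "emp_mean x n (\<lambda>y. c * f y) = c * emp_mean x n f"
  by (simp add: emp_mean_def sum_distrib_left)

lemma emp_mean_sum: "emp_mean x n (\<lambda>y. \<Sum>m\<in>A. f m y) = (\<Sum>m\<in>A. emp_mean x n (f m))"
  unfolding emp_mean_def by (subst sum.swap) (simp add: sum_divide_distrib)

lemma emp_mean_abs_le:
  assumes "\<And>i. i < n \<Longrightarrow> \<bar>f (x i)\<bar> \<le> g (x i)"
  shows "\<bar>emp_mean x n f\<bar> \<le> emp_mean x n g"
  unfolding emp_mean_def abs_divide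
  using assms by (auto intro!: divide_right_mono order.trans[OF sum_abs] sum_mono)

lemma emp_mean_eq_emp_proc:
  assumes "n \<ge> 1"
  shows "emp_mean x n f = (\<integral>y. f y \<partial>P) + emp_proc P x n f / sqrt (real n)"
  using assms by (simp add: emp_mean_def emp_proc_def sum_subtractf field_simps)

text \<open>
  The factor \<open>1 / fact k\<close> of the Lagrange remainder is dropped, as only orders of magnitude matter.
\<close>

lemma Taylor_bound:
  fixes diff :: "nat \<Rightarrow> real \<Rightarrow> real"
  assumes k: "k > 0"
    and der: "\<And>m s. m < k \<Longrightarrow> \<bar>s - c\<bar> < r \<Longrightarrow> (diff m has_real_derivative diff (Suc m) s) (at s)"
    and bd: "\<And>s. \<bar>s - c\<bar> < r \<Longrightarrow> \<bar>diff k s\<bar> \<le> B"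
    and t: "\<bar>t - c\<bar> < r"
  shows "\<bar>diff 0 t - (\<Sum>m<k. diff m c / fact m * (t - c) ^ m)\<bar> \<le> B * \<bar>t - c\<bar> ^ k"
proof (cases "t = c")
  case True
  have "(\<Sum>m<k. diff m c / fact m * 0 ^ m) = (\<Sum>m<k. if m = 0 then diff 0 c else 0)"
    by (intro sum.cong) auto
  also have "\<dots> = diff 0 c" using k by simp
  finally show ?thesis using True k by (simp add: power_0_left)
next
  case False
  have "\<exists>s. (if t < c then t < s \<and> s < c else c < s \<and> s < t) \<and>
      diff 0 t = (\<Sum>m<k. diff m c / fact m * (t - c) ^ m) + diff k s / fact k * (t - c) ^ k"
    by (rule Taylor[of k diff "diff 0" "min t c" "max t c"]) (use k der t False in auto)
  then obtain s where s: "if t < c then t < s \<and> s < c else c < s \<and> s < t"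
    and eq: "diff 0 t = (\<Sum>m<k. diff m c / fact m * (t - c) ^ m) + diff k s / fact k * (t - c) ^ k"
    by blast
  have "\<bar>s - c\<bar> < r" using s t by (auto split: if_splits)
  then have B: "\<bar>diff k s\<bar> \<le> B" by (rule bd)
  have "\<bar>diff k s\<bar> / fact k \<le> \<bar>diff k s\<bar> / 1"
    by (rule divide_left_mono) auto
  with B have "\<bar>diff k s\<bar> / fact k \<le> B" by simp
  then have "\<bar>diff k s\<bar> / fact k * \<bar>t - c\<bar> ^ k \<le> B * \<bar>t - c\<bar> ^ k"
    by (rule mult_right_mono) simp
  then show ?thesis unfolding eq by (simp add: abs_mult power_abs)
qed

lemma emp_mean_Taylor:
  fixes f :: "nat \<Rightarrow> real \<Rightarrow> 'x \<Rightarrow> real"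
  assumes k: "k > 0"
    and der: "\<And>i m s. i < n \<Longrightarrow> m < k \<Longrightarrow> \<bar>s - c\<bar> < r \<Longrightarrow>
      ((\<lambda>s. f m s (x i)) has_real_derivative f (Suc m) s (x i)) (at s)"
    and bd: "\<And>i s. i < n \<Longrightarrow> \<bar>s - c\<bar> < r \<Longrightarrow> \<bar>f k s (x i)\<bar> \<le> E (x i)"
    and t: "\<bar>t - c\<bar> < r"
  shows "\<bar>emp_mean x n (f 0 t) - (\<Sum>m<k. emp_mean x n (f m c) / fact m * (t - c) ^ m)\<bar>
    \<le> emp_mean x n E * \<bar>t - c\<bar> ^ k"
proof -
  have "\<bar>emp_mean x n (\<lambda>y. f 0 t y - (\<Sum>m<k. (t - c) ^ m / fact m * f m c y))\<bar>
      \<le> emp_mean x n (\<lambda>y. \<bar>t - c\<bar> ^ k * E y)"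
  proof (rule emp_mean_abs_le)
    fix i assume i: "i < n"
    show "\<bar>f 0 t (x i) - (\<Sum>m<k. (t - c) ^ m / fact m * f m c (x i))\<bar> \<le> \<bar>t - c\<bar> ^ k * E (x i)"
      using Taylor_bound[of k c r "\<lambda>m s. f m s (x i)" "E (x i)" t] k der[OF i] bd[OF i] t
      by (simp add: mult.commute)
  qed
  then show ?thesis
    unfolding emp_mean_diff emp_mean_sum emp_mean_cmult by (simp add: mult.commute)
qed

lemma integral_Taylor:
  fixes f :: "nat \<Rightarrow> real \<Rightarrow> 'x \<Rightarrow> real"
  assumes k: "k > 0"
    and der: "AE x in P. \<forall>m<k. \<forall>s. \<bar>s - c\<bar> < r \<longrightarrow>
      ((\<lambda>s. f m s x) has_real_derivative f (Suc m) s x) (at s)"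
    and bd: "AE x in P. \<forall>s. \<bar>s - c\<bar> < r \<longrightarrow> \<bar>f k s x\<bar> \<le> E x"
    and int: "\<And>m. m < k \<Longrightarrow> integrable P (f m c)" "integrable P (f 0 t)" "integrable P E"
    and t: "\<bar>t - c\<bar> < r"
  shows "\<bar>(\<integral>x. f 0 t x \<partial>P) - (\<Sum>m<k. (\<integral>x. f m c x \<partial>P) / fact m * (t - c) ^ m)\<bar>
    \<le> (\<integral>x. E x \<partial>P) * \<bar>t - c\<bar> ^ k"
proof -
  let ?R = "\<lambda>x. f 0 t x - (\<Sum>m<k. (t - c) ^ m / fact m * f m c x)"
  have intS: "integrable P (\<lambda>x. \<Sum>m<k. (t - c) ^ m / fact m * f m c x)"
  proof (rule Bochner_Integration.integrable_sum)
    show "integrable P (\<lambda>x. (t - c) ^ m / fact m * f m c x)" if "m \<in> {..<k}" for m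
      using int(1)[of m] that by (intro integrable_mult_right) auto
  qed
  have intR: "integrable P ?R" by (rule Bochner_Integration.integrable_diff[OF int(2) intS])
  have "\<bar>\<integral>x. ?R x \<partial>P\<bar> \<le> (\<integral>x. \<bar>?R x\<bar> \<partial>P)" by (rule integral_abs_bound)
  also have "\<dots> \<le> (\<integral>x. \<bar>t - c\<bar> ^ k * E x \<partial>P)"
  proof (rule integral_mono_AE)
    show "AE x in P. \<bar>?R x\<bar> \<le> \<bar>t - c\<bar> ^ k * E x"
      using der bd
    proof eventually_elim
      case (elim x)
      then show ?case
        using Taylor_bound[of k c r "\<lambda>m s. f m s x" "E x" t] k t by (simp add: mult.commute)
    qed
  qed (use intR int in auto)
  also have "(\<integral>x. ?R x \<partial>P) = (\<integral>x. f 0 t x \<partial>P) - (\<Sum>m<k. (t - c) ^ m / fact m * (\<integral>x. f m c x \<partial>P))"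
  proof -
    have "(\<integral>x. (\<Sum>m<k. (t - c) ^ m / fact m * f m c x) \<partial>P) =
        (\<Sum>m<k. \<integral>x. (t - c) ^ m / fact m * f m c x \<partial>P)"
      by (rule Bochner_Integration.integral_sum) (use int(1) in \<open>auto intro!: integrable_mult_right\<close>)
    then show ?thesis
      unfolding Bochner_Integration.integral_diff[OF int(2) intS] by simp
  qed
  finally show ?thesis by (simp add: mult.commute)
qed

lemma derivative_of_quadratic_remainder:
  fixes \<phi> :: "real \<Rightarrow> real"
  assumes r: "r > 0"
    and rem: "\<And>t. \<bar>t - c\<bar> < r \<Longrightarrow> \<bar>\<phi> t - \<phi> c - (t - c) * a\<bar> \<le> K * (t - c)\<^sup>2"
  shows "(\<phi> has_real_derivative a) (at c)"
proof -
  have "((\<lambda>t. (\<phi> t - \<phi> c) / (t - c) - a) \<longlongrightarrow> 0) (at c)"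
  proof (rule Lim_null_comparison)
    have "eventually (\<lambda>t. \<bar>t - c\<bar> < r \<and> t \<noteq> c) (at c)"
      using r by (auto simp: eventually_at dist_real_def)
    then show "eventually (\<lambda>t. norm ((\<phi> t - \<phi> c) / (t - c) - a) \<le> K * \<bar>t - c\<bar>) (at c)"
    proof eventually_elim
      case (elim t)
      have "(\<phi> t - \<phi> c) / (t - c) - a = (\<phi> t - \<phi> c - (t - c) * a) / (t - c)"
        using elim by (simp add: field_simps)
      also have "norm \<dots> \<le> K * (t - c)\<^sup>2 / \<bar>t - c\<bar>"
        unfolding real_norm_def abs_divide using rem[of t] elim by (intro divide_right_mono) auto
      also have "(t - c)\<^sup>2 = \<bar>t - c\<bar> * \<bar>t - c\<bar>" by (simp add: power2_eq_square)
      also have "K * (\<bar>t - c\<bar> * \<bar>t - c\<bar>) / \<bar>t - c\<bar> = K * \<bar>t - c\<bar>"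
        unfolding mult.assoc[symmetric] by (rule nonzero_mult_div_cancel_right) (use elim in simp)
      finally show ?case .
    qed
    show "((\<lambda>t. K * \<bar>t - c\<bar>) \<longlongrightarrow> 0) (at c)"
      by (auto intro!: tendsto_eq_intros)
  qed
  then show ?thesis
    unfolding has_field_derivative_iff by (rule LIM_zero_cancel)
qed

section \<open>Local regularity of the submodel\<close>

text \<open>
  Neighbourhoods in the product space are replaced by boxes, in which the segments needed for
  Taylor expansion in \<open>t\<close> and in \<open>\<theta>\<close> with \<open>\<eta>\<close> fixed stay inside.
\<close>

definition par_box :: "real \<Rightarrow> 'h::real_normed_vector set \<Rightarrow> 'h \<Rightarrow> real \<Rightarrow> (real \<times> real \<times> 'h) set" where
  "par_box \<theta>0 H \<eta>0 r = {(t,\<theta>,\<eta>). \<bar>t - \<theta>0\<bar> < r \<and> \<bar>\<theta> - \<theta>0\<bar> < r \<and> \<eta> \<in> H \<and> norm (\<eta> - \<eta>0) < r}"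

lemma par_box_mono: "r \<le> r' \<Longrightarrow> par_box \<theta>0 H \<eta>0 r \<subseteq> par_box \<theta>0 H \<eta>0 r'"
  by (auto simp: par_box_def)

lemma nbhd_in_par_box:
  fixes H :: "'h::real_normed_vector set"
  assumes V: "nbhd_in (\<Theta> \<times> \<Theta> \<times> H) (\<theta>0, \<theta>0, \<eta>0) V" and \<theta>0: "\<theta>0 \<in> interior \<Theta>"
  shows "\<exists>r>0. par_box \<theta>0 H \<eta>0 r \<subseteq> V"
proof -
  obtain T where T: "open T" "V = (\<Theta> \<times> \<Theta> \<times> H) \<inter> T" "(\<theta>0, \<theta>0, \<eta>0) \<in> T"
    using V unfolding nbhd_in_def openin_open by auto
  obtain e where e: "e > 0" "ball (\<theta>0, \<theta>0, \<eta>0) e \<subseteq> T"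
    using T(1,3) open_contains_ball by blast
  obtain d where d: "d > 0" "ball \<theta>0 d \<subseteq> \<Theta>"
    using \<theta>0 mem_interior by blast
  define r where "r = min d (e/3)"
  have "par_box \<theta>0 H \<eta>0 r \<subseteq> V"
  proof
    fix p assume "p \<in> par_box \<theta>0 H \<eta>0 r"
    then obtain t \<theta> \<eta> where p: "p = (t,\<theta>,\<eta>)" "\<bar>t - \<theta>0\<bar> < r" "\<bar>\<theta> - \<theta>0\<bar> < r" "\<eta> \<in> H" "norm (\<eta> - \<eta>0) < r"
      by (auto simp: par_box_def)
    have "t \<in> \<Theta>" "\<theta> \<in> \<Theta>"
      using p d(2) by (auto simp: r_def dist_real_def subset_iff abs_minus_commute)
    moreover have "dist (\<theta>0, \<theta>0, \<eta>0) p < e"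
    proof -
      have "dist (\<theta>0, \<theta>0, \<eta>0) p \<le> dist \<theta>0 t + dist (\<theta>0, \<eta>0) (\<theta>, \<eta>)"
        unfolding p(1) dist_Pair_Pair by (rule sqrt_sum_squares_le_sum) auto
      also have "dist (\<theta>0, \<eta>0) (\<theta>, \<eta>) \<le> dist \<theta>0 \<theta> + dist \<eta>0 \<eta>"
        unfolding dist_Pair_Pair by (rule sqrt_sum_squares_le_sum) auto
      also have "dist \<theta>0 t + (dist \<theta>0 \<theta> + dist \<eta>0 \<eta>) < e"
        using p by (simp add: r_def dist_real_def dist_norm norm_minus_commute abs_minus_commute)
      finally show ?thesis by simp
    qed
    ultimately show "p \<in> V" using e(2) p(1,4) by (auto simp: T(2))
  qed
  moreover have "r > 0" using e d by (simp add: r_def)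
  ultimately show ?thesis by blast
qed

lemma nbhd_in_ball:
  fixes H :: "'h::real_normed_vector set"
  assumes "nbhd_in H \<eta>0 U"
  shows "\<exists>r>0. \<forall>\<eta>\<in>H. norm (\<eta> - \<eta>0) < r \<longrightarrow> \<eta> \<in> U"
proof -
  obtain T where T: "open T" "U = H \<inter> T" "\<eta>0 \<in> T"
    using assms unfolding nbhd_in_def openin_open by auto
  then obtain e where "e > 0" "ball \<eta>0 e \<subseteq> T" using open_contains_ball by blast
  then show ?thesis using T(2)
    by (intro exI[of _ e]) (auto simp: subset_iff dist_norm norm_minus_commute)
qed

lemma pd_0_0: "pd l 0 0 t \<theta> \<eta> x = l t \<theta> \<eta> x"
  by (simp add: pd_def)

lemma pd_has_derivative_t:
  assumes "pd_exists l (Suc m) 0 t \<theta> \<eta> x"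
  shows "((\<lambda>s. pd l m 0 s \<theta> \<eta> x) has_real_derivative pd l (Suc m) 0 t \<theta> \<eta> x) (at t)"
proof -
  have "pd l (Suc m) 0 t \<theta> \<eta> x = deriv (\<lambda>s. pd l m 0 s \<theta> \<eta> x) t"
    by (simp add: pd_def)
  then show ?thesis
    using assms by (simp add: pd_exists_def DERIV_deriv_iff_real_differentiable)
qed

lemma pd_has_derivative_theta:
  assumes "pd_exists l m (Suc k) t \<theta> \<eta> x"
  shows "((\<lambda>u. pd l m k t u \<eta> x) has_real_derivative pd l m (Suc k) t \<theta> \<eta> x) (at \<theta>)"
proof -
  have "pd l m (Suc k) t \<theta> \<eta> x = deriv (\<lambda>u. pd l m k t u \<eta> x) \<theta>"
    by (simp add: pd_def)
  then show ?thesis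
    using assms by (simp add: pd_exists_def DERIV_deriv_iff_real_differentiable)
qed

text \<open>
  The smoothness of the submodel at one observation \<open>x\<close>; the three derivatives bounded by \<open>E\<close> are
  those that occur as Taylor remainders.
\<close>

definition regular_at ::
  "(real \<Rightarrow> real \<Rightarrow> 'h \<Rightarrow> 'x \<Rightarrow> real) \<Rightarrow> ('x \<Rightarrow> real) \<Rightarrow> (real \<times> real \<times> 'h) set \<Rightarrow> 'x \<Rightarrow> bool" where
  "regular_at l E V x \<longleftrightarrow> (\<forall>(t,\<theta>,\<eta>)\<in>V.
     (\<forall>(m,k)\<in>{(1,0), (2,0), (3,0), (1,1), (1,2), (2,1)}. pd_exists l m k t \<theta> \<eta> x) \<and>
     (\<forall>(m,k)\<in>{(3,0), (1,2), (2,1)}. \<bar>pd l m k t \<theta> \<eta> x\<bar> \<le> E x))"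

lemma regular_at_subset: "regular_at l E V x \<Longrightarrow> W \<subseteq> V \<Longrightarrow> regular_at l E W x"
  unfolding regular_at_def by blast

lemma regular_atD:
  assumes "regular_at l E V x" "(t,\<theta>,\<eta>) \<in> V"
  shows "m < 3 \<Longrightarrow> ((\<lambda>s. pd l m 0 s \<theta> \<eta> x) has_real_derivative pd l (Suc m) 0 t \<theta> \<eta> x) (at t)"
    and "k < 2 \<Longrightarrow> ((\<lambda>u. pd l 1 k t u \<eta> x) has_real_derivative pd l 1 (Suc k) t \<theta> \<eta> x) (at \<theta>)"
    and "((\<lambda>u. pd l 2 0 t u \<eta> x) has_real_derivative pd l 2 1 t \<theta> \<eta> x) (at \<theta>)"
    and "\<bar>pd l 3 0 t \<theta> \<eta> x\<bar> \<le> E x" "\<bar>pd l 1 2 t \<theta> \<eta> x\<bar> \<le> E x" "\<bar>pd l 2 1 t \<theta> \<eta> x\<bar> \<le> E x"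
proof -
  have ex: "pd_exists l m k t \<theta> \<eta> x" if "(m,k) \<in> {(1,0), (2,0), (3,0), (1,1), (1,2), (2,1)}" for m k
    using assms that unfolding regular_at_def by blast
  show "((\<lambda>s. pd l m 0 s \<theta> \<eta> x) has_real_derivative pd l (Suc m) 0 t \<theta> \<eta> x) (at t)" if "m < 3"
  proof -
    have "(Suc m, 0) \<in> {(1,0), (2,0), (3,0), (1,1), (1,2), (2,1)}" using that by auto
    from pd_has_derivative_t[OF ex[OF this]] show ?thesis .
  qed
  show "((\<lambda>u. pd l 1 k t u \<eta> x) has_real_derivative pd l 1 (Suc k) t \<theta> \<eta> x) (at \<theta>)" if "k < 2"
  proof -
    have "(1, Suc k) \<in> {(1,0), (2,0), (3,0), (1,1), (1,2), (2,1::nat)}" using that by auto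
    from pd_has_derivative_theta[OF ex[OF this]] show ?thesis by simp
  qed
  show "((\<lambda>u. pd l 2 0 t u \<eta> x) has_real_derivative pd l 2 1 t \<theta> \<eta> x) (at \<theta>)"
    using pd_has_derivative_theta[of l 2 0 t \<theta> \<eta> x] ex[of 2 1] by simp
  show "\<bar>pd l 3 0 t \<theta> \<eta> x\<bar> \<le> E x" "\<bar>pd l 1 2 t \<theta> \<eta> x\<bar> \<le> E x" "\<bar>pd l 2 1 t \<theta> \<eta> x\<bar> \<le> E x"
    using assms unfolding regular_at_def by blast+
qed

lemma smooth_with_envelopesD:
  assumes "smooth_with_envelopes P H lik etat J V" "(m,k) \<in> J"
  shows "AE x in P. \<forall>(t,\<theta>,\<eta>)\<in>V. pd_exists (submodel_loglik lik etat) m k t \<theta> \<eta> x"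
    and "\<exists>E. integrable P E \<and> (AE x in P. \<forall>(t,\<theta>,\<eta>)\<in>V. \<bar>pd (submodel_loglik lik etat) m k t \<theta> \<eta> x\<bar> \<le> E x)"
    and "(t,\<theta>,\<eta>) \<in> V \<Longrightarrow> integrable P (pd (submodel_loglik lik etat) m k t \<theta> \<eta>)"
proof -
  show "AE x in P. \<forall>(t,\<theta>,\<eta>)\<in>V. pd_exists (submodel_loglik lik etat) m k t \<theta> \<eta> x"
    using assms unfolding smooth_with_envelopes_def by blast
  show *: "\<exists>E. integrable P E \<and> (AE x in P. \<forall>(t,\<theta>,\<eta>)\<in>V. \<bar>pd (submodel_loglik lik etat) m k t \<theta> \<eta> x\<bar> \<le> E x)"
    using assms unfolding smooth_with_envelopes_def by blast
  then obtain E where E: "integrable P E"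
    "AE x in P. \<forall>(t,\<theta>,\<eta>)\<in>V. \<bar>pd (submodel_loglik lik etat) m k t \<theta> \<eta> x\<bar> \<le> E x" by blast
  assume V: "(t,\<theta>,\<eta>) \<in> V"
  show "integrable P (pd (submodel_loglik lik etat) m k t \<theta> \<eta>)"
  proof (rule Bochner_Integration.integrable_bound[OF E(1)])
    show "pd (submodel_loglik lik etat) m k t \<theta> \<eta> \<in> borel_measurable P"
      using assms V unfolding smooth_with_envelopes_def by blast
    show "AE x in P. norm (pd (submodel_loglik lik etat) m k t \<theta> \<eta> x) \<le> norm (E x)"
      using E(2)
    proof eventually_elim
      case (elim x)
      with V have "\<bar>pd (submodel_loglik lik etat) m k t \<theta> \<eta> x\<bar> \<le> E x" by blast
      then show ?case by simp
    qed
  qed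
qed

lemma smooth_imp_regular_at:
  assumes S: "smooth_with_envelopes P H lik etat J V"
    and J: "{(1,0), (2,0), (3,0), (1,1), (1,2), (2,1)} \<subseteq> J"
  shows "\<exists>E. integrable P E \<and> (\<forall>x. 0 \<le> E x) \<and> (AE x in P. regular_at (submodel_loglik lik etat) E V x)"
proof -
  let ?l = "submodel_loglik lik etat"
  obtain E1 where E1: "integrable P E1" "AE x in P. \<forall>(t,\<theta>,\<eta>)\<in>V. \<bar>pd ?l 3 0 t \<theta> \<eta> x\<bar> \<le> E1 x"
    using smooth_with_envelopesD(2)[OF S, of 3 0] J by auto
  obtain E2 where E2: "integrable P E2" "AE x in P. \<forall>(t,\<theta>,\<eta>)\<in>V. \<bar>pd ?l 1 2 t \<theta> \<eta> x\<bar> \<le> E2 x"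
    using smooth_with_envelopesD(2)[OF S, of 1 2] J by auto
  obtain E3 where E3: "integrable P E3" "AE x in P. \<forall>(t,\<theta>,\<eta>)\<in>V. \<bar>pd ?l 2 1 t \<theta> \<eta> x\<bar> \<le> E3 x"
    using smooth_with_envelopesD(2)[OF S, of 2 1] J by auto
  define E where "E x = \<bar>E1 x\<bar> + \<bar>E2 x\<bar> + \<bar>E3 x\<bar>" for x
  have "AE x in P. \<forall>(m,k)\<in>{(1,0), (2,0), (3,0), (1,1), (1,2), (2,1)}. \<forall>(t,\<theta>,\<eta>)\<in>V. pd_exists ?l m k t \<theta> \<eta> x"
    using smooth_with_envelopesD(1)[OF S] J by (subst AE_finite_all) auto
  then have "AE x in P. regular_at ?l E V x"
    using E1(2) E2(2) E3(2)
  proof eventually_elim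
    case (elim x)
    have E: "E1 x \<le> E x" "E2 x \<le> E x" "E3 x \<le> E x" by (auto simp: E_def)
    show ?case
      unfolding regular_at_def
    proof (clarify, intro conjI)
      fix t \<theta> \<eta> assume V: "(t,\<theta>,\<eta>) \<in> V"
      show "\<forall>(m,k)\<in>{(1,0), (2,0), (3,0), (1,1), (1,2), (2,1)}. pd_exists ?l m k t \<theta> \<eta> x"
        using elim(1) V by blast
      have "\<bar>pd ?l 3 0 t \<theta> \<eta> x\<bar> \<le> E1 x" "\<bar>pd ?l 1 2 t \<theta> \<eta> x\<bar> \<le> E2 x" "\<bar>pd ?l 2 1 t \<theta> \<eta> x\<bar> \<le> E3 x"
        using elim(2-4) V by blast+
      then show "\<forall>(m,k)\<in>{(3,0), (1,2), (2,1)}. \<bar>pd ?l m k t \<theta> \<eta> x\<bar> \<le> E x"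
        using E by auto
    qed
  qed
  moreover have "integrable P E" unfolding E_def using E1(1) E2(1) E3(1) by auto
  ultimately show ?thesis by (intro exI[of _ E]) (auto simp: E_def)
qed

text \<open>
  Differentiation under the integral sign: the second-order Taylor remainder is integrated against
  the envelope, which identifies the mean of the mixed derivative with the derivative of the mean.
\<close>

lemma mixed_derivative_mean_zero:
  fixes l :: "real \<Rightarrow> real \<Rightarrow> 'h::real_normed_vector \<Rightarrow> 'x \<Rightarrow> real"
  assumes r: "r > 0" and \<eta>0: "\<eta>0 \<in> H"
    and reg: "AE x in P. regular_at l E (par_box \<theta>0 H \<eta>0 r) x" and E: "integrable P E"
    and int: "\<And>\<theta>. \<bar>\<theta> - \<theta>0\<bar> < r \<Longrightarrow> integrable P (pd l 1 0 \<theta>0 \<theta> \<eta>0)" "integrable P (pd l 1 1 \<theta>0 \<theta>0 \<eta>0)"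
    and deriv: "((\<lambda>\<theta>. \<integral>x. pd l 1 0 \<theta>0 \<theta> \<eta>0 x \<partial>P) has_real_derivative 0) (at \<theta>0)"
  shows "(\<integral>x. pd l 1 1 \<theta>0 \<theta>0 \<eta>0 x \<partial>P) = 0"
proof -
  have mem: "(\<theta>0, \<theta>, \<eta>0) \<in> par_box \<theta>0 H \<eta>0 r" if "\<bar>\<theta> - \<theta>0\<bar> < r" for \<theta>
    using that r \<eta>0 by (auto simp: par_box_def)
  have "((\<lambda>\<theta>. \<integral>x. pd l 1 0 \<theta>0 \<theta> \<eta>0 x \<partial>P) has_real_derivative (\<integral>x. pd l 1 1 \<theta>0 \<theta>0 \<eta>0 x \<partial>P)) (at \<theta>0)"
  proof (rule derivative_of_quadratic_remainder[OF r])
    fix t assume t: "\<bar>t - \<theta>0\<bar> < r"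
    have "\<bar>(\<integral>x. pd l 1 0 \<theta>0 t \<eta>0 x \<partial>P) - (\<Sum>m<2. (\<integral>x. pd l 1 m \<theta>0 \<theta>0 \<eta>0 x \<partial>P) / fact m * (t - \<theta>0) ^ m)\<bar>
        \<le> (\<integral>x. E x \<partial>P) * \<bar>t - \<theta>0\<bar> ^ 2"
    proof (rule integral_Taylor[where k=2 and P=P and c=\<theta>0 and r=r and f="\<lambda>m u. pd l 1 m \<theta>0 u \<eta>0"])
      show "AE x in P. \<forall>m<2. \<forall>s. \<bar>s - \<theta>0\<bar> < r \<longrightarrow>
          ((\<lambda>s. pd l 1 m \<theta>0 s \<eta>0 x) has_real_derivative pd l 1 (Suc m) \<theta>0 s \<eta>0 x) (at s)"
        using reg by eventually_elim (intro allI impI, rule regular_atD(2)[OF _ mem], assumption+)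
      show "AE x in P. \<forall>s. \<bar>s - \<theta>0\<bar> < r \<longrightarrow> \<bar>pd l 1 2 \<theta>0 s \<eta>0 x\<bar> \<le> E x"
        using reg by eventually_elim (intro allI impI, rule regular_atD(5)[OF _ mem], assumption+)
      show "integrable P (pd l 1 m \<theta>0 \<theta>0 \<eta>0)" if "m < 2" for m
        using that int(1)[of \<theta>0] int(2) r by (cases m) auto
    qed (use t int E in auto)
    then show "\<bar>(\<integral>x. pd l 1 0 \<theta>0 t \<eta>0 x \<partial>P) - (\<integral>x. pd l 1 0 \<theta>0 \<theta>0 \<eta>0 x \<partial>P) -
        (t - \<theta>0) * (\<integral>x. pd l 1 1 \<theta>0 \<theta>0 \<eta>0 x \<partial>P)\<bar> \<le> (\<integral>x. E x \<partial>P) * (t - \<theta>0)\<^sup>2"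
      by (simp add: numeral_2_eq_2 algebra_simps)
  qed
  then show ?thesis using deriv DERIV_unique by blast
qed

section \<open>Expansion of the log-likelihood along the submodel\<close>

text \<open>
  The expansion at \<open>\<theta>0\<close> of \<open>t \<mapsto> P\<^sub>n \<ell>(t,\<theta>,\<eta>)\<close> and of its derivative, with error constant \<open>D\<close>; in the
  application \<open>S\<close> is the empirical mean of the efficient score. The argument \<open>t\<close> is left free since
  the lower half of the sandwich evaluates the function for \<open>\<theta> = \<theta>0\<close> at another point.
\<close>

definition expands ::
  "(real \<Rightarrow> real \<Rightarrow> 'h \<Rightarrow> 'x \<Rightarrow> real) \<Rightarrow> real \<Rightarrow> real \<Rightarrow> real \<Rightarrow> (nat \<Rightarrow> 'x) \<Rightarrow> nat \<Rightarrow> real \<Rightarrow> real \<Rightarrow>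
     real \<Rightarrow> 'h \<Rightarrow> bool" where
  "expands l \<theta>0 I0 S x n r D \<theta> \<eta> \<longleftrightarrow> (\<forall>t. \<bar>t - \<theta>0\<bar> < r \<longrightarrow>
     \<bar>emp_mean x n (l t \<theta> \<eta>) - emp_mean x n (l \<theta>0 \<theta> \<eta>) - (t - \<theta>0) * S + I0 / 2 * (t - \<theta>0)\<^sup>2\<bar>
       \<le> D * \<bar>t - \<theta>0\<bar> * (1 / sqrt (real n) + \<bar>\<theta> - \<theta>0\<bar> + \<bar>t - \<theta>0\<bar>)\<^sup>2 \<and>
     \<bar>emp_mean x n (pd l 1 0 t \<theta> \<eta>) - S + (t - \<theta>0) * I0\<bar>
       \<le> D * (1 / sqrt (real n) + \<bar>\<theta> - \<theta>0\<bar> + \<bar>t - \<theta>0\<bar>)\<^sup>2)"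

text \<open>
  The heart of the argument, on one fixed sample. Three facts about derivatives at \<open>\<theta>0\<close> are
  assembled, with \<open>\<delta> = n\<^sup>-\<^sup>1\<^sup>/\<^sup>2 + \<bar>\<theta> - \<theta>0\<bar>\<close>. At \<open>(\<theta>0,\<theta>0,\<eta>)\<close> the score differs from \<open>S\<close> by an empirical
  process term of size \<open>n\<^sup>-\<^sup>1\<^sup>/\<^sup>2 \<delta>\<close> and a mean of size \<open>\<delta>\<^sup>2\<close>. Moving the second argument from \<open>\<theta>0\<close> to
  \<open>\<theta>\<close> costs \<open>\<bar>\<theta> - \<theta>0\<bar>\<close> times the mixed derivative, itself only \<open>O(\<delta>)\<close>, plus a quadratic remainder.
  The second derivative is \<open>- I0\<close> up to \<open>O(\<delta>)\<close>.
\<close>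

lemma submodel_expansion:
  fixes l :: "real \<Rightarrow> real \<Rightarrow> 'h::real_normed_vector \<Rightarrow> 'x \<Rightarrow> real"
  assumes n: "n \<ge> 1" and C: "C \<ge> 1"
    and reg: "\<And>i. i < n \<Longrightarrow> regular_at l E (par_box \<theta>0 H \<eta>0 r) (x i)"
    and \<theta>: "\<bar>\<theta> - \<theta>0\<bar> < r" and \<eta>: "\<eta> \<in> H" "norm (\<eta> - \<eta>0) < r"
    and rate: "norm (\<eta> - \<eta>0) \<le> C * (1 / sqrt (real n) + \<bar>\<theta> - \<theta>0\<bar>)"
    and int: "integrable P (pd l 1 0 \<theta>0 \<theta>0 \<eta>)" "integrable P (pd l 1 0 \<theta>0 \<theta>0 \<eta>0)"
    and P0: "(\<integral>y. pd l 1 0 \<theta>0 \<theta>0 \<eta>0 y \<partial>P) = 0"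
    and P10: "\<bar>\<integral>y. pd l 1 0 \<theta>0 \<theta>0 \<eta> y \<partial>P\<bar> \<le> C * (norm (\<eta> - \<eta>0))\<^sup>2"
    and P11: "\<bar>\<integral>y. pd l 1 1 \<theta>0 \<theta>0 \<eta> y \<partial>P\<bar> \<le> C * norm (\<eta> - \<eta>0)"
    and P20: "\<bar>(\<integral>y. pd l 2 0 \<theta>0 \<theta>0 \<eta> y \<partial>P) + I0\<bar> \<le> C * norm (\<eta> - \<eta>0)"
    and G10: "\<bar>emp_proc P x n (\<lambda>y. pd l 1 0 \<theta>0 \<theta>0 \<eta> y - pd l 1 0 \<theta>0 \<theta>0 \<eta>0 y)\<bar> \<le> C * norm (\<eta> - \<eta>0)"
    and G11: "\<bar>emp_proc P x n (pd l 1 1 \<theta>0 \<theta>0 \<eta>)\<bar> \<le> C"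
    and G20: "\<bar>emp_proc P x n (pd l 2 0 \<theta>0 \<theta>0 \<eta>)\<bar> \<le> C"
    and E: "emp_mean x n E \<le> C"
  shows "expands l \<theta>0 I0 (emp_mean x n (pd l 1 0 \<theta>0 \<theta>0 \<eta>0)) x n r (5 * C ^ 3) \<theta> \<eta>"
proof -
  define N where "N = norm (\<eta> - \<eta>0)"
  define q where "q = 1 / sqrt (real n)"
  define d where "d = \<bar>\<theta> - \<theta>0\<bar>"
  define \<delta> where "\<delta> = q + d"
  define S where "S = emp_mean x n (pd l 1 0 \<theta>0 \<theta>0 \<eta>0)"
  have r: "r > 0" using \<theta> by auto
  have q: "0 \<le> q" "q \<le> \<delta>" and d: "0 \<le> d" "d \<le> \<delta>" and \<delta>: "0 \<le> \<delta>" and N: "0 \<le> N" "N \<le> C * \<delta>"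
    using rate by (auto simp: q_def d_def \<delta>_def N_def)
  \<comment> \<open>The powers of \<open>C\<close> come from \<open>norm (\<eta> - \<eta>0) \<le> C \<delta>\<close>; since \<open>C \<ge> 1\<close> all are replaced by \<open>C\<^sup>3\<close>.\<close>
  have C2: "C \<le> C ^ 2" "C ^ 2 \<le> C ^ 3" "1 \<le> C ^ 2"
    using C power_increasing[of 1 2 C] power_increasing[of 2 3 C] by simp_all
  have CN: "C * N \<le> C ^ 2 * \<delta>"
    using mult_left_mono[OF N(2), of C] C by (simp add: power2_eq_square)
  have CN2: "C * N\<^sup>2 \<le> C ^ 3 * \<delta>\<^sup>2"
  proof -
    have "N\<^sup>2 \<le> (C * \<delta>)\<^sup>2" using N by (intro power_mono)
    from mult_left_mono[OF this, of C] C show ?thesis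
      by (simp add: power_mult_distrib power2_eq_square power3_eq_cube mult_ac)
  qed
  have emp: "emp_mean x n f = (\<integral>y. f y \<partial>P) + emp_proc P x n f * q" for f
    using emp_mean_eq_emp_proc[OF n] by (simp add: q_def)
  have Gq: "\<bar>G * q\<bar> \<le> K * \<delta>" if "\<bar>G\<bar> \<le> K" for G K
    unfolding abs_mult using that q \<delta> by (intro mult_mono) auto
  have mem: "(t, \<theta>', \<eta>) \<in> par_box \<theta>0 H \<eta>0 r" if "\<bar>t - \<theta>0\<bar> < r" "\<bar>\<theta>' - \<theta>0\<bar> < r" for t \<theta>'
    using that \<eta> by (simp add: par_box_def)
  note D = regular_atD[OF reg mem]

  have s1: "\<bar>emp_mean x n (pd l 1 0 \<theta>0 \<theta>0 \<eta>) - S\<bar> \<le> 2 * C ^ 3 * \<delta>\<^sup>2"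
  proof -
    have "emp_mean x n (pd l 1 0 \<theta>0 \<theta>0 \<eta>) - S =
        emp_mean x n (\<lambda>y. pd l 1 0 \<theta>0 \<theta>0 \<eta> y - pd l 1 0 \<theta>0 \<theta>0 \<eta>0 y)"
      by (simp add: S_def emp_mean_diff)
    also have "\<dots> = (\<integral>y. pd l 1 0 \<theta>0 \<theta>0 \<eta> y \<partial>P) +
        emp_proc P x n (\<lambda>y. pd l 1 0 \<theta>0 \<theta>0 \<eta> y - pd l 1 0 \<theta>0 \<theta>0 \<eta>0 y) * q"
      using int P0 by (simp add: emp)
    finally have "\<bar>emp_mean x n (pd l 1 0 \<theta>0 \<theta>0 \<eta>) - S\<bar> \<le> C * N\<^sup>2 + C * N * \<delta>"
      using P10 Gq[OF G10] by (simp add: N_def)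
    also have "\<dots> \<le> C ^ 3 * \<delta>\<^sup>2 + C ^ 2 * \<delta>\<^sup>2"
      using CN2 mult_right_mono[OF CN \<delta>] by (simp add: power2_eq_square mult.assoc)
    also have "\<dots> \<le> C ^ 3 * \<delta>\<^sup>2 + C ^ 3 * \<delta>\<^sup>2"
      using C2 by (intro add_mono mult_right_mono) auto
    finally show ?thesis by simp
  qed
  have s2: "\<bar>emp_mean x n (pd l 1 1 \<theta>0 \<theta>0 \<eta>)\<bar> \<le> 2 * C ^ 3 * \<delta>"
  proof -
    have "\<bar>emp_mean x n (pd l 1 1 \<theta>0 \<theta>0 \<eta>)\<bar> \<le> C * N + C * \<delta>"
      unfolding emp using P11 Gq[OF G11] by (simp add: N_def)
    also have "\<dots> \<le> C ^ 3 * \<delta> + C ^ 3 * \<delta>"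
      using C2 CN mult_right_mono[OF _ \<delta>, of "C ^ 2" "C ^ 3"] mult_right_mono[OF _ \<delta>, of C "C ^ 3"]
      by (intro add_mono) auto
    finally show ?thesis by (simp only: mult_2 distrib_right)
  qed
  have s3: "\<bar>emp_mean x n (pd l 1 0 \<theta>0 \<theta> \<eta>) - S\<bar> \<le> 5 * C ^ 3 * \<delta>\<^sup>2"
  proof -
    have "\<bar>emp_mean x n (pd l 1 0 \<theta>0 \<theta> \<eta>) -
        (\<Sum>m<2. emp_mean x n (pd l 1 m \<theta>0 \<theta>0 \<eta>) / fact m * (\<theta> - \<theta>0) ^ m)\<bar>
        \<le> emp_mean x n E * \<bar>\<theta> - \<theta>0\<bar> ^ 2"
      by (rule emp_mean_Taylor[of 2 n \<theta>0 r "\<lambda>m u. pd l 1 m \<theta>0 u \<eta>"])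
        (use D r \<theta> in \<open>auto simp: numeral_2_eq_2\<close>)
    then have T: "\<bar>emp_mean x n (pd l 1 0 \<theta>0 \<theta> \<eta>) - emp_mean x n (pd l 1 0 \<theta>0 \<theta>0 \<eta>) -
        emp_mean x n (pd l 1 1 \<theta>0 \<theta>0 \<eta>) * (\<theta> - \<theta>0)\<bar> \<le> emp_mean x n E * d\<^sup>2"
      by (simp add: numeral_2_eq_2 d_def algebra_simps)
    have "emp_mean x n E * d\<^sup>2 \<le> C * \<delta>\<^sup>2"
      using E d C by (intro mult_mono power_mono) auto
    also have "\<dots> \<le> C ^ 3 * \<delta>\<^sup>2" using C2 by (intro mult_right_mono) auto
    finally have T': "emp_mean x n E * d\<^sup>2 \<le> C ^ 3 * \<delta>\<^sup>2" .
    have "\<bar>emp_mean x n (pd l 1 1 \<theta>0 \<theta>0 \<eta>) * (\<theta> - \<theta>0)\<bar> \<le> 2 * C ^ 3 * \<delta> * \<delta>"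
      unfolding abs_mult using s2 d \<delta> C by (intro mult_mono) (auto simp: d_def)
    then have "\<bar>emp_mean x n (pd l 1 1 \<theta>0 \<theta>0 \<eta>) * (\<theta> - \<theta>0)\<bar> \<le> 2 * C ^ 3 * \<delta>\<^sup>2"
      by (simp add: power2_eq_square)
    with T T' s1 show ?thesis by linarith
  qed
  have s4: "\<bar>emp_mean x n (pd l 2 0 \<theta>0 \<theta> \<eta>) + I0\<bar> \<le> 3 * C ^ 3 * \<delta>"
  proof -
    have "\<bar>emp_mean x n (pd l 2 0 \<theta>0 \<theta> \<eta>) -
        (\<Sum>m<1. emp_mean x n (pd l 2 m \<theta>0 \<theta>0 \<eta>) / fact m * (\<theta> - \<theta>0) ^ m)\<bar>
        \<le> emp_mean x n E * \<bar>\<theta> - \<theta>0\<bar> ^ 1"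
      by (rule emp_mean_Taylor[of 1 n \<theta>0 r "\<lambda>m u. pd l 2 m \<theta>0 u \<eta>"])
        (use D r \<theta> in auto)
    then have T: "\<bar>emp_mean x n (pd l 2 0 \<theta>0 \<theta> \<eta>) - emp_mean x n (pd l 2 0 \<theta>0 \<theta>0 \<eta>)\<bar> \<le> emp_mean x n E * d"
      by (simp add: d_def)
    have "emp_mean x n E * d \<le> C * \<delta>" using E d C by (intro mult_mono) auto
    with T have "\<bar>emp_mean x n (pd l 2 0 \<theta>0 \<theta> \<eta>) + I0\<bar> \<le> C * \<delta> + (C * N + C * \<delta>)"
      using P20 Gq[OF G20] emp[of "pd l 2 0 \<theta>0 \<theta>0 \<eta>"] by (simp add: N_def)
    also have "\<dots> \<le> C ^ 3 * \<delta> + (C ^ 3 * \<delta> + C ^ 3 * \<delta>)"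
      using C2 CN mult_right_mono[OF _ \<delta>, of "C ^ 2" "C ^ 3"] mult_right_mono[OF _ \<delta>, of C "C ^ 3"]
      by (intro add_mono) auto
    finally show ?thesis by (simp add: mult_ac)
  qed
  show ?thesis
    unfolding expands_def S_def[symmetric] q_def[symmetric] d_def[symmetric] \<delta>_def[symmetric]
  proof (intro allI impI)
    fix t assume t: "\<bar>t - \<theta>0\<bar> < r"
    \<comment> \<open>All error terms are dominated by the terms of \<open>5 C\<^sup>3 (\<delta> + a)\<^sup>2\<close>, which explains the constant.\<close>
    define a where "a = \<bar>t - \<theta>0\<bar>"
    have a: "0 \<le> a" by (simp add: a_def)
    have E3: "emp_mean x n E * a ^ k \<le> C ^ 3 * a ^ k" for k
      using E C2 a by (intro mult_right_mono) auto
    have sq: "(\<delta> + a)\<^sup>2 = \<delta>\<^sup>2 + 2 * \<delta> * a + a\<^sup>2" by (simp add: power2_sum algebra_simps)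
    have nn: "0 \<le> C ^ 3 * \<delta> * a" "0 \<le> C ^ 3 * a\<^sup>2" using C \<delta> a by auto
    have "\<bar>emp_mean x n (pd l 1 0 t \<theta> \<eta>) -
        (\<Sum>m<2. emp_mean x n (pd l (Suc m) 0 \<theta>0 \<theta> \<eta>) / fact m * (t - \<theta>0) ^ m)\<bar>
        \<le> emp_mean x n E * \<bar>t - \<theta>0\<bar> ^ 2"
      using emp_mean_Taylor[of 2 n \<theta>0 r "\<lambda>m s. pd l (Suc m) 0 s \<theta> \<eta>" x E t] D \<theta> t
      by (auto simp: eval_nat_numeral)
    then have T2: "\<bar>emp_mean x n (pd l 1 0 t \<theta> \<eta>) - emp_mean x n (pd l 1 0 \<theta>0 \<theta> \<eta>) -
        emp_mean x n (pd l 2 0 \<theta>0 \<theta> \<eta>) * (t - \<theta>0)\<bar> \<le> emp_mean x n E * a\<^sup>2"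
      by (simp add: eval_nat_numeral a_def algebra_simps)
    have m2: "\<bar>(emp_mean x n (pd l 2 0 \<theta>0 \<theta> \<eta>) + I0) * (t - \<theta>0)\<bar> \<le> 3 * C ^ 3 * \<delta> * a"
      unfolding abs_mult a_def using s4 by (intro mult_right_mono) auto
    have "\<bar>emp_mean x n (pd l 1 0 t \<theta> \<eta>) - S + (t - \<theta>0) * I0\<bar>
        \<le> C ^ 3 * a\<^sup>2 + 5 * C ^ 3 * \<delta>\<^sup>2 + 3 * C ^ 3 * \<delta> * a"
    proof -
      have "emp_mean x n (pd l 1 0 t \<theta> \<eta>) - S + (t - \<theta>0) * I0 =
        (emp_mean x n (pd l 1 0 t \<theta> \<eta>) - emp_mean x n (pd l 1 0 \<theta>0 \<theta> \<eta>) -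
          emp_mean x n (pd l 2 0 \<theta>0 \<theta> \<eta>) * (t - \<theta>0)) +
        (emp_mean x n (pd l 1 0 \<theta>0 \<theta> \<eta>) - S) + (emp_mean x n (pd l 2 0 \<theta>0 \<theta> \<eta>) + I0) * (t - \<theta>0)"
        by (simp add: algebra_simps)
      then show ?thesis using T2 E3[of 2] m2 s3 by linarith
    qed
    also have "\<dots> \<le> 5 * C ^ 3 * (\<delta> + a)\<^sup>2"
      using nn unfolding sq by (simp add: algebra_simps)
    finally have second: "\<bar>emp_mean x n (pd l 1 0 t \<theta> \<eta>) - S + (t - \<theta>0) * I0\<bar> \<le> 5 * C ^ 3 * (\<delta> + a)\<^sup>2" .
    have "\<bar>emp_mean x n (pd l 0 0 t \<theta> \<eta>) -
        (\<Sum>m<3. emp_mean x n (pd l m 0 \<theta>0 \<theta> \<eta>) / fact m * (t - \<theta>0) ^ m)\<bar>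
        \<le> emp_mean x n E * \<bar>t - \<theta>0\<bar> ^ 3"
      by (rule emp_mean_Taylor[of 3 n \<theta>0 r "\<lambda>m s. pd l m 0 s \<theta> \<eta>" x E t])
        (use D \<theta> t in auto)
    moreover have "(\<lambda>y. pd l 0 0 s \<theta> \<eta> y) = l s \<theta> \<eta>" for s by (simp add: pd_0_0 fun_eq_iff)
    ultimately have T3: "\<bar>emp_mean x n (l t \<theta> \<eta>) - emp_mean x n (l \<theta>0 \<theta> \<eta>) -
        emp_mean x n (pd l 1 0 \<theta>0 \<theta> \<eta>) * (t - \<theta>0) -
        emp_mean x n (pd l 2 0 \<theta>0 \<theta> \<eta>) / 2 * (t - \<theta>0)\<^sup>2\<bar> \<le> emp_mean x n E * a ^ 3"
      by (simp add: eval_nat_numeral a_def algebra_simps)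
    have m3: "\<bar>(emp_mean x n (pd l 1 0 \<theta>0 \<theta> \<eta>) - S) * (t - \<theta>0)\<bar> \<le> 5 * C ^ 3 * \<delta>\<^sup>2 * a"
      unfolding abs_mult a_def using s3 by (intro mult_right_mono) auto
    have m4: "\<bar>(emp_mean x n (pd l 2 0 \<theta>0 \<theta> \<eta>) + I0) * (t - \<theta>0)\<^sup>2\<bar> \<le> 3 * C ^ 3 * \<delta> * a\<^sup>2"
      unfolding abs_mult a_def using s4 by (auto intro!: mult_right_mono)
    have "\<bar>emp_mean x n (l t \<theta> \<eta>) - emp_mean x n (l \<theta>0 \<theta> \<eta>) - (t - \<theta>0) * S + I0 / 2 * (t - \<theta>0)\<^sup>2\<bar>
        \<le> C ^ 3 * a ^ 3 + 5 * C ^ 3 * \<delta>\<^sup>2 * a + 3 * C ^ 3 * \<delta> * a\<^sup>2"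
    proof -
      have "emp_mean x n (l t \<theta> \<eta>) - emp_mean x n (l \<theta>0 \<theta> \<eta>) - (t - \<theta>0) * S + I0 / 2 * (t - \<theta>0)\<^sup>2 =
        (emp_mean x n (l t \<theta> \<eta>) - emp_mean x n (l \<theta>0 \<theta> \<eta>) -
          emp_mean x n (pd l 1 0 \<theta>0 \<theta> \<eta>) * (t - \<theta>0) -
          emp_mean x n (pd l 2 0 \<theta>0 \<theta> \<eta>) / 2 * (t - \<theta>0)\<^sup>2) +
        (emp_mean x n (pd l 1 0 \<theta>0 \<theta> \<eta>) - S) * (t - \<theta>0) +
        ((emp_mean x n (pd l 2 0 \<theta>0 \<theta> \<eta>) + I0) * (t - \<theta>0)\<^sup>2) / 2"
        by (simp add: algebra_simps add_divide_distrib)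
      then show ?thesis using T3 E3[of 3] m3 m4 by linarith
    qed
    also have "\<dots> \<le> 5 * C ^ 3 * a * (\<delta> + a)\<^sup>2"
    proof -
      have "0 \<le> C ^ 3 * a ^ 3" "0 \<le> C ^ 3 * \<delta> * a\<^sup>2" using C \<delta> a by auto
      then show ?thesis unfolding sq by (simp add: algebra_simps power2_eq_square power3_eq_cube)
    qed
    finally show "\<bar>emp_mean x n (l t \<theta> \<eta>) - emp_mean x n (l \<theta>0 \<theta> \<eta>) - (t - \<theta>0) * S + I0 / 2 * (t - \<theta>0)\<^sup>2\<bar>
        \<le> 5 * C ^ 3 * \<bar>t - \<theta>0\<bar> * (\<delta> + \<bar>t - \<theta>0\<bar>)\<^sup>2 \<and>
      \<bar>emp_mean x n (pd l 1 0 t \<theta> \<eta>) - S + (t - \<theta>0) * I0\<bar> \<le> 5 * C ^ 3 * (\<delta> + \<bar>t - \<theta>0\<bar>)\<^sup>2"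
      using second by (simp add: a_def)
  qed
qed

lemma expands_mono:
  assumes "expands l \<theta>0 I0 S x n r D \<theta> \<eta>" "D \<le> D'"
  shows "expands l \<theta>0 I0 S x n r D' \<theta> \<eta>"
proof -
  have "D * \<bar>t - \<theta>0\<bar> * w\<^sup>2 \<le> D' * \<bar>t - \<theta>0\<bar> * w\<^sup>2" "D * w\<^sup>2 \<le> D' * w\<^sup>2" for t w :: real
    using assms(2) by (auto intro!: mult_right_mono)
  then show ?thesis
    using assms(1) unfolding expands_def by (meson order_trans)
qed

text \<open>
  All random hypotheses of \<open>submodel_expansion\<close> are collected under one constant \<open>C\<close>. Consistency of
  \<open>th\<close> together with the rate of \<open>et\<close> then places both estimators inside the box.
\<close>

lemma (in iid_sample) expansion_tightly:
  fixes l :: "real \<Rightarrow> real \<Rightarrow> 'h::real_normed_vector \<Rightarrow> 'x \<Rightarrow> real"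
    and th :: "nat \<Rightarrow> 'w \<Rightarrow> real" and et :: "nat \<Rightarrow> 'w \<Rightarrow> 'h"
  assumes r: "r > 0" and \<eta>0: "\<eta>0 \<in> H"
    and reg: "AE x in P. regular_at l E (par_box \<theta>0 H \<eta>0 r) x"
    and E: "integrable P E" "\<And>x. 0 \<le> E x"
    and int: "\<And>\<eta>. \<eta> \<in> H \<Longrightarrow> norm (\<eta> - \<eta>0) < r \<Longrightarrow> integrable P (pd l 1 0 \<theta>0 \<theta>0 \<eta>)"
    and P0: "(\<integral>y. pd l 1 0 \<theta>0 \<theta>0 \<eta>0 y \<partial>P) = 0"
    and P10: "\<And>\<eta>. \<eta> \<in> H \<Longrightarrow> norm (\<eta> - \<eta>0) < r \<Longrightarrow>
      \<bar>\<integral>y. pd l 1 0 \<theta>0 \<theta>0 \<eta> y \<partial>P\<bar> \<le> K * (norm (\<eta> - \<eta>0))\<^sup>2"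
    and P11: "\<And>\<eta>. \<eta> \<in> H \<Longrightarrow> norm (\<eta> - \<eta>0) < r \<Longrightarrow>
      \<bar>\<integral>y. pd l 1 1 \<theta>0 \<theta>0 \<eta> y \<partial>P\<bar> \<le> K * norm (\<eta> - \<eta>0)"
    and P20: "\<And>\<eta>. \<eta> \<in> H \<Longrightarrow> norm (\<eta> - \<eta>0) < r \<Longrightarrow>
      \<bar>(\<integral>y. pd l 2 0 \<theta>0 \<theta>0 \<eta> y \<partial>P) + I0\<bar> \<le> K * norm (\<eta> - \<eta>0)"
    and G10: "tightly M (\<lambda>C n \<omega>. \<forall>\<eta>\<in>H. norm (\<eta> - \<eta>0) < r \<longrightarrow>
      \<bar>emp_proc P (\<lambda>i. X i \<omega>) n (\<lambda>y. pd l 1 0 \<theta>0 \<theta>0 \<eta> y - pd l 1 0 \<theta>0 \<theta>0 \<eta>0 y)\<bar>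
        \<le> C * norm (\<eta> - \<eta>0))"
    and G11: "tightly M (\<lambda>C n \<omega>. \<forall>\<eta>\<in>H. norm (\<eta> - \<eta>0) < r \<longrightarrow>
      \<bar>emp_proc P (\<lambda>i. X i \<omega>) n (pd l 1 1 \<theta>0 \<theta>0 \<eta>)\<bar> \<le> C)"
    and G20: "tightly M (\<lambda>C n \<omega>. \<forall>\<eta>\<in>H. norm (\<eta> - \<eta>0) < r \<longrightarrow>
      \<bar>emp_proc P (\<lambda>i. X i \<omega>) n (pd l 2 0 \<theta>0 \<theta>0 \<eta>)\<bar> \<le> C)"
    and th: "o_P_1 M (\<lambda>n \<omega>. th n \<omega> - \<theta>0)"
    and etH: "whp M (\<lambda>n \<omega>. et n \<omega> \<in> H)"
    and rate: "O_P M (\<lambda>n \<omega>. norm (et n \<omega> - \<eta>0)) (\<lambda>n \<omega>. 1 / sqrt (real n) + \<bar>th n \<omega> - \<theta>0\<bar>)"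
  shows "tightly M (\<lambda>D n \<omega>. 0 \<le> D \<and> \<bar>th n \<omega> - \<theta>0\<bar> < r \<and> et n \<omega> \<in> H \<and> norm (et n \<omega> - \<eta>0) < r \<and>
    expands l \<theta>0 I0 (emp_mean (\<lambda>i. X i \<omega>) n (pd l 1 0 \<theta>0 \<theta>0 \<eta>0)) (\<lambda>i. X i \<omega>) n r D (th n \<omega>) (et n \<omega>))"
proof -
  let ?\<delta> = "\<lambda>n \<omega>. 1 / sqrt (real n) + \<bar>th n \<omega> - \<theta>0\<bar>"
  define EK where "EK C n \<omega> \<longleftrightarrow> max 1 K \<le> C \<and> emp_mean (\<lambda>i. X i \<omega>) n E \<le> C" for C n \<omega>
  define g10 where "g10 C n \<omega> \<longleftrightarrow> (\<forall>\<eta>\<in>H. norm (\<eta> - \<eta>0) < r \<longrightarrow>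
      \<bar>emp_proc P (\<lambda>i. X i \<omega>) n (\<lambda>y. pd l 1 0 \<theta>0 \<theta>0 \<eta> y - pd l 1 0 \<theta>0 \<theta>0 \<eta>0 y)\<bar>
        \<le> C * norm (\<eta> - \<eta>0))" for C n \<omega>
  define g11 where "g11 C n \<omega> \<longleftrightarrow> (\<forall>\<eta>\<in>H. norm (\<eta> - \<eta>0) < r \<longrightarrow>
      \<bar>emp_proc P (\<lambda>i. X i \<omega>) n (pd l 1 1 \<theta>0 \<theta>0 \<eta>)\<bar> \<le> C)" for C n \<omega>
  define g20 where "g20 C n \<omega> \<longleftrightarrow> (\<forall>\<eta>\<in>H. norm (\<eta> - \<eta>0) < r \<longrightarrow>
      \<bar>emp_proc P (\<lambda>i. X i \<omega>) n (pd l 2 0 \<theta>0 \<theta>0 \<eta>)\<bar> \<le> C)" for C n \<omega>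
  define rt where "rt C n \<omega> \<longleftrightarrow> \<bar>norm (et n \<omega> - \<eta>0)\<bar> \<le> C * ?\<delta> n \<omega>" for C n \<omega>
  note defs = EK_def g10_def g11_def g20_def rt_def
  define good where "good C n \<omega> \<longleftrightarrow> EK C n \<omega> \<and> g10 C n \<omega> \<and> g11 C n \<omega> \<and> g20 C n \<omega> \<and> rt C n \<omega>" for C n \<omega>
  have mono: "a \<le> C' * b" if "C \<le> C'" "a \<le> C * b" "0 \<le> b" for a b C C' :: real
    using that mult_right_mono[of C C' b] by linarith
  have mono_EK: "EK C' n \<omega>" if "C \<le> C'" "EK C n \<omega>" for C C' n \<omega>
    using that unfolding EK_def by auto
  have mono11: "g11 C' n \<omega>" if "C \<le> C'" "g11 C n \<omega>" for C C' n \<omega>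
    using that unfolding g11_def by (blast intro: order_trans)
  have mono20: "g20 C' n \<omega>" if "C \<le> C'" "g20 C n \<omega>" for C C' n \<omega>
    using that unfolding g20_def by (blast intro: order_trans)
  have mono10: "g10 C' n \<omega>" if "C \<le> C'" "g10 C n \<omega>" for C C' n \<omega>
    unfolding g10_def
  proof (intro ballI impI)
    fix \<eta> assume "\<eta> \<in> H" "norm (\<eta> - \<eta>0) < r"
    then show "\<bar>emp_proc P (\<lambda>i. X i \<omega>) n (\<lambda>y. pd l 1 0 \<theta>0 \<theta>0 \<eta> y - pd l 1 0 \<theta>0 \<theta>0 \<eta>0 y)\<bar>
        \<le> C' * norm (\<eta> - \<eta>0)"
      using that(2) unfolding g10_def by (intro mono[OF that(1)]) auto
  qed
  have mono_rt: "rt C' n \<omega>" if "C \<le> C'" "rt C n \<omega>" for C C' n \<omega>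
    unfolding rt_def by (rule mono[OF that(1) that(2)[unfolded rt_def]]) simp
  have "tightly M EK"
    unfolding EK_def by (rule tightly_conj[OF tightly_const emp_mean_tightly[OF E]]) auto
  moreover have "tightly M g10" "tightly M g11" "tightly M g20" "tightly M rt"
    using G10 G11 G20 rate unfolding defs O_P_tightly by auto
  ultimately have "tightly M good"
    unfolding good_def by (intro tightly_conj) (blast intro: mono_EK mono10 mono11 mono20 mono_rt)+
  moreover have "whp M (\<lambda>n \<omega>. (\<forall>i. regular_at l E (par_box \<theta>0 H \<eta>0 r) (X i \<omega>)) \<and> et n \<omega> \<in> H \<and>
      \<bar>th n \<omega> - \<theta>0\<bar> < r \<and> C * ?\<delta> n \<omega> < r)" for C
  proof -
    define C1 where "C1 = max 1 C"
    \<comment> \<open>Once \<open>n\<^sup>-\<^sup>1\<^sup>/\<^sup>2\<close> and \<open>\<bar>th - \<theta>0\<bar>\<close> are both at most \<open>\<rho>\<close>, the rate bound is at most \<open>r/2\<close>.\<close>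
    define \<rho> where "\<rho> = r / (4 * C1)"
    have C1: "1 \<le> C1" "C \<le> C1" by (auto simp: C1_def)
    have \<rho>: "\<rho> > 0" "\<rho> < r" "C1 * \<rho> = r / 4"
      using r C1(1) by (auto simp: \<rho>_def field_simps)
    have w: "whp M (\<lambda>n \<omega>. (\<forall>i. regular_at l E (par_box \<theta>0 H \<eta>0 r) (X i \<omega>)) \<and> et n \<omega> \<in> H \<and>
        \<bar>th n \<omega> - \<theta>0\<bar> \<le> \<rho>)"
      by (intro whp_conj whp_AE AE_X reg etH o_P_1_whp th \<rho>)
    have ev: "\<forall>\<^sub>F n in sequentially. 1 / sqrt (real n) < \<rho>"
    proof -
      have "(\<lambda>n. 1 / sqrt (real n)) \<longlonglongrightarrow> 0"
        using tendsto_inverse_0_at_top[OF filterlim_compose[OF sqrt_at_top filterlim_real_sequentially]]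
        by (simp add: inverse_eq_divide)
      then show ?thesis using \<rho>(1) by (rule order_tendstoD)
    qed
    show ?thesis
    proof (rule whp_mono[OF w], use ev in eventually_elim)
        case (elim n)
        have "C * ?\<delta> n \<omega> < r" if "\<bar>th n \<omega> - \<theta>0\<bar> \<le> \<rho>" for \<omega>
        proof -
          have "C * ?\<delta> n \<omega> \<le> C1 * ?\<delta> n \<omega>"
            using C1 by (intro mult_right_mono) auto
          also have "\<dots> \<le> C1 * (\<rho> + \<rho>)"
            using that elim C1 by (intro mult_left_mono) auto
          also have "\<dots> < r" using \<rho> r by (simp add: distrib_left)
          finally show ?thesis .
        qed
        then show ?case using \<rho>(2) by fastforce
    qed
  qed
  ultimately have "tightly M (\<lambda>C n \<omega>. good C n \<omega> \<and>
      ((\<forall>i. regular_at l E (par_box \<theta>0 H \<eta>0 r) (X i \<omega>)) \<and> et n \<omega> \<in> H \<and>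
      \<bar>th n \<omega> - \<theta>0\<bar> < r \<and> C * ?\<delta> n \<omega> < r))"
    by (rule tightly_conj_whp)
  then show ?thesis
  proof (rule tightly_mono)
    fix C :: real
    show "\<exists>D. \<forall>\<^sub>F n in sequentially. \<forall>\<omega>\<in>space M.
      good C n \<omega> \<and>
      ((\<forall>i. regular_at l E (par_box \<theta>0 H \<eta>0 r) (X i \<omega>)) \<and> et n \<omega> \<in> H \<and>
      \<bar>th n \<omega> - \<theta>0\<bar> < r \<and> C * ?\<delta> n \<omega> < r) \<longrightarrow>
      0 \<le> D \<and> \<bar>th n \<omega> - \<theta>0\<bar> < r \<and> et n \<omega> \<in> H \<and> norm (et n \<omega> - \<eta>0) < r \<and>
      expands l \<theta>0 I0 (emp_mean (\<lambda>i. X i \<omega>) n (pd l 1 0 \<theta>0 \<theta>0 \<eta>0)) (\<lambda>i. X i \<omega>) n r D (th n \<omega>) (et n \<omega>)"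
    proof (intro exI[of _ "5 * C ^ 3"] eventually_sequentiallyI[of 1] ballI impI, goal_cases)
      case (1 n \<omega>)
      let ?\<eta> = "et n \<omega>"
      from 1(3) have good: "good C n \<omega>" and reg: "\<And>i. regular_at l E (par_box \<theta>0 H \<eta>0 r) (X i \<omega>)"
        and H: "?\<eta> \<in> H" and th: "\<bar>th n \<omega> - \<theta>0\<bar> < r" and small: "C * ?\<delta> n \<omega> < r" by auto
      from good have EK: "EK C n \<omega>" and g10: "g10 C n \<omega>" and g11: "g11 C n \<omega>" and g20: "g20 C n \<omega>"
        and rt: "rt C n \<omega>" unfolding good_def by auto
      have C: "1 \<le> C" "K \<le> C" using EK by (auto simp: EK_def)
      have rt': "norm (?\<eta> - \<eta>0) \<le> C * ?\<delta> n \<omega>" using rt by (simp add: rt_def)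
      then have ball: "norm (?\<eta> - \<eta>0) < r" using small by linarith
      have "expands l \<theta>0 I0 (emp_mean (\<lambda>i. X i \<omega>) n (pd l 1 0 \<theta>0 \<theta>0 \<eta>0)) (\<lambda>i. X i \<omega>) n r (5 * C ^ 3) (th n \<omega>) ?\<eta>"
      proof (rule submodel_expansion[where P=P and E=E and H=H, OF 1(1) C(1) reg th H ball rt' int[OF H ball] int[OF \<eta>0] P0])
        show "norm (\<eta>0 - \<eta>0) < r" using r by simp
        show "\<bar>\<integral>y. pd l 1 0 \<theta>0 \<theta>0 ?\<eta> y \<partial>P\<bar> \<le> C * (norm (?\<eta> - \<eta>0))\<^sup>2"
          by (rule mono[OF C(2) P10[OF H ball]]) simp
        show "\<bar>\<integral>y. pd l 1 1 \<theta>0 \<theta>0 ?\<eta> y \<partial>P\<bar> \<le> C * norm (?\<eta> - \<eta>0)"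
          by (rule mono[OF C(2) P11[OF H ball]]) simp
        show "\<bar>(\<integral>y. pd l 2 0 \<theta>0 \<theta>0 ?\<eta> y \<partial>P) + I0\<bar> \<le> C * norm (?\<eta> - \<eta>0)"
          by (rule mono[OF C(2) P20[OF H ball]]) simp
        show "\<bar>emp_proc P (\<lambda>i. X i \<omega>) n (\<lambda>y. pd l 1 0 \<theta>0 \<theta>0 ?\<eta> y - pd l 1 0 \<theta>0 \<theta>0 \<eta>0 y)\<bar>
            \<le> C * norm (?\<eta> - \<eta>0)"
          using g10 H ball unfolding g10_def by blast
        show "\<bar>emp_proc P (\<lambda>i. X i \<omega>) n (pd l 1 1 \<theta>0 \<theta>0 ?\<eta>)\<bar> \<le> C"
          using g11 H ball unfolding g11_def by blast
        show "\<bar>emp_proc P (\<lambda>i. X i \<omega>) n (pd l 2 0 \<theta>0 \<theta>0 ?\<eta>)\<bar> \<le> C"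
          using g20 H ball unfolding g20_def by blast
        show "emp_mean (\<lambda>i. X i \<omega>) n E \<le> C" using EK by (simp add: EK_def)
      qed
      then show ?case using C th H ball by auto
    qed
  qed
qed

section \<open>The profile likelihood between two submodels\<close>

text \<open>
  One realisation of a sample of size \<open>n\<close>, for which the likelihood is positive along the submodel
  and \<open>\<eta>h \<theta>\<close> maximises the likelihood over the nuisance parameter.
\<close>

locale submodel_data =
  fixes \<Theta> :: "real set" and H :: "'h::real_normed_vector set" and lik :: "real \<Rightarrow> 'h \<Rightarrow> 'x \<Rightarrow> real"
    and etat :: "real \<Rightarrow> real \<Rightarrow> 'h \<Rightarrow> 'h" and \<theta>0 :: real and \<eta>0 :: 'h and r :: real
    and x :: "nat \<Rightarrow> 'x" and n :: nat and \<eta>h :: "real \<Rightarrow> 'h"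
  assumes n: "n \<ge> 1" and r: "r > 0"
    and in_\<Theta>: "\<And>\<theta>. \<bar>\<theta> - \<theta>0\<bar> < r \<Longrightarrow> \<theta> \<in> \<Theta>"
    and A2: "\<And>\<theta> \<eta>. \<theta> \<in> \<Theta> \<Longrightarrow> \<eta> \<in> H \<Longrightarrow> etat \<theta> \<theta> \<eta> = \<eta>"
    and etat_H: "\<And>t \<theta> \<eta>. (t,\<theta>,\<eta>) \<in> par_box \<theta>0 H \<eta>0 r \<Longrightarrow> etat t \<theta> \<eta> \<in> H"
    and pos: "\<And>i t \<theta> \<eta>. i < n \<Longrightarrow> (t,\<theta>,\<eta>) \<in> par_box \<theta>0 H \<eta>0 r \<Longrightarrow> 0 < lik t (etat t \<theta> \<eta>) (x i)"
    and max_H: "\<And>\<theta>. \<theta> \<in> \<Theta> \<Longrightarrow> \<eta>h \<theta> \<in> H"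
    and max: "\<And>\<theta> \<eta>. \<theta> \<in> \<Theta> \<Longrightarrow> \<eta> \<in> H \<Longrightarrow> lik_n lik x n \<theta> \<eta> \<le> lik_n lik x n \<theta> (\<eta>h \<theta>)"
begin

abbreviation "l \<equiv> submodel_loglik lik etat"

lemma lik_n_submodel:
  assumes "(t,\<theta>,\<eta>) \<in> par_box \<theta>0 H \<eta>0 r"
  shows "0 < lik_n lik x n t (etat t \<theta> \<eta>)"
    and "ln (lik_n lik x n t (etat t \<theta> \<eta>)) = real n * emp_mean x n (l t \<theta> \<eta>)"
proof -
  show "0 < lik_n lik x n t (etat t \<theta> \<eta>)"
    unfolding lik_n_def using pos[OF _ assms] by (intro prod_pos) auto
  have "ln (\<Prod>i<n. lik t (etat t \<theta> \<eta>) (x i)) = (\<Sum>i<n. ln (lik t (etat t \<theta> \<eta>) (x i)))"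
    by (intro ln_prod) (use pos[OF _ assms] in \<open>auto simp: less_imp_neq[symmetric]\<close>)
  then show "ln (lik_n lik x n t (etat t \<theta> \<eta>)) = real n * emp_mean x n (l t \<theta> \<eta>)"
    using n by (simp add: lik_n_def emp_mean_def submodel_loglik_def)
qed

lemma profile_lik_eq:
  assumes "\<theta> \<in> \<Theta>"
  shows "profile_lik H lik x n \<theta> = lik_n lik x n \<theta> (\<eta>h \<theta>)"
  unfolding profile_lik_def
  by (rule cSup_eq_maximum) (use max max_H assms in auto)

lemma ln_profile_lik_eq:
  assumes "\<bar>\<theta> - \<theta>0\<bar> < r" "norm (\<eta>h \<theta> - \<eta>0) < r"
  shows "ln (profile_lik H lik x n \<theta>) = real n * emp_mean x n (l \<theta> \<theta> (\<eta>h \<theta>))"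
proof -
  have \<theta>: "\<theta> \<in> \<Theta>" using in_\<Theta> assms by auto
  have "(\<theta>, \<theta>, \<eta>h \<theta>) \<in> par_box \<theta>0 H \<eta>0 r"
    using assms max_H[OF \<theta>] by (auto simp: par_box_def)
  from lik_n_submodel(2)[OF this] show ?thesis
    by (simp add: profile_lik_eq[OF \<theta>] A2[OF \<theta> max_H[OF \<theta>]])
qed

lemma ln_profile_lik_ge:
  assumes "(t,\<theta>,\<eta>) \<in> par_box \<theta>0 H \<eta>0 r"
  shows "real n * emp_mean x n (l t \<theta> \<eta>) \<le> ln (profile_lik H lik x n t)"
proof -
  have t: "t \<in> \<Theta>" using in_\<Theta> assms by (auto simp: par_box_def)
  have "lik_n lik x n t (etat t \<theta> \<eta>) \<le> profile_lik H lik x n t"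
    unfolding profile_lik_eq[OF t] by (rule max[OF t etat_H[OF assms]])
  then have "ln (lik_n lik x n t (etat t \<theta> \<eta>)) \<le> ln (profile_lik H lik x n t)"
    using lik_n_submodel(1)[OF assms] by (subst ln_le_cancel_iff) auto
  then show ?thesis by (simp add: lik_n_submodel(2)[OF assms])
qed

text \<open>
  The sandwich. The submodel through \<open>(\<theta>, \<eta>h \<theta>)\<close> attains the profile likelihood at \<open>\<theta>\<close> and is below
  it at \<open>\<theta>0\<close>, which bounds the increment of the log profile likelihood from above; the submodel through
  \<open>(\<theta>0, \<eta>h \<theta>0)\<close> has the two roles exchanged and bounds it from below. Both bounds have the same
  quadratic expansion.
\<close>

lemma profile_expansion:
  assumes \<theta>: "\<bar>\<theta> - \<theta>0\<bar> < r" "norm (\<eta>h \<theta> - \<eta>0) < r" and \<eta>0h: "norm (\<eta>h \<theta>0 - \<eta>0) < r"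
    and D: "0 \<le> D"
    and e: "expands l \<theta>0 I0 S x n r D \<theta> (\<eta>h \<theta>)" and e0: "expands l \<theta>0 I0 S x n r D \<theta>0 (\<eta>h \<theta>0)"
  shows "\<bar>ln (profile_lik H lik x n \<theta>) - ln (profile_lik H lik x n \<theta>0)
      - real n * ((\<theta> - \<theta>0) * S - I0 / 2 * (\<theta> - \<theta>0)\<^sup>2)\<bar>
    \<le> 4 * D * real n * (\<bar>\<theta> - \<theta>0\<bar> * (1 / sqrt (real n) + \<bar>\<theta> - \<theta>0\<bar>)\<^sup>2)"
proof -
  define q where "q = 1 / sqrt (real n)"
  define d where "d = \<bar>\<theta> - \<theta>0\<bar>"
  define R where "R = 4 * D * (d * (q + d)\<^sup>2)"
  define Q where "Q = (\<theta> - \<theta>0) * S - I0 / 2 * (\<theta> - \<theta>0)\<^sup>2"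
  let ?e = "\<lambda>t \<theta>. emp_mean x n (l t \<theta> (\<eta>h \<theta>))"
  have q: "0 \<le> q" "0 \<le> d" by (auto simp: q_def d_def)
  have mem: "\<eta>h \<theta> \<in> H" "\<eta>h \<theta>0 \<in> H" using max_H in_\<Theta> \<theta> r by auto
  \<comment> \<open>Both halves use the expansion at \<open>t = \<theta>\<close>, where its error scale is at most \<open>2 (q + d)\<close>.\<close>
  have le: "D * d * w\<^sup>2 \<le> R" if "0 \<le> w" "w \<le> 2 * (q + d)" for w
  proof -
    have "w\<^sup>2 \<le> (2 * (q + d))\<^sup>2" using that by (intro power_mono)
    then have "D * d * w\<^sup>2 \<le> D * d * (2 * (q + d))\<^sup>2" using D q by (intro mult_left_mono) auto
    also have "\<dots> = R" unfolding R_def power_mult_distrib by simp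
    finally show ?thesis .
  qed
  have "\<bar>?e \<theta> \<theta> - ?e \<theta>0 \<theta> - Q\<bar> \<le> D * d * (q + d + d)\<^sup>2"
    using e \<theta>(1) unfolding expands_def Q_def q_def d_def by (auto simp: algebra_simps)
  also have "\<dots> \<le> R" using q by (intro le) auto
  finally have up: "\<bar>?e \<theta> \<theta> - ?e \<theta>0 \<theta> - Q\<bar> \<le> R" .
  have "\<bar>?e \<theta> \<theta>0 - ?e \<theta>0 \<theta>0 - Q\<bar> \<le> D * d * (q + d)\<^sup>2"
    using e0 \<theta>(1) unfolding expands_def Q_def q_def d_def by (auto simp: algebra_simps)
  also have "\<dots> \<le> R" using q by (intro le) auto
  finally have low: "\<bar>?e \<theta> \<theta>0 - ?e \<theta>0 \<theta>0 - Q\<bar> \<le> R" .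
  have pl: "ln (profile_lik H lik x n \<theta>) = real n * ?e \<theta> \<theta>"
    "ln (profile_lik H lik x n \<theta>0) = real n * ?e \<theta>0 \<theta>0"
    using \<theta> \<eta>0h r by (auto intro!: ln_profile_lik_eq)
  have "real n * ?e \<theta>0 \<theta> \<le> real n * ?e \<theta>0 \<theta>0" "real n * ?e \<theta> \<theta>0 \<le> real n * ?e \<theta> \<theta>"
    unfolding pl[symmetric] using \<theta> \<eta>0h r mem by (auto intro!: ln_profile_lik_ge simp: par_box_def)
  then have "?e \<theta>0 \<theta> \<le> ?e \<theta>0 \<theta>0" "?e \<theta> \<theta>0 \<le> ?e \<theta> \<theta>" using n by auto
  with up low have "\<bar>?e \<theta> \<theta> - ?e \<theta>0 \<theta>0 - Q\<bar> \<le> R" by linarith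
  then have "real n * \<bar>?e \<theta> \<theta> - ?e \<theta>0 \<theta>0 - Q\<bar> \<le> real n * R" by (intro mult_left_mono) auto
  then have "\<bar>real n * (?e \<theta> \<theta> - ?e \<theta>0 \<theta>0 - Q)\<bar> \<le> real n * R" by (simp add: abs_mult)
  then show ?thesis
    unfolding pl Q_def[symmetric] q_def[symmetric] d_def[symmetric] by (simp add: R_def algebra_simps)
qed

text \<open>
  The submodel through the maximum likelihood estimator stays inside the model, so the full
  likelihood restricted to it has an interior maximum at the estimator.
\<close>

lemma score_equation:
  assumes reg: "\<And>i. i < n \<Longrightarrow> regular_at l E (par_box \<theta>0 H \<eta>0 r) (x i)"
    and \<theta>: "\<bar>\<theta> - \<theta>0\<bar> < r" "norm (\<eta>h \<theta> - \<eta>0) < r"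
    and mle: "\<And>t \<eta>. t \<in> \<Theta> \<Longrightarrow> \<eta> \<in> H \<Longrightarrow> lik_n lik x n t \<eta> \<le> lik_n lik x n \<theta> (\<eta>h \<theta>)"
  shows "emp_mean x n (pd l 1 0 \<theta> \<theta> (\<eta>h \<theta>)) = 0"
proof -
  have H: "\<theta> \<in> \<Theta>" "\<eta>h \<theta> \<in> H" using in_\<Theta> max_H \<theta> by auto
  have mem: "(t, \<theta>, \<eta>h \<theta>) \<in> par_box \<theta>0 H \<eta>0 r" if "\<bar>t - \<theta>0\<bar> < r" for t
    using that \<theta> H by (auto simp: par_box_def)
  let ?f = "\<lambda>t. real n * emp_mean x n (l t \<theta> (\<eta>h \<theta>))"
  have deriv: "(?f has_real_derivative real n * emp_mean x n (pd l 1 0 \<theta> \<theta> (\<eta>h \<theta>))) (at \<theta>)"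
    unfolding emp_mean_def using regular_atD(1)[OF reg mem[OF \<theta>(1)], of _ 0] n
    by (auto intro!: derivative_intros simp: pd_0_0)
  have "real n * emp_mean x n (pd l 1 0 \<theta> \<theta> (\<eta>h \<theta>)) = 0"
  proof (rule DERIV_local_max[OF deriv])
    show "0 < r - \<bar>\<theta> - \<theta>0\<bar>" using \<theta> by simp
    show "\<forall>t. \<bar>\<theta> - t\<bar> < r - \<bar>\<theta> - \<theta>0\<bar> \<longrightarrow> ?f t \<le> ?f \<theta>"
    proof (intro allI impI)
      fix t assume "\<bar>\<theta> - t\<bar> < r - \<bar>\<theta> - \<theta>0\<bar>"
      then have t: "\<bar>t - \<theta>0\<bar> < r" by auto
      have "lik_n lik x n t (etat t \<theta> (\<eta>h \<theta>)) \<le> lik_n lik x n \<theta> (etat \<theta> \<theta> (\<eta>h \<theta>))"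
        unfolding A2[OF H] by (rule mle[OF in_\<Theta>[OF t] etat_H[OF mem[OF t]]])
      then have "ln (lik_n lik x n t (etat t \<theta> (\<eta>h \<theta>))) \<le> ln (lik_n lik x n \<theta> (etat \<theta> \<theta> (\<eta>h \<theta>)))"
        using lik_n_submodel(1)[OF mem[OF t]] lik_n_submodel(1)[OF mem[OF \<theta>(1)]]
        by (subst ln_le_cancel_iff) auto
      then show "?f t \<le> ?f \<theta>"
        by (simp add: lik_n_submodel(2)[OF mem[OF t]] lik_n_submodel(2)[OF mem[OF \<theta>(1)]])
    qed
  qed
  then show ?thesis using n by simp
qed

end

section \<open>Efficient information, absorption and recentering\<close>

text \<open>
  A function equal almost everywhere to a measurable one may itself fail to be measurable, in which
  case its Bochner integral is zero by convention. In either case \<open>f\<close> has mean zero, and since a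
  non-integrable square would give the variance zero, positivity of the variance forces square integrability.
\<close>

lemma (in prob_space) positive_variance_of_AE_version:
  fixes f g :: "'a \<Rightarrow> real"
  assumes g: "g \<in> borel_measurable M" and eq: "AE x in M. g x = f x"
    and g0: "(\<integral>x. g x \<partial>M) = 0" and pos: "variance f > 0"
  shows "integrable M (\<lambda>x. (g x)\<^sup>2)" "variance f = (\<integral>x. (g x)\<^sup>2 \<partial>M)"
proof -
  have "(\<integral>x. f x \<partial>M) = 0"
  proof (cases "integrable M f")
    case True
    then have "(\<integral>x. f x \<partial>M) = (\<integral>x. g x \<partial>M)"
      using g eq by (intro integral_cong_AE) auto
    then show ?thesis using g0 by simp
  qed (rule not_integrable_integral_eq)
  then have v: "variance f = (\<integral>x. (f x)\<^sup>2 \<partial>M)" by simp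
  then have int: "integrable M (\<lambda>x. (f x)\<^sup>2)"
    using pos not_integrable_integral_eq by fastforce
  have AE: "AE x in M. (f x)\<^sup>2 = (g x)\<^sup>2" using eq by eventually_elim simp
  have g2: "(\<lambda>x. (g x)\<^sup>2) \<in> borel_measurable M" using g by measurable
  show "integrable M (\<lambda>x. (g x)\<^sup>2)"
    using integrable_cong_AE_imp[OF int g2] AE by auto
  show "variance f = (\<integral>x. (g x)\<^sup>2 \<partial>M)"
    unfolding v by (rule integral_cong_AE) (use int g2 AE in auto)
qed

text \<open>
  A quadratic error term is absorbed: since \<open>d\<close> is small, \<open>D d\<^sup>2\<close> is at most a fraction of
  \<open>\<bar>d\<bar> I0\<close>, so the score equation first bounds \<open>d\<close> by a multiple of \<open>q\<close>, and this bound turns the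
  error of the score equation into a multiple of \<open>q\<^sup>2\<close>. In the application \<open>q = n\<^sup>-\<^sup>1\<^sup>/\<^sup>2\<close> and \<open>d\<close> is the
  error of the estimator.
\<close>

lemma root_n_rate:
  fixes d S I0 D q :: real
  assumes I0: "I0 > 0" and D: "0 \<le> D" and q: "0 \<le> q" "q \<le> 1"
    and score: "\<bar>S - d * I0\<bar> \<le> D * (q + \<bar>d\<bar> + \<bar>d\<bar>)\<^sup>2"
    and S: "\<bar>S\<bar> \<le> D * q" and small: "8 * D * \<bar>d\<bar> \<le> I0 / 2"
  defines "K \<equiv> 18 * D / I0"
  shows "\<bar>d\<bar> \<le> K * q" "\<bar>S - d * I0\<bar> \<le> 4 * D * (1 + K)\<^sup>2 * q\<^sup>2"
proof -
  have "(q + \<bar>d\<bar> + \<bar>d\<bar>)\<^sup>2 \<le> (2 * (q + \<bar>d\<bar>))\<^sup>2" using q by (intro power_mono) auto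
  then have "D * (q + \<bar>d\<bar> + \<bar>d\<bar>)\<^sup>2 \<le> D * (2 * (q + \<bar>d\<bar>))\<^sup>2" using D by (rule mult_left_mono)
  also have "\<dots> = 4 * D * (q + \<bar>d\<bar>)\<^sup>2" unfolding power_mult_distrib by simp
  finally have s: "\<bar>S - d * I0\<bar> \<le> 4 * D * (q + \<bar>d\<bar>)\<^sup>2" using score by linarith
  have "(q + \<bar>d\<bar>)\<^sup>2 \<le> 2 * q\<^sup>2 + 2 * \<bar>d\<bar>\<^sup>2"
    using sum_squares_bound[of q "\<bar>d\<bar>"] unfolding power2_sum by linarith
  then have "4 * D * (q + \<bar>d\<bar>)\<^sup>2 \<le> 4 * D * (2 * q\<^sup>2 + 2 * \<bar>d\<bar>\<^sup>2)" using D by (intro mult_left_mono) auto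
  also have "\<dots> = 8 * D * q\<^sup>2 + 8 * D * \<bar>d\<bar> * \<bar>d\<bar>" by (simp add: algebra_simps power2_eq_square)
  also have "\<dots> \<le> 8 * D * q + I0 / 2 * \<bar>d\<bar>"
    using D q small by (intro add_mono mult_left_mono mult_right_mono)
      (auto simp: power2_eq_square intro: mult_left_le)
  finally have "\<bar>S - d * I0\<bar> \<le> 8 * D * q + I0 / 2 * \<bar>d\<bar>" using s by linarith
  moreover have "\<bar>d\<bar> * I0 = \<bar>d * I0\<bar>" using I0 by (simp add: abs_mult)
  moreover have "\<bar>d * I0\<bar> \<le> \<bar>S\<bar> + \<bar>S - d * I0\<bar>" by linarith
  ultimately have "\<bar>d\<bar> * I0 \<le> D * q + (8 * D * q + I0 / 2 * \<bar>d\<bar>)" using S by linarith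
  then have "\<bar>d\<bar> * I0 \<le> 18 * D * q" by (simp add: algebra_simps)
  then show K: "\<bar>d\<bar> \<le> K * q" using I0 by (simp add: K_def field_simps)
  have "(q + \<bar>d\<bar>)\<^sup>2 \<le> ((1 + K) * q)\<^sup>2" using K q by (intro power_mono) (auto simp: algebra_simps)
  then have "4 * D * (q + \<bar>d\<bar>)\<^sup>2 \<le> 4 * D * ((1 + K) * q)\<^sup>2" using D by (intro mult_left_mono) auto
  then show "\<bar>S - d * I0\<bar> \<le> 4 * D * (1 + K)\<^sup>2 * q\<^sup>2" using s by (simp add: power_mult_distrib)
qed

text \<open>
  Here \<open>a\<close> and \<open>b\<close> stand for the deviations from \<open>\<theta>0\<close> of the given sequence and of the estimator, and
  \<open>A\<close> and \<open>B\<close> for the corresponding increments of the log profile likelihood. If \<open>S = b I0\<close> held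
  exactly, the difference of the quadratics would be \<open>- (a - b)\<^sup>2 I0 / 2\<close>; the actual deviation
  contributes \<open>n \<bar>a - b\<bar> O(1/n)\<close>. With \<open>q = n\<^sup>-\<^sup>1\<^sup>/\<^sup>2\<close>, every error is at most a multiple of
  \<open>n (\<bar>a - b\<bar> + q)\<^sup>3\<close>, and \<open>n q\<^sup>3 = q\<close>.
\<close>

lemma recenter_expansion:
  fixes a b S I0 D :: real and n :: nat
  assumes n: "n \<ge> 1" and D: "0 \<le> D"
    and b: "\<bar>b\<bar> \<le> D * (1 / sqrt (real n))" and S: "\<bar>S - b * I0\<bar> \<le> D * (1 / sqrt (real n))\<^sup>2"
    and A: "\<bar>A - real n * (a * S - I0 / 2 * a\<^sup>2)\<bar>
      \<le> 4 * D * real n * (\<bar>a\<bar> * (1 / sqrt (real n) + \<bar>a\<bar>)\<^sup>2)"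
    and B: "\<bar>B - real n * (b * S - I0 / 2 * b\<^sup>2)\<bar>
      \<le> 4 * D * real n * (\<bar>b\<bar> * (1 / sqrt (real n) + \<bar>b\<bar>)\<^sup>2)"
  shows "\<bar>A - B + real n / 2 * (a - b)\<^sup>2 * I0\<bar>
    \<le> (D + 32 * D * (1 + D) ^ 3) * (real n * \<bar>a - b\<bar> ^ 3 + 1 / sqrt (real n))"
proof -
  define q where "q = 1 / sqrt (real n)"
  define e where "e = \<bar>a - b\<bar>"
  have e: "0 \<le> e" by (simp add: e_def)
  have q: "0 < q" "real n * q\<^sup>2 = 1" using n by (auto simp: q_def power_divide)
  have q3: "real n * q ^ 3 = q" using q(2) by (simp add: power3_eq_cube power2_eq_square mult.assoc)
  define W where "W = (1 + D) * (e + q)"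
  have W: "0 \<le> W" using D e q by (simp add: W_def)
  have De: "0 \<le> D * e" "0 \<le> D * q" using D e q by auto
  have bW: "\<bar>b\<bar> \<le> W" "q + \<bar>b\<bar> \<le> W"
    using b De e q unfolding W_def q_def[symmetric] by (auto simp: algebra_simps)
  have aW: "\<bar>a\<bar> \<le> W" "q + \<bar>a\<bar> \<le> W"
    using b De e q unfolding W_def q_def[symmetric] by (auto simp: algebra_simps e_def abs_if split: if_splits)
  have cube: "\<bar>c\<bar> * (q + \<bar>c\<bar>)\<^sup>2 \<le> W ^ 3" if "\<bar>c\<bar> \<le> W" "q + \<bar>c\<bar> \<le> W" for c
  proof -
    have "\<bar>c\<bar> * (q + \<bar>c\<bar>)\<^sup>2 \<le> W * W\<^sup>2" using that q W by (intro mult_mono power_mono) auto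
    then show ?thesis by (simp add: power3_eq_cube power2_eq_square)
  qed
  have W3: "real n * W ^ 3 \<le> 4 * (1 + D) ^ 3 * (real n * e ^ 3 + q)"
  proof -
    \<comment> \<open>Convexity of the cube, in the form of an identity.\<close>
    have "4 * (e ^ 3 + q ^ 3) - (e + q) ^ 3 = 3 * ((e + q) * (e - q)\<^sup>2)"
      by (simp add: power3_eq_cube power2_eq_square algebra_simps)
    moreover have "0 \<le> (e + q) * (e - q)\<^sup>2" using e q by auto
    ultimately have "(e + q) ^ 3 \<le> 4 * (e ^ 3 + q ^ 3)" by linarith
    then have "real n * (1 + D) ^ 3 * (e + q) ^ 3 \<le> real n * (1 + D) ^ 3 * (4 * (e ^ 3 + q ^ 3))"
      using D by (intro mult_left_mono) auto
    also have "\<dots> = 4 * (1 + D) ^ 3 * (real n * e ^ 3 + real n * q ^ 3)" by (simp add: algebra_simps)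
    finally show ?thesis by (simp add: W_def power_mult_distrib q3 mult.assoc)
  qed
  have err: "4 * D * real n * (\<bar>c\<bar> * (q + \<bar>c\<bar>)\<^sup>2) \<le> 16 * D * (1 + D) ^ 3 * (real n * e ^ 3 + q)"
    if "\<bar>c\<bar> \<le> W" "q + \<bar>c\<bar> \<le> W" for c
  proof -
    have "4 * D * real n * (\<bar>c\<bar> * (q + \<bar>c\<bar>)\<^sup>2) \<le> 4 * D * real n * W ^ 3"
      using cube[OF that] D by (intro mult_left_mono) auto
    also have "\<dots> = 4 * D * (real n * W ^ 3)" by simp
    also have "\<dots> \<le> 4 * D * (4 * (1 + D) ^ 3 * (real n * e ^ 3 + q))"
      using W3 D by (intro mult_left_mono) auto
    finally show ?thesis by simp
  qed
  \<comment> \<open>If \<open>e > q\<close>, then \<open>n e\<^sup>2 \<ge> n q\<^sup>2 = 1\<close>.\<close>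
  have eb: "e \<le> real n * e ^ 3 + q"
  proof (cases "e \<le> q")
    case True
    then show ?thesis using e by (simp add: add_increasing)
  next
    case False
    then have "q\<^sup>2 \<le> e\<^sup>2" using q by (intro power_mono) auto
    then have "real n * q\<^sup>2 * e \<le> real n * e\<^sup>2 * e" using e by (intro mult_right_mono mult_left_mono) auto
    then have "e \<le> real n * e ^ 3" unfolding q(2) by (simp add: power3_eq_cube power2_eq_square mult.assoc)
    then show ?thesis using q by simp
  qed
  have "\<bar>real n * ((a - b) * (S - b * I0))\<bar> = real n * (e * \<bar>S - b * I0\<bar>)"
    by (simp add: abs_mult e_def)
  also have "\<dots> \<le> real n * (e * (D * q\<^sup>2))"
    using S e by (intro mult_left_mono) (auto simp: q_def)
  also have "\<dots> = D * e" using q(2) by (simp add: algebra_simps)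
  also have "\<dots> \<le> D * (real n * e ^ 3 + q)" using eb D by (rule mult_left_mono)
  finally have main: "\<bar>real n * ((a - b) * (S - b * I0))\<bar> \<le> D * (real n * e ^ 3 + q)" .
  have "A - B + real n / 2 * (a - b)\<^sup>2 * I0 =
    real n * ((a - b) * (S - b * I0)) + (A - real n * (a * S - I0 / 2 * a\<^sup>2))
      - (B - real n * (b * S - I0 / 2 * b\<^sup>2))"
    by (simp add: power2_eq_square field_simps)
  then have "\<bar>A - B + real n / 2 * (a - b)\<^sup>2 * I0\<bar> \<le>
      D * (real n * e ^ 3 + q) + 16 * D * (1 + D) ^ 3 * (real n * e ^ 3 + q) + 16 * D * (1 + D) ^ 3 * (real n * e ^ 3 + q)"
    using main err[OF aW] err[OF bW] A B unfolding q_def[symmetric] by linarith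
  then show ?thesis unfolding q_def[symmetric] e_def[symmetric] by (simp add: algebra_simps)
qed

section \<open>The expansion of the log profile likelihood\<close>

theorem theorem1:
  fixes M :: "'w measure" and \<mu> P :: "'x measure" and X :: "nat \<Rightarrow> 'w \<Rightarrow> 'x"
    and \<Theta> :: "real set" and H :: "'h::real_normed_vector set"
    and lik :: "real \<Rightarrow> 'h \<Rightarrow> 'x \<Rightarrow> real"
    and \<theta>0 :: real and \<eta>0 :: 'h
    and etat :: "real \<Rightarrow> real \<Rightarrow> 'h \<Rightarrow> 'h" and l :: "real \<Rightarrow> real \<Rightarrow> 'h \<Rightarrow> 'x \<Rightarrow> real"
    and eta_hat :: "nat \<Rightarrow> 'w \<Rightarrow> real \<Rightarrow> 'h"
    and theta_hat theta_til :: "nat \<Rightarrow> 'w \<Rightarrow> real"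
    and eff :: "'x \<Rightarrow> real" and I0 :: real
  assumes model: "semiparametric_model \<mu> \<Theta> H lik"
    and true_par: "\<theta>0 \<in> \<Theta>" "\<eta>0 \<in> H"
    and P_def: "P = law \<mu> lik \<theta>0 \<eta>0"
    \<comment> \<open>i.i.d. data\<close>
    and M: "prob_space M"
    and indep: "prob_space.indep_vars M (\<lambda>_. P) X UNIV"
    and distr: "\<And>i. distr M P (X i) = P"
    \<comment> \<open>maximisers of the likelihood\<close>
    and eta_hat: "AE \<omega> in M. \<forall>n\<ge>1. \<forall>\<theta>\<in>\<Theta>.
      is_arg_max (lik_n lik (\<lambda>i. X i \<omega>) n \<theta>) (\<lambda>\<eta>. \<eta> \<in> H) (eta_hat n \<omega> \<theta>)"
    and mle_rv: "random_seq_in M \<Theta> theta_hat"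
    and mle: "AE \<omega> in M. \<forall>n\<ge>1.
      is_arg_max (\<lambda>(\<theta>,\<eta>). lik_n lik (\<lambda>i. X i \<omega>) n \<theta> \<eta>) (\<lambda>(\<theta>,\<eta>). \<theta> \<in> \<Theta> \<and> \<eta> \<in> H)
        (theta_hat n \<omega>, eta_hat n \<omega> (theta_hat n \<omega>))"
    and mle_consistent: "o_P_1 M (\<lambda>n \<omega>. theta_hat n \<omega> - \<theta>0)"
    \<comment> \<open>efficient score and information\<close>
    and score_exists: "AE x in P. (\<forall>\<^sub>F \<theta> in nhds \<theta>0. 0 < lik \<theta> \<eta>0 x) \<and>
      (\<lambda>\<theta>. ln (lik \<theta> \<eta>0 x)) differentiable (at \<theta>0)"
    and score_L2: "theta_score lik \<theta>0 \<eta>0 \<in> L2 P"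
    and eff_def: "eff = efficient_score \<mu> H lik \<theta>0 \<eta>0"
    and I0_def: "I0 = efficient_info \<mu> H lik \<theta>0 \<eta>0"
    \<comment> \<open>least favorable submodel\<close>
    and submodel: "\<forall>\<theta>\<in>\<Theta>. \<forall>\<eta>\<in>H. \<forall>\<^sub>F t in at \<theta> within \<Theta>. etat t \<theta> \<eta> \<in> H"
    and l_def: "l = submodel_loglik lik etat"
    and least_favorable: "AE x in P. pd l 1 0 \<theta>0 \<theta>0 \<eta>0 x = eff x"
    \<comment> \<open>standing assumptions\<close>
    and A1: "compact \<Theta>" "\<theta>0 \<in> interior \<Theta>"
    and A2: "\<forall>\<theta>\<in>\<Theta>. \<forall>\<eta>\<in>H. etat \<theta> \<theta> \<eta> = \<eta>"
    and A3: "\<And>th. random_seq_in M \<Theta> th \<Longrightarrow> o_P_1 M (\<lambda>n \<omega>. th n \<omega> - \<theta>0) \<Longrightarrow>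
      O_P M (\<lambda>n \<omega>. norm (eta_hat n \<omega> (th n \<omega>) - \<eta>0))
            (\<lambda>n \<omega>. 1 / sqrt (real n) + \<bar>th n \<omega> - \<theta>0\<bar>)"
    and A4_envelopes: "\<exists>V. nbhd_in (\<Theta> \<times> \<Theta> \<times> H) (\<theta>0, \<theta>0, \<eta>0) V \<and>
      smooth_with_envelopes P H lik etat
        {(0,0), (1,0), (2,0), (3,0), (1,1), (1,2), (2,1)} V"
    and A4_information: "- (\<integral>x. (pd l 1 0 \<theta>0 \<theta>0 \<eta>0 x)\<^sup>2 \<partial>P) = (\<integral>x. pd l 2 0 \<theta>0 \<theta>0 \<eta>0 x \<partial>P)"
    and A4_derivative: "((\<lambda>\<theta>. \<integral>x. pd l 1 0 \<theta>0 \<theta> \<eta>0 x \<partial>P) has_real_derivative 0) (at \<theta>0)"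
    and A5: "\<exists>V. nbhd_in (\<Theta> \<times> \<Theta> \<times> H) (\<theta>0, \<theta>0, \<eta>0) V \<and>
      Donsker P ((\<lambda>(t,\<theta>,\<eta>). pd l 2 0 t \<theta> \<eta>) ` V) \<and>
      Donsker P ((\<lambda>(t,\<theta>,\<eta>). pd l 1 1 t \<theta> \<eta>) ` V) \<and>
      Glivenko_Cantelli P ((\<lambda>(t,\<theta>,\<eta>). pd l 3 0 t \<theta> \<eta>) ` V)"
    and A6: "\<exists>U. nbhd_in H \<eta>0 U \<and>
      O_P_on M U
        (\<lambda>n \<eta> \<omega>. emp_proc P (\<lambda>i. X i \<omega>) n (\<lambda>x. pd l 1 0 \<theta>0 \<theta>0 \<eta> x - pd l 1 0 \<theta>0 \<theta>0 \<eta>0 x))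
        (\<lambda>\<eta>. norm (\<eta> - \<eta>0)) \<and>
      (\<exists>C. \<forall>\<eta>\<in>U. \<bar>(\<integral>x. pd l 2 0 \<theta>0 \<theta>0 \<eta> x \<partial>P) - (\<integral>x. pd l 2 0 \<theta>0 \<theta>0 \<eta>0 x \<partial>P)\<bar>
                   \<le> C * norm (\<eta> - \<eta>0)) \<and>
      (\<exists>C. \<forall>\<eta>\<in>U. \<bar>(\<integral>x. pd l 1 1 \<theta>0 \<theta>0 \<eta> x \<partial>P) - (\<integral>x. pd l 1 1 \<theta>0 \<theta>0 \<eta>0 x \<partial>P)\<bar>
                   \<le> C * norm (\<eta> - \<eta>0)) \<and>
      (\<exists>C. \<forall>\<eta>\<in>U. \<bar>\<integral>x. pd l 1 0 \<theta>0 \<theta>0 \<eta> x \<partial>P\<bar> \<le> C * (norm (\<eta> - \<eta>0))\<^sup>2)"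
    and A7: "I0 > 0"
    \<comment> \<open>the random sequence\<close>
    and theta_til_rv: "random_seq_in M \<Theta> theta_til"
    and theta_til: "o_P_1 M (\<lambda>n \<omega>. theta_til n \<omega> - theta_hat n \<omega>)"
  shows "O_P M
      (\<lambda>n \<omega>. ln (profile_lik H lik (\<lambda>i. X i \<omega>) n (theta_til n \<omega>))
           - (ln (profile_lik H lik (\<lambda>i. X i \<omega>) n (theta_hat n \<omega>))
              - real n / 2 * (theta_til n \<omega> - theta_hat n \<omega>)\<^sup>2 * I0))
      (\<lambda>n \<omega>. real n * \<bar>theta_til n \<omega> - theta_hat n \<omega>\<bar> ^ 3 + 1 / sqrt (real n))
    \<and> O_P M
      (\<lambda>n \<omega>. sqrt (real n) * (theta_hat n \<omega> - \<theta>0)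
           - 1 / sqrt (real n) * (\<Sum>i<n. eff (X i \<omega>) * inverse I0))
      (\<lambda>n \<omega>. 1 / sqrt (real n))"
proof -
  interpret iid_sample M P X
    by (rule iid_sample.intro[OF M iid_sample_axioms.intro]) (use indep distr in auto)
  interpret P: prob_space P by (rule prob_space_P)
  define x where "x \<omega> i = X i \<omega>" for \<omega> i

  obtain V4 where V4: "nbhd_in (\<Theta> \<times> \<Theta> \<times> H) (\<theta>0, \<theta>0, \<eta>0) V4"
    and smooth: "smooth_with_envelopes P H lik etat {(0,0), (1,0), (2,0), (3,0), (1,1), (1,2), (2,1)} V4"
    using A4_envelopes by blast
  obtain V5 where V5: "nbhd_in (\<Theta> \<times> \<Theta> \<times> H) (\<theta>0, \<theta>0, \<eta>0) V5"
    and D20: "Donsker P ((\<lambda>(t,\<theta>,\<eta>). pd l 2 0 t \<theta> \<eta>) ` V5)"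
    and D11: "Donsker P ((\<lambda>(t,\<theta>,\<eta>). pd l 1 1 t \<theta> \<eta>) ` V5)"
    using A5 by blast
  obtain U C10 C11 C20 where U: "nbhd_in H \<eta>0 U"
    and G10: "O_P_on M U
      (\<lambda>n \<eta> \<omega>. emp_proc P (\<lambda>i. X i \<omega>) n (\<lambda>x. pd l 1 0 \<theta>0 \<theta>0 \<eta> x - pd l 1 0 \<theta>0 \<theta>0 \<eta>0 x))
      (\<lambda>\<eta>. norm (\<eta> - \<eta>0))"
    and C20: "\<And>\<eta>. \<eta> \<in> U \<Longrightarrow> \<bar>(\<integral>x. pd l 2 0 \<theta>0 \<theta>0 \<eta> x \<partial>P) - (\<integral>x. pd l 2 0 \<theta>0 \<theta>0 \<eta>0 x \<partial>P)\<bar> \<le> C20 * norm (\<eta> - \<eta>0)"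
    and C11: "\<And>\<eta>. \<eta> \<in> U \<Longrightarrow> \<bar>(\<integral>x. pd l 1 1 \<theta>0 \<theta>0 \<eta> x \<partial>P) - (\<integral>x. pd l 1 1 \<theta>0 \<theta>0 \<eta>0 x \<partial>P)\<bar> \<le> C11 * norm (\<eta> - \<eta>0)"
    and C10: "\<And>\<eta>. \<eta> \<in> U \<Longrightarrow> \<bar>\<integral>x. pd l 1 0 \<theta>0 \<theta>0 \<eta> x \<partial>P\<bar> \<le> C10 * (norm (\<eta> - \<eta>0))\<^sup>2"
    using A6 by blast

  obtain r where r: "r > 0" and box4: "par_box \<theta>0 H \<eta>0 r \<subseteq> V4" and box5: "par_box \<theta>0 H \<eta>0 r \<subseteq> V5"
    and ballU: "\<And>\<eta>. \<eta> \<in> H \<Longrightarrow> norm (\<eta> - \<eta>0) < r \<Longrightarrow> \<eta> \<in> U"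
    and in_\<Theta>: "\<And>\<theta>. \<bar>\<theta> - \<theta>0\<bar> < r \<Longrightarrow> \<theta> \<in> \<Theta>"
  proof -
    obtain r4 where r4: "r4 > 0" "par_box \<theta>0 H \<eta>0 r4 \<subseteq> V4" using nbhd_in_par_box[OF V4 A1(2)] by blast
    obtain r5 where r5: "r5 > 0" "par_box \<theta>0 H \<eta>0 r5 \<subseteq> V5" using nbhd_in_par_box[OF V5 A1(2)] by blast
    obtain rU where rU: "rU > 0" "\<forall>\<eta>\<in>H. norm (\<eta> - \<eta>0) < rU \<longrightarrow> \<eta> \<in> U" using nbhd_in_ball[OF U] by blast
    obtain rT where rT: "rT > 0" "ball \<theta>0 rT \<subseteq> \<Theta>" using A1(2) mem_interior by blast
    show ?thesis
    proof (rule that[of "min (min r4 r5) (min rU rT)"])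
      show "par_box \<theta>0 H \<eta>0 (min (min r4 r5) (min rU rT)) \<subseteq> V4"
        by (rule order_trans[OF par_box_mono r4(2)]) simp
      show "par_box \<theta>0 H \<eta>0 (min (min r4 r5) (min rU rT)) \<subseteq> V5"
        by (rule order_trans[OF par_box_mono r5(2)]) simp
      show "\<theta> \<in> \<Theta>" if "\<bar>\<theta> - \<theta>0\<bar> < min (min r4 r5) (min rU rT)" for \<theta>
        using that rT(2) by (auto simp: subset_iff dist_real_def abs_minus_commute)
    qed (use r4 r5 rU rT in auto)
  qed
  let ?B = "par_box \<theta>0 H \<eta>0 r"
  have box\<eta>: "(\<theta>0, \<theta>, \<eta>) \<in> ?B" if "\<bar>\<theta> - \<theta>0\<bar> < r" "\<eta> \<in> H" "norm (\<eta> - \<eta>0) < r" for \<theta> \<eta>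
    using that r by (auto simp: par_box_def)

  obtain E where E: "integrable P E" "\<And>x. 0 \<le> E x" and reg4: "AE x in P. regular_at l E V4 x"
    using smooth_imp_regular_at[OF smooth] l_def by auto
  have reg: "AE x in P. regular_at l E ?B x"
    using reg4 by eventually_elim (rule regular_at_subset[OF _ box4])
  have int: "integrable P (pd l m k t \<theta> \<eta>)"
    if "(m,k) \<in> {(1,0), (1,1)}" "(t,\<theta>,\<eta>) \<in> ?B" for m k t \<theta> \<eta>
    using smooth_with_envelopesD(3)[OF smooth, of m k t \<theta> \<eta>] that box4 l_def by auto
  have \<eta>0B: "(\<theta>0, \<theta>0, \<eta>0) \<in> ?B" using r true_par(2) by (intro box\<eta>) auto

  \<comment> \<open>The quadratic bound on the mean score is sharp enough at \<open>\<eta>0\<close> to force mean zero.\<close>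
  have P10: "(\<integral>x. pd l 1 0 \<theta>0 \<theta>0 \<eta>0 x \<partial>P) = 0"
    using C10[of \<eta>0] ballU[OF true_par(2)] r by simp
  have P11: "(\<integral>x. pd l 1 1 \<theta>0 \<theta>0 \<eta>0 x \<partial>P) = 0"
    by (rule mixed_derivative_mean_zero[OF r true_par(2) reg E(1) _ _ A4_derivative])
      (use true_par(2) r \<eta>0B in \<open>auto intro!: int box\<eta>\<close>)
  have score_meas: "pd l 1 0 \<theta>0 \<theta>0 \<eta>0 \<in> borel_measurable P"
    using int[of 1 0, OF _ \<eta>0B] by auto
  have I0_var: "I0 = P.variance eff" by (simp add: I0_def efficient_info_def eff_def P_def)
  have score_sq: "integrable P (\<lambda>x. (pd l 1 0 \<theta>0 \<theta>0 \<eta>0 x)\<^sup>2)"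
    and I0_sq: "I0 = (\<integral>x. (pd l 1 0 \<theta>0 \<theta>0 \<eta>0 x)\<^sup>2 \<partial>P)"
    using P.positive_variance_of_AE_version[OF score_meas least_favorable P10] A7 I0_var by auto
  then have P20: "(\<integral>x. pd l 2 0 \<theta>0 \<theta>0 \<eta>0 x \<partial>P) = - I0"
    using A4_information by simp

  define S where "S n \<omega> = emp_mean (x \<omega>) n (pd l 1 0 \<theta>0 \<theta>0 \<eta>0)" for n \<omega>
  define q where "q n = 1 / sqrt (real n)" for n
  define lp where "lp n \<omega> \<theta> = ln (profile_lik H lik (x \<omega>) n \<theta>)" for n \<omega> \<theta>
  have q: "0 \<le> q n" "n \<ge> 1 \<Longrightarrow> q n \<le> 1" for n
    by (auto simp: q_def)

  \<comment> \<open>The almost sure properties of the data, for all sample sizes simultaneously.\<close>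
  define nice where "nice \<omega> \<longleftrightarrow>
      (\<forall>i. regular_at l E ?B (x \<omega> i) \<and> (\<forall>(t,\<theta>,\<eta>)\<in>V4. 0 < lik t (etat t \<theta> \<eta>) (x \<omega> i)) \<and>
        pd l 1 0 \<theta>0 \<theta>0 \<eta>0 (x \<omega> i) = eff (x \<omega> i)) \<and>
      (\<forall>n\<ge>1. \<forall>\<theta>\<in>\<Theta>. is_arg_max (lik_n lik (x \<omega>) n \<theta>) (\<lambda>\<eta>. \<eta> \<in> H) (eta_hat n \<omega> \<theta>)) \<and>
      (\<forall>n\<ge>1. is_arg_max (\<lambda>(\<theta>,\<eta>). lik_n lik (x \<omega>) n \<theta> \<eta>) (\<lambda>(\<theta>,\<eta>). \<theta> \<in> \<Theta> \<and> \<eta> \<in> H)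
        (theta_hat n \<omega>, eta_hat n \<omega> (theta_hat n \<omega>)))" for \<omega>
  have nice_whp: "whp M (\<lambda>n \<omega>. nice \<omega>)"
  proof (rule whp_AE)
    have "AE y in P. \<forall>(t,\<theta>,\<eta>)\<in>V4. 0 < lik t (etat t \<theta> \<eta>) y"
      using smooth unfolding smooth_with_envelopes_def by blast
    with reg least_favorable have "AE y in P. regular_at l E ?B y \<and>
        (\<forall>(t,\<theta>,\<eta>)\<in>V4. 0 < lik t (etat t \<theta> \<eta>) y) \<and> pd l 1 0 \<theta>0 \<theta>0 \<eta>0 y = eff y"
      by eventually_elim auto
    from AE_X[OF this] eta_hat mle show "AE \<omega> in M. nice \<omega>"
    proof eventually_elim
      case (elim \<omega>)
      have "x \<omega> = (\<lambda>i. X i \<omega>)" by (auto simp: x_def)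
      then show ?case unfolding nice_def using elim by simp
    qed
  qed
  have data: "submodel_data \<Theta> H lik etat \<theta>0 \<eta>0 r (x \<omega>) n (eta_hat n \<omega>)"
    if n: "n \<ge> 1" and nice: "nice \<omega>" for n \<omega>
  proof
    show "etat t \<theta> \<eta> \<in> H" if "(t,\<theta>,\<eta>) \<in> ?B" for t \<theta> \<eta>
      using smooth that box4 unfolding smooth_with_envelopes_def by blast
    show "0 < lik t (etat t \<theta> \<eta>) (x \<omega> i)" if "(t,\<theta>,\<eta>) \<in> ?B" for i t \<theta> \<eta>
      using nice that box4 unfolding nice_def by blast
    show "eta_hat n \<omega> \<theta> \<in> H" if "\<theta> \<in> \<Theta>" for \<theta>
      using nice that n unfolding nice_def is_arg_max_def by blast
    show "lik_n lik (x \<omega>) n \<theta> \<eta> \<le> lik_n lik (x \<omega>) n \<theta> (eta_hat n \<omega> \<theta>)" if "\<theta> \<in> \<Theta>" "\<eta> \<in> H" for \<theta> \<eta>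
      using nice that n unfolding nice_def is_arg_max_def by (meson not_le_imp_less)
  qed (use n r in_\<Theta> A2 in auto)

  \<comment> \<open>The parameter sequence has reached the box and the submodel through it is expanded.\<close>
  define good where "good th D n \<omega> \<longleftrightarrow> 0 \<le> D \<and> \<bar>th n \<omega> - \<theta>0\<bar> < r \<and> norm (eta_hat n \<omega> (th n \<omega>) - \<eta>0) < r \<and>
      expands l \<theta>0 I0 (S n \<omega>) (x \<omega>) n r D (th n \<omega>) (eta_hat n \<omega> (th n \<omega>))"
    for th :: "nat \<Rightarrow> 'w \<Rightarrow> real" and D n \<omega>
  have good_mono: "good th D' n \<omega>" if "D \<le> D'" "good th D n \<omega>" for th D D' n \<omega>
    using that expands_mono unfolding good_def by (meson order_trans)
  have good: "tightly M (good th)"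
    if th: "random_seq_in M \<Theta> th" "o_P_1 M (\<lambda>n \<omega>. th n \<omega> - \<theta>0)" for th
  proof -
    define K where "K = max C10 (max C11 C20)"
    have K: "C10 \<le> K" "C11 \<le> K" "C20 \<le> K" by (auto simp: K_def)
    have le: "a \<le> K * b" if "a \<le> c * b" "c \<le> K" "0 \<le> b" for a b c
      using that mult_right_mono[of c K b] by linarith
    have Dn: "tightly M (\<lambda>C n \<omega>. \<forall>\<eta>\<in>H. norm (\<eta> - \<eta>0) < r \<longrightarrow>
        \<bar>emp_proc P (\<lambda>i. X i \<omega>) n (pd l m k \<theta>0 \<theta>0 \<eta>)\<bar> \<le> C)"
      if "Donsker P ((\<lambda>(t,\<theta>,\<eta>). pd l m k t \<theta> \<eta>) ` V5)" for m k
    proof (rule tightly_mono[OF tightly_data[OF Donsker_tightly[OF prob_space_P that]]])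
      have "pd l m k \<theta>0 \<theta>0 \<eta> \<in> (\<lambda>(t,\<theta>,\<eta>). pd l m k t \<theta> \<eta>) ` V5" if "\<eta> \<in> H" "norm (\<eta> - \<eta>0) < r" for \<eta>
        using box\<eta>[OF _ that, of \<theta>0] box5 r by force
      then show "\<exists>C'. \<forall>\<^sub>F n in sequentially. \<forall>\<omega>\<in>space M.
          (\<forall>f\<in>(\<lambda>(t,\<theta>,\<eta>). pd l m k t \<theta> \<eta>) ` V5. \<bar>emp_proc P (\<lambda>i. X i \<omega>) n f\<bar> \<le> C) \<longrightarrow>
          (\<forall>\<eta>\<in>H. norm (\<eta> - \<eta>0) < r \<longrightarrow> \<bar>emp_proc P (\<lambda>i. X i \<omega>) n (pd l m k \<theta>0 \<theta>0 \<eta>)\<bar> \<le> C')" for C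
        by (intro exI[of _ C] always_eventually) blast
    qed
    have "tightly M (\<lambda>D n \<omega>. 0 \<le> D \<and> \<bar>th n \<omega> - \<theta>0\<bar> < r \<and> eta_hat n \<omega> (th n \<omega>) \<in> H \<and>
      norm (eta_hat n \<omega> (th n \<omega>) - \<eta>0) < r \<and>
      expands l \<theta>0 I0 (emp_mean (\<lambda>i. X i \<omega>) n (pd l 1 0 \<theta>0 \<theta>0 \<eta>0)) (\<lambda>i. X i \<omega>) n r D
        (th n \<omega>) (eta_hat n \<omega> (th n \<omega>)))"
    proof (rule expansion_tightly[where K=K and E=E, OF r true_par(2) reg E])
      fix \<eta> assume \<eta>: "\<eta> \<in> H" "norm (\<eta> - \<eta>0) < r"
      note \<eta>U = ballU[OF \<eta>]
      show "integrable P (pd l 1 0 \<theta>0 \<theta>0 \<eta>)" using \<eta> r by (intro int box\<eta>) auto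
      show "\<bar>\<integral>y. pd l 1 0 \<theta>0 \<theta>0 \<eta> y \<partial>P\<bar> \<le> K * (norm (\<eta> - \<eta>0))\<^sup>2"
        by (rule le[OF C10[OF \<eta>U] K(1)]) simp
      show "\<bar>\<integral>y. pd l 1 1 \<theta>0 \<theta>0 \<eta> y \<partial>P\<bar> \<le> K * norm (\<eta> - \<eta>0)"
        using le[OF C11[OF \<eta>U] K(2)] P11 by simp
      show "\<bar>(\<integral>y. pd l 2 0 \<theta>0 \<theta>0 \<eta> y \<partial>P) + I0\<bar> \<le> K * norm (\<eta> - \<eta>0)"
        using le[OF C20[OF \<eta>U] K(3)] P20 by simp
    next
      show "tightly M (\<lambda>C n \<omega>. \<forall>\<eta>\<in>H. norm (\<eta> - \<eta>0) < r \<longrightarrow>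
          \<bar>emp_proc P (\<lambda>i. X i \<omega>) n (\<lambda>y. pd l 1 0 \<theta>0 \<theta>0 \<eta> y - pd l 1 0 \<theta>0 \<theta>0 \<eta>0 y)\<bar>
            \<le> C * norm (\<eta> - \<eta>0))"
        using G10[unfolded O_P_on_tightly]
        by (rule tightly_mono) (intro exI always_eventually, use ballU in blast)
      show "whp M (\<lambda>n \<omega>. eta_hat n \<omega> (th n \<omega>) \<in> H)"
        using nice_whp
      proof (rule whp_mono)
        show "\<forall>\<^sub>F n in sequentially. \<forall>\<omega>\<in>space M. nice \<omega> \<longrightarrow> eta_hat n \<omega> (th n \<omega>) \<in> H"
          using data[THEN submodel_data.max_H] th(1) unfolding random_seq_in_def
          by (intro eventually_sequentiallyI[of 1]) blast
      qed
      show "O_P M (\<lambda>n \<omega>. norm (eta_hat n \<omega> (th n \<omega>) - \<eta>0)) (\<lambda>n \<omega>. 1 / sqrt (real n) + \<bar>th n \<omega> - \<theta>0\<bar>)"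
        by (rule A3[OF th])
    qed (use P10 Dn[OF D11] Dn[OF D20] th in auto)
    then show ?thesis
    proof (rule tightly_mono)
      fix D :: real
      have "x \<omega> = (\<lambda>i. X i \<omega>)" for \<omega> by (auto simp: x_def)
      then show "\<exists>D'. \<forall>\<^sub>F n in sequentially. \<forall>\<omega>\<in>space M. 0 \<le> D \<and> \<bar>th n \<omega> - \<theta>0\<bar> < r \<and> eta_hat n \<omega> (th n \<omega>) \<in> H \<and>
          norm (eta_hat n \<omega> (th n \<omega>) - \<eta>0) < r \<and>
          expands l \<theta>0 I0 (emp_mean (\<lambda>i. X i \<omega>) n (pd l 1 0 \<theta>0 \<theta>0 \<eta>0)) (\<lambda>i. X i \<omega>) n r D
            (th n \<omega>) (eta_hat n \<omega> (th n \<omega>)) \<longrightarrow> good th D' n \<omega>"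
        unfolding good_def S_def by (intro exI[of _ D] always_eventually) auto
    qed
  qed

  \<comment> \<open>The quadratic expansion of the log profile likelihood around \<open>\<theta>0\<close>, along a parameter sequence.\<close>
  define quad where "quad th D n \<omega> \<longleftrightarrow> 0 \<le> D \<and>
      \<bar>lp n \<omega> (th n \<omega>) - lp n \<omega> \<theta>0 - real n * ((th n \<omega> - \<theta>0) * S n \<omega> - I0 / 2 * (th n \<omega> - \<theta>0)\<^sup>2)\<bar>
        \<le> 4 * D * real n * (\<bar>th n \<omega> - \<theta>0\<bar> * (q n + \<bar>th n \<omega> - \<theta>0\<bar>)\<^sup>2)"
    for th :: "nat \<Rightarrow> 'w \<Rightarrow> real" and D n \<omega>
  have quad_mono: "quad th D' n \<omega>" if "D \<le> D'" "quad th D n \<omega>" for th D D' n \<omega>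
  proof -
    have "4 * D * real n * w \<le> 4 * D' * real n * w" if "0 \<le> w" for w
      using that \<open>D \<le> D'\<close> by (intro mult_right_mono) auto
    from this[of "\<bar>th n \<omega> - \<theta>0\<bar> * (q n + \<bar>th n \<omega> - \<theta>0\<bar>)\<^sup>2"] show ?thesis
      using that unfolding quad_def by auto
  qed
  have quad: "tightly M (quad th)"
    if th: "random_seq_in M \<Theta> th" "o_P_1 M (\<lambda>n \<omega>. th n \<omega> - \<theta>0)" for th
  proof -
    \<comment> \<open>The lower half of the sandwich needs the submodel through the constant sequence \<open>\<theta>0\<close>.\<close>
    have "random_seq_in M \<Theta> (\<lambda>n \<omega>. \<theta>0)" using true_par(1) by (simp add: random_seq_in_def)
    moreover have "o_P_1 M (\<lambda>n \<omega>. \<theta>0 - \<theta>0)" by (simp add: o_P_1_def)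
    ultimately have good0: "tightly M (good (\<lambda>n \<omega>. \<theta>0))" by (rule good)
    have "tightly M (\<lambda>D n \<omega>. (good th D n \<omega> \<and> good (\<lambda>n \<omega>. \<theta>0) D n \<omega>) \<and> nice \<omega>)"
      by (rule tightly_conj_whp[OF tightly_conj[OF good[OF th] good0 good_mono good_mono] nice_whp])
    then show ?thesis
    proof (rule tightly_mono)
      fix D :: real
      have "quad th D n \<omega>" if "n \<ge> 1" "good th D n \<omega>" "good (\<lambda>n \<omega>. \<theta>0) D n \<omega>" "nice \<omega>" for n \<omega>
        using submodel_data.profile_expansion[OF data[OF that(1,4)], of "th n \<omega>" D I0 "S n \<omega>"] that
        unfolding quad_def good_def lp_def q_def l_def by auto
      then show "\<exists>D'. \<forall>\<^sub>F n in sequentially. \<forall>\<omega>\<in>space M.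
          (good th D n \<omega> \<and> good (\<lambda>n \<omega>. \<theta>0) D n \<omega>) \<and> nice \<omega> \<longrightarrow> quad th D' n \<omega>"
        by (intro exI[of _ D] eventually_sequentiallyI[of 1]) auto
    qed
  qed

  \<comment> \<open>The root-\<open>n\<close> rate of the estimator, and its score equation with error of order \<open>1/n\<close>.\<close>
  define rate where "rate D n \<omega> \<longleftrightarrow> 0 \<le> D \<and> \<bar>theta_hat n \<omega> - \<theta>0\<bar> \<le> D * q n \<and>
      \<bar>S n \<omega> - (theta_hat n \<omega> - \<theta>0) * I0\<bar> \<le> D * (q n)\<^sup>2" for D n \<omega>
  have rate_mono: "rate D' n \<omega>" if "D \<le> D'" "rate D n \<omega>" for D D' n \<omega>
    using that q(1)[of n] mult_right_mono[of D D' "q n"] mult_right_mono[of D D' "(q n)\<^sup>2"]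
    unfolding rate_def by auto
  have rate: "tightly M rate"
  proof -
    have S: "tightly M (\<lambda>C n \<omega>. \<bar>S n \<omega>\<bar> \<le> C * q n)"
      using centered_emp_mean_tightly[OF score_meas score_sq P10]
      by (simp add: S_def q_def x_def[abs_def])
    have S_mono: "\<bar>S n \<omega>\<bar> \<le> C' * q n" if "C \<le> C'" "\<bar>S n \<omega>\<bar> \<le> C * q n" for C C' n \<omega>
      using that mult_right_mono[OF that(1) q(1)[of n]] by linarith
    have "tightly M (\<lambda>D n \<omega>. (good theta_hat D n \<omega> \<and> \<bar>S n \<omega>\<bar> \<le> D * q n) \<and>
        (nice \<omega> \<and> \<bar>theta_hat n \<omega> - \<theta>0\<bar> \<le> I0 / (16 * (\<bar>D\<bar> + 1))))"
    \<comment> \<open>Consistency makes the estimation error small relative to the constant \<open>D\<close> already chosen.\<close>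
    proof (rule tightly_conj_whp[OF tightly_conj[OF good[OF mle_rv mle_consistent] S good_mono S_mono]])
      show "whp M (\<lambda>n \<omega>. nice \<omega> \<and> \<bar>theta_hat n \<omega> - \<theta>0\<bar> \<le> I0 / (16 * (\<bar>D\<bar> + 1)))" for D :: real
        using A7 by (intro whp_conj nice_whp o_P_1_whp[OF mle_consistent]) auto
    qed
    then show ?thesis
    proof (rule tightly_mono)
      fix D :: real
      define K where "K = 18 * D / I0"
      define D' where "D' = max K (4 * D * (1 + K)\<^sup>2)"
      have "rate D' n \<omega>" if n: "n \<ge> 1" and g: "good theta_hat D n \<omega>" and S: "\<bar>S n \<omega>\<bar> \<le> D * q n"
        and nice: "nice \<omega>" and small: "\<bar>theta_hat n \<omega> - \<theta>0\<bar> \<le> I0 / (16 * (\<bar>D\<bar> + 1))" for n \<omega>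
      proof -
        let ?d = "theta_hat n \<omega> - \<theta>0"
        interpret sd: submodel_data \<Theta> H lik etat \<theta>0 \<eta>0 r "x \<omega>" n "eta_hat n \<omega>" by (rule data[OF n nice])
        have D: "0 \<le> D" using g by (simp add: good_def)
        have "emp_mean (x \<omega>) n (pd l 1 0 (theta_hat n \<omega>) (theta_hat n \<omega>) (eta_hat n \<omega> (theta_hat n \<omega>))) = 0"
          unfolding l_def
        proof (rule sd.score_equation)
          show "regular_at (submodel_loglik lik etat) E ?B (x \<omega> i)" for i
            using nice unfolding nice_def l_def by blast
          show "lik_n lik (x \<omega>) n t \<eta> \<le> lik_n lik (x \<omega>) n (theta_hat n \<omega>) (eta_hat n \<omega> (theta_hat n \<omega>))"
            if "t \<in> \<Theta>" "\<eta> \<in> H" for t \<eta>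
            using nice n that unfolding nice_def is_arg_max_def by (force simp: not_less)
        qed (use g in \<open>auto simp: good_def\<close>)
        then have "\<bar>0 - S n \<omega> + ?d * I0\<bar> \<le> D * (q n + \<bar>?d\<bar> + \<bar>?d\<bar>)\<^sup>2"
          using g unfolding good_def expands_def q_def by metis
        then have score: "\<bar>S n \<omega> - ?d * I0\<bar> \<le> D * (q n + \<bar>?d\<bar> + \<bar>?d\<bar>)\<^sup>2"
          by (simp add: abs_minus_commute)
        have "8 * D * \<bar>?d\<bar> \<le> 8 * D * (I0 / (16 * (\<bar>D\<bar> + 1)))"
          using small D by (intro mult_left_mono) auto
        also have "\<dots> \<le> I0 / 2" using D A7 by (simp add: field_simps)
        finally have small': "8 * D * \<bar>?d\<bar> \<le> I0 / 2" .
        note R = root_n_rate[OF A7 D q(1) q(2)[OF n] score S small', folded K_def]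
        have "K * q n \<le> D' * q n" "4 * D * (1 + K)\<^sup>2 * (q n)\<^sup>2 \<le> D' * (q n)\<^sup>2"
          using q(1)[of n] by (auto simp: D'_def intro!: mult_right_mono)
        moreover have "0 \<le> D'" using D A7 by (simp add: D'_def K_def le_max_iff_disj)
        ultimately show ?thesis using R unfolding rate_def by linarith
      qed
      then show "\<exists>D'. \<forall>\<^sub>F n in sequentially. \<forall>\<omega>\<in>space M.
          (good theta_hat D n \<omega> \<and> \<bar>S n \<omega>\<bar> \<le> D * q n) \<and>
          (nice \<omega> \<and> \<bar>theta_hat n \<omega> - \<theta>0\<bar> \<le> I0 / (16 * (\<bar>D\<bar> + 1))) \<longrightarrow> rate D' n \<omega>"
        by (intro exI[of _ D'] eventually_sequentiallyI[of 1]) auto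
    qed
  qed

  show ?thesis
  proof
    have "o_P_1 M (\<lambda>n \<omega>. theta_til n \<omega> - \<theta>0)"
      using o_P_1_add[OF theta_til mle_consistent] by simp
    then have "tightly M (\<lambda>D n \<omega>. rate D n \<omega> \<and> quad theta_til D n \<omega> \<and> quad theta_hat D n \<omega>)"
      by (intro tightly_conj rate quad theta_til_rv mle_rv mle_consistent)
        (blast intro: rate_mono quad_mono)+
    then have "O_P M (\<lambda>n \<omega>. lp n \<omega> (theta_til n \<omega>) - (lp n \<omega> (theta_hat n \<omega>)
              - real n / 2 * (theta_til n \<omega> - theta_hat n \<omega>)\<^sup>2 * I0))
        (\<lambda>n \<omega>. real n * \<bar>theta_til n \<omega> - theta_hat n \<omega>\<bar> ^ 3 + 1 / sqrt (real n))"
      unfolding O_P_tightly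
    proof (rule tightly_mono)
      fix D :: real
      have "\<bar>lp n \<omega> (theta_til n \<omega>) - (lp n \<omega> (theta_hat n \<omega>)
              - real n / 2 * (theta_til n \<omega> - theta_hat n \<omega>)\<^sup>2 * I0)\<bar>
          \<le> (D + 32 * D * (1 + D) ^ 3) * (real n * \<bar>theta_til n \<omega> - theta_hat n \<omega>\<bar> ^ 3 + 1 / sqrt (real n))"
        if "n \<ge> 1" "rate D n \<omega> \<and> quad theta_til D n \<omega> \<and> quad theta_hat D n \<omega>" for n \<omega>
        using recenter_expansion[of n D "theta_hat n \<omega> - \<theta>0" "S n \<omega>" I0
            "lp n \<omega> (theta_til n \<omega>) - lp n \<omega> \<theta>0" "theta_til n \<omega> - \<theta>0" "lp n \<omega> (theta_hat n \<omega>) - lp n \<omega> \<theta>0"] that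
        unfolding rate_def quad_def q_def by simp
      then show "\<exists>C. \<forall>\<^sub>F n in sequentially. \<forall>\<omega>\<in>space M.
          rate D n \<omega> \<and> quad theta_til D n \<omega> \<and> quad theta_hat D n \<omega> \<longrightarrow>
          \<bar>lp n \<omega> (theta_til n \<omega>) - (lp n \<omega> (theta_hat n \<omega>)
              - real n / 2 * (theta_til n \<omega> - theta_hat n \<omega>)\<^sup>2 * I0)\<bar>
          \<le> C * (real n * \<bar>theta_til n \<omega> - theta_hat n \<omega>\<bar> ^ 3 + 1 / sqrt (real n))"
        by (intro exI[of _ "D + 32 * D * (1 + D) ^ 3"] eventually_sequentiallyI[of 1]) blast
    qed
    then show "O_P M
      (\<lambda>n \<omega>. ln (profile_lik H lik (\<lambda>i. X i \<omega>) n (theta_til n \<omega>))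
           - (ln (profile_lik H lik (\<lambda>i. X i \<omega>) n (theta_hat n \<omega>))
              - real n / 2 * (theta_til n \<omega> - theta_hat n \<omega>)\<^sup>2 * I0))
      (\<lambda>n \<omega>. real n * \<bar>theta_til n \<omega> - theta_hat n \<omega>\<bar> ^ 3 + 1 / sqrt (real n))"
      by (simp add: lp_def x_def[abs_def])
  next
    have "tightly M (\<lambda>D n \<omega>. rate D n \<omega> \<and> nice \<omega>)"
      by (rule tightly_conj_whp[OF rate nice_whp])
    then show "O_P M
      (\<lambda>n \<omega>. sqrt (real n) * (theta_hat n \<omega> - \<theta>0)
           - 1 / sqrt (real n) * (\<Sum>i<n. eff (X i \<omega>) * inverse I0))
      (\<lambda>n \<omega>. 1 / sqrt (real n))"
      unfolding O_P_tightly
    proof (rule tightly_mono)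
      fix D :: real
      have "\<bar>sqrt (real n) * (theta_hat n \<omega> - \<theta>0) - 1 / sqrt (real n) * (\<Sum>i<n. eff (X i \<omega>) * inverse I0)\<bar>
          \<le> D / I0 * (1 / sqrt (real n))" if n: "n \<ge> 1" and rt: "rate D n \<omega>" and nice: "nice \<omega>" for n \<omega>
      proof -
        let ?s = "sqrt (real n)"
        have s: "?s > 0" "?s * ?s = real n" using n by auto
        have eff: "eff (X i \<omega>) = pd l 1 0 \<theta>0 \<theta>0 \<eta>0 (x \<omega> i)" for i
          using nice unfolding nice_def x_def by metis
        have "(\<Sum>i<n. eff (X i \<omega>)) = ?s * (?s * S n \<omega>)"
          using n by (simp add: eff S_def emp_mean_def mult.assoc[symmetric] s)
        then have "1 / ?s * (\<Sum>i<n. eff (X i \<omega>) * inverse I0) = ?s * S n \<omega> / I0"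
          unfolding sum_distrib_right[symmetric] using s by (simp add: divide_inverse)
        then have "?s * (theta_hat n \<omega> - \<theta>0) - 1 / ?s * (\<Sum>i<n. eff (X i \<omega>) * inverse I0) =
            - (?s * (S n \<omega> - (theta_hat n \<omega> - \<theta>0) * I0) / I0)"
          using A7 by (simp add: field_simps)
        also have "\<bar>\<dots>\<bar> = ?s * \<bar>S n \<omega> - (theta_hat n \<omega> - \<theta>0) * I0\<bar> / I0"
          using A7 s by (simp add: abs_mult)
        also have "\<dots> \<le> ?s * (D * (q n)\<^sup>2) / I0"
          using rt A7 s unfolding rate_def by (intro divide_right_mono mult_left_mono) auto
        also have "\<dots> = D / I0 * (?s * q n) * q n" by (simp add: power2_eq_square)
        also have "\<dots> = D / I0 * (1 / ?s)" using s by (simp add: q_def)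
        finally show ?thesis .
      qed
      then show "\<exists>C. \<forall>\<^sub>F n in sequentially. \<forall>\<omega>\<in>space M. rate D n \<omega> \<and> nice \<omega> \<longrightarrow>
          \<bar>sqrt (real n) * (theta_hat n \<omega> - \<theta>0) - 1 / sqrt (real n) * (\<Sum>i<n. eff (X i \<omega>) * inverse I0)\<bar>
            \<le> C * (1 / sqrt (real n))"
        by (intro exI[of _ "D / I0"] eventually_sequentiallyI[of 1]) blast
    qed
  qed
qed

end
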